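(* No $K_{3,3}$-free $12\times 18$ binary matrix has (exactly) $109$ ones.
   Context: A binary matrix is a matrix with entries in $\{0,1\}$. It is called $K_{3,3}$-free if it contains no all-one $3\times 3$ submatrix formed by arbitrary choices of three distinct rows and three distinct columns (not necessarily consecutive); equivalently, the bipartite graph whose parts are the rows and the columns, with a row adjacent to a column exactly when the corresponding entry is $1$, contains no copy of the complete bipartite graph $K_{3,3}$. *)

theory Defs
  imports "Jordan_Normal_Form.Matrix"
begin

definition binary_mat :: "nat mat \<Rightarrow> bool" where
  "binary_mat A \<longleftrightarrow> elements_mat A \<subseteq> {0, 1}"

(* The row set I and the column set J are arbitrary, not necessarily consecutive. *)
definition K33_free :: "nat mat \<Rightarrow> bool" where
  "K33_free A \<longleftrightarrow>
    \<not> (\<exists>I J. I \<subseteq> {..<dim_row A} \<and> card I = 3 \<and> J \<subseteq> {..<dim_col A} \<and> card J = 3 \<and>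
           (\<forall>i\<in>I. \<forall>j\<in>J. A $$ (i, j) = 1))"

definition num_ones :: "nat mat \<Rightarrow> nat" where
  "num_ones A = card {(i, j). i < dim_row A \<and> j < dim_col A \<and> A $$ (i, j) = 1}"

end

theory Submission
  imports Defs
begin

text \<open>
  For a row y of size r, the number D of common ones with the other rows is the sum of c - 1 over the
  columns c through y. Restricted to the columns of y, the other eleven rows form a block system in
  which two points share at most two blocks, and this bounds D in terms of r: by counting triples for
  small r, by counting pairs for large r, and for r from 10 to 12 by the variance of the sizes of the
  intersections with one block (for r = 10 and 11 also by the pairwise intersections of the columns
  that avoid y). Let V be the sum of the squares of column size minus 6, which is odd. Summing
  2 D - 6 r - 38 over all rows gives 2 V - 8, and together with counts of common columns the bounds
  on D exclude every V except 5. For V = 5 there are three columns of size 7 and two of size 5, and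
  one row of size 11 contains both columns of size 5 and none of size 7. All its inequalities are
  then nearly tight; comparing, for each of the two rows through all three columns of size 7, the
  missing pairs inside the pairwise column intersections with the total number of missing pairs
  gives a contradiction.
\<close>

section \<open>Families of blocks in which two points share at most two blocks\<close>

text \<open>The biplane 2-(11,5,2) shapes the middle sizes: it is a block system on eleven points
  with eleven blocks and 55 incidences, and deleting a block leaves ten blocks with 50. So for r =
  10 and r = 11 no argument inside the columns of y can reach the required 49 and 53, and the
  columns that avoid y must enter. The deficits \<open>5 - p x\<close>, \<open>5 - b d\<close> and
  \<open>2 - dd x z\<close> are all measured from this design.

  Since 109 = 18 * 6 + 1, the column sizes minus 6 sum to 1. If 2 D - 6 r - 38 <= r - 9 held for
  every row, its sum 2 V - 8 would be at most 1, and only V = 1 and V = 3 would remain. The obstacle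
  is a set of rows of size at most 8 that violate this. They are controlled because such a row
  shares at most four ones with any other row, which in turn lowers D for the other rows.\<close>

locale block_family =
  fixes X :: "'x set" and D :: "'d set" and a :: "'x \<Rightarrow> 'd \<Rightarrow> int"
  assumes finX: "finite X" and finD: "finite D"
    and a01: "\<And>x d. a x d = 0 \<or> a x d = 1"
    and pair_le: "\<And>x z. \<lbrakk>x \<in> X; z \<in> X; x \<noteq> z\<rbrakk> \<Longrightarrow> (\<Sum>d\<in>D. a x d * a z d) \<le> 2"
begin

definition p :: "'x \<Rightarrow> int" where "p x = (\<Sum>d\<in>D. a x d)"
definition b :: "'d \<Rightarrow> int" where "b d = (\<Sum>x\<in>X. a x d)"
definition dd :: "'x \<Rightarrow> 'x \<Rightarrow> int" where "dd x z = (\<Sum>d\<in>D. a x d * a z d)"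
abbreviation r :: int where "r \<equiv> int (card D)"
definition n :: int where "n = (\<Sum>x\<in>X. p x)"

lemma a_sq [simp]: "a x d * a x d = a x d"
  using a01[of x d] by auto

lemma a_ge0 [simp]: "0 \<le> a x d" and a_le1 [simp]: "a x d \<le> 1"
  using a01[of x d] by auto

lemma n_blocks: "n = (\<Sum>d\<in>D. b d)"
  unfolding n_def p_def b_def by (rule sum.swap)

lemma p_nonneg: "0 \<le> p x" unfolding p_def by (simp add: sum_nonneg)
lemma b_nonneg: "0 \<le> b x" unfolding b_def by (simp add: sum_nonneg)

lemma p_le_r: "p x \<le> r"
  unfolding p_def using sum_mono[of D "a x" "\<lambda>_. 1"] by simp

lemma dd_self: "dd x x = p x" unfolding dd_def p_def by simp
lemma dd_sym: "dd x z = dd z x" unfolding dd_def by (simp add: mult.commute)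
lemma dd_le: "x \<in> X \<Longrightarrow> z \<in> X \<Longrightarrow> x \<noteq> z \<Longrightarrow> dd x z \<le> 2"
  unfolding dd_def by (rule pair_le)

text \<open>Three columns share at most one row, since two rows share at most two columns.\<close>
lemma triple_le:
  assumes "i \<in> D" "j \<in> D" "k \<in> D" "i \<noteq> j" "i \<noteq> k" "j \<noteq> k"
  shows "(\<Sum>x\<in>X. a x i * a x j * a x k) \<le> 1"
proof -
  let ?S = "{x\<in>X. a x i = 1 \<and> a x j = 1 \<and> a x k = 1}"
  have fS: "finite ?S" using finX by simp
  have "x = z" if xz: "x \<in> ?S" "z \<in> ?S" for x z
  proof (rule ccontr)
    assume "x \<noteq> z"
    have "3 = (\<Sum>d\<in>{i,j,k}. a x d * a z d)" using xz assms by simp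
    also have "\<dots> \<le> (\<Sum>d\<in>D. a x d * a z d)"
      by (rule sum_mono2) (use finD assms in auto)
    finally show False using pair_le[of x z] xz \<open>x \<noteq> z\<close> by simp
  qed
  then have "card ?S \<le> Suc 0" by (subst card_le_Suc0_iff_eq[OF fS]) blast
  moreover have "(\<Sum>x\<in>X. a x i * a x j * a x k) = (\<Sum>x\<in>?S. 1)"
  proof (rule sum.mono_neutral_cong_right[OF finX])
    show "\<forall>x\<in>X - ?S. a x i * a x j * a x k = 0" using a01 by fastforce
  qed auto
  ultimately show ?thesis by simp
qed

lemma pair_cols:
  assumes "i \<in> D" "j \<in> D" "i \<noteq> j" "E \<subseteq> D - {i, j}"
  shows "(\<Sum>x\<in>X. a x i * a x j * (\<Sum>e\<in>E. a x e)) \<le> int (card E)"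
proof -
  have "(\<Sum>x\<in>X. a x i * a x j * (\<Sum>e\<in>E. a x e)) = (\<Sum>e\<in>E. \<Sum>x\<in>X. a x i * a x j * a x e)"
    by (simp add: sum_distrib_left) (rule sum.swap)
  also have "\<dots> \<le> (\<Sum>e\<in>E. 1)" by (rule sum_mono, rule triple_le) (use assms in auto)
  finally show ?thesis by simp
qed

lemma pair_cols_all:
  assumes "i \<in> D" "j \<in> D" "i \<noteq> j"
  shows "(\<Sum>x\<in>X. a x i * a x j * (p x - 2)) \<le> r - 2"
proof -
  let ?E = "D - {i, j}"
  have c2: "card {i,j} \<le> card D" using assms finD by (intro card_mono) auto
  have "card ?E = card D - 2" using assms finD by (subst card_Diff_subset) auto
  then have ce: "int (card ?E) = r - 2" using c2 assms by simp
  have "a x i * a x j * (p x - 2) = a x i * a x j * (\<Sum>e\<in>?E. a x e)" for x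
  proof -
    have "p x = (\<Sum>e\<in>?E. a x e) + (a x i + a x j)" unfolding p_def
      using sum.subset_diff[of "{i,j}" D "a x"] assms finD by auto
    then show ?thesis using a01[of x i] a01[of x j] by auto
  qed
  then have "(\<Sum>x\<in>X. a x i * a x j * (p x - 2)) = (\<Sum>x\<in>X. a x i * a x j * (\<Sum>e\<in>?E. a x e))"
    by (rule sum.cong[OF refl])
  then show ?thesis using pair_cols[OF assms, of ?E] ce by simp
qed

lemma triple_col:
  assumes "i \<in> D"
  shows "(\<Sum>x\<in>X. a x i * ((p x - 1) * (p x - 2))) \<le> (r - 1) * (r - 2)"
proof -
  have "a x i * ((p x - 1) * (p x - 2)) = (\<Sum>j\<in>D-{i}. a x i * a x j * (p x - 2))" for x
  proof -
    have "p x = (\<Sum>j\<in>D-{i}. a x j) + a x i" unfolding p_def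
      using assms finD by (simp add: sum.remove)
    then have "(\<Sum>j\<in>D-{i}. a x i * a x j * (p x - 2)) = a x i * (p x - a x i) * (p x - 2)"
      by (simp add: sum_distrib_left[symmetric] sum_distrib_right[symmetric])
    then show ?thesis using a01[of x i] by (auto simp: algebra_simps)
  qed
  then have "(\<Sum>x\<in>X. a x i * ((p x - 1) * (p x - 2))) = (\<Sum>j\<in>D-{i}. \<Sum>x\<in>X. a x i * a x j * (p x - 2))"
    by (simp only:) (rule sum.swap)
  also have "\<dots> \<le> (\<Sum>j\<in>D-{i}. r - 2)" by (rule sum_mono, rule pair_cols_all) (use assms in auto)
  also have "\<dots> = (r - 1) * (r - 2)" using assms finD
    by (simp add: of_nat_diff Suc_leI card_gt_0_iff) (metis card_gt_0_iff empty_iff of_nat_diff Suc_leI One_nat_def of_nat_1)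
  finally show ?thesis .
qed

text \<open>Both sides count ordered triples of distinct blocks; by \<open>triple_le\<close> no
  triple is met at two points.\<close>

lemma triple_total: "(\<Sum>x\<in>X. p x * ((p x - 1) * (p x - 2))) \<le> r * ((r - 1) * (r - 2))"
proof -
  have "(\<Sum>x\<in>X. p x * ((p x - 1) * (p x - 2))) = (\<Sum>i\<in>D. \<Sum>x\<in>X. a x i * ((p x - 1) * (p x - 2)))"
    unfolding p_def by (subst sum.swap) (simp add: sum_distrib_right)
  also have "\<dots> \<le> (\<Sum>i\<in>D. (r - 1) * (r - 2))" by (rule sum_mono, rule triple_col)
  finally show ?thesis by simp
qed

lemma dd_row: "x \<in> X \<Longrightarrow> (\<Sum>z\<in>X-{x}. dd x z) = (\<Sum>d\<in>D. a x d * (b d - 1))"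
proof -
  assume x: "x \<in> X"
  have "(\<Sum>z\<in>X. dd x z) = (\<Sum>d\<in>D. a x d * b d)"
    unfolding dd_def b_def by (subst sum.swap) (simp add: sum_distrib_left)
  moreover have "(\<Sum>z\<in>X. dd x z) = (\<Sum>z\<in>X-{x}. dd x z) + p x"
    using x finX by (simp add: sum.remove dd_self)
  ultimately show ?thesis unfolding p_def by (simp add: algebra_simps sum_subtractf)
qed

lemma dd_total: "(\<Sum>x\<in>X. \<Sum>z\<in>X-{x}. dd x z) = (\<Sum>d\<in>D. b d * (b d - 1))"
proof -
  have "(\<Sum>x\<in>X. \<Sum>z\<in>X-{x}. dd x z) = (\<Sum>x\<in>X. \<Sum>d\<in>D. a x d * (b d - 1))"
    by (rule sum.cong) (auto simp: dd_row)
  also have "\<dots> = (\<Sum>d\<in>D. b d * (b d - 1))"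
    unfolding b_def by (subst sum.swap) (simp add: sum_distrib_right)
  finally show ?thesis .
qed

lemma block_pairs_le: "(\<Sum>d\<in>D. b d * (b d - 1)) \<le> 2 * int (card X) * (int (card X) - 1)"
proof -
  have "(\<Sum>x\<in>X. \<Sum>z\<in>X-{x}. dd x z) \<le> (\<Sum>x\<in>X. \<Sum>z\<in>X-{x}. 2)"
    by (intro sum_mono dd_le) auto
  also have "\<dots> = (\<Sum>x\<in>X. 2 * (int (card X) - 1))"
  proof (rule sum.cong)
    fix x assume "x \<in> X"
    then have "card X \<ge> 1" using finX by (metis card_gt_0_iff empty_iff Suc_leI One_nat_def)
    then show "(\<Sum>z\<in>X-{x}. 2) = 2 * (int (card X) - 1)" using \<open>x \<in> X\<close> finX by (simp add: of_nat_diff)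
  qed simp
  finally show ?thesis unfolding dd_total[symmetric] by (simp add: algebra_simps)
qed

text \<open>\<open>2 * m * q - m * (m + 1)\<close> is the chord of the convex
  \<open>q * (q - 1)\<close> through q = m and q = m + 1, hence below it at every integer. Summed
  over the blocks this compares \<open>n\<close> with the pairs of points available; the best m has
  the average block size between m and m + 1.\<close>

lemma n_capacity:
  assumes "card X = c" "m \<ge> (0::int)"
  shows "2 * m * n \<le> 2 * int c * (int c - 1) + m * (m + 1) * r"
proof -
  have "2 * m * b d - m * (m + 1) \<le> b d * (b d - 1)" for d
  proof -
    have "(b d - m) * (b d - m - 1) \<ge> 0"
      by (cases "b d \<ge> m + 1") (auto intro: mult_nonneg_nonneg mult_nonpos_nonpos)
    then show ?thesis by (simp add: algebra_simps)
  qed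
  then have "(\<Sum>d\<in>D. 2 * m * b d - m * (m + 1)) \<le> (\<Sum>d\<in>D. b d * (b d - 1))" by (rule sum_mono)
  then have "2 * m * n - m * (m + 1) * r \<le> (\<Sum>d\<in>D. b d * (b d - 1))"
    by (simp add: sum_subtractf sum_distrib_left n_blocks mult.commute)
  then show ?thesis using block_pairs_le assms by simp
qed

end

section \<open>Triples of blocks taken from disjoint classes\<close>

context block_family begin

definition m :: "'d set \<Rightarrow> 'x \<Rightarrow> int" where "m E x = (\<Sum>d\<in>E. a x d)"

lemma m_nonneg: "0 \<le> m E x" unfolding m_def by (simp add: sum_nonneg)
lemma m_le_card: "m E x \<le> int (card E)"
  unfolding m_def using sum_mono[of E "a x" "\<lambda>_. 1"] by simp
lemma m_D: "m D x = p x" unfolding m_def p_def ..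

lemma m_union: "\<lbrakk>E \<subseteq> D; F \<subseteq> D; E \<inter> F = {}\<rbrakk> \<Longrightarrow> m (E \<union> F) x = m E x + m F x"
  unfolding m_def by (rule sum.union_disjoint) (auto intro: finite_subset[OF _ finD])

definition supp :: "'x \<Rightarrow> 'd set" where "supp x = {d \<in> D. a x d = 1}"

lemma supp_sub: "supp x \<subseteq> D" unfolding supp_def by auto

lemma m_supp: "m (supp x) z = dd x z"
proof -
  have "dd x z = (\<Sum>d\<in>D. if a x d = 1 then a z d else 0)"
    unfolding dd_def by (rule sum.cong) (use a01[of x] in auto)
  then show ?thesis unfolding m_def supp_def using finD
    by (simp add: sum.If_cases Int_def)
qed

lemma card_supp: "int (card (supp x)) = p x"
proof -
  have "m (supp x) x = int (card (supp x))" unfolding m_def by (simp add: supp_def)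
  then show ?thesis by (simp add: m_supp dd_self)
qed

lemma triple_m:
  assumes "A \<subseteq> D" "B \<subseteq> D" "C \<subseteq> D" "A \<inter> B = {}" "A \<inter> C = {}" "B \<inter> C = {}"
  shows "(\<Sum>x\<in>X. m A x * m B x * m C x) \<le> int (card A) * int (card B) * int (card C)"
proof -
  have "(\<Sum>x\<in>X. m A x * m B x * m C x) = (\<Sum>x\<in>X. \<Sum>i\<in>A. \<Sum>k\<in>C. \<Sum>j\<in>B. a x i * a x j * a x k)"
    by (rule sum.cong[OF refl]) (simp only: m_def sum_distrib_left[symmetric] sum_distrib_right[symmetric])
  also have "\<dots> = (\<Sum>i\<in>A. \<Sum>x\<in>X. \<Sum>k\<in>C. \<Sum>j\<in>B. a x i * a x j * a x k)" by (rule sum.swap)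
  also have "\<dots> = (\<Sum>i\<in>A. \<Sum>k\<in>C. \<Sum>x\<in>X. \<Sum>j\<in>B. a x i * a x j * a x k)"
    by (rule sum.cong[OF refl], rule sum.swap)
  also have "\<dots> = (\<Sum>i\<in>A. \<Sum>k\<in>C. \<Sum>j\<in>B. \<Sum>x\<in>X. a x i * a x j * a x k)"
    by (intro sum.cong[OF refl], rule sum.swap)
  also have "\<dots> \<le> (\<Sum>i\<in>A. \<Sum>k\<in>C. \<Sum>j\<in>B. 1)"
    by (intro sum_mono triple_le) (use assms in auto)
  finally show ?thesis by (simp add: mult_ac)
qed

text \<open>\<open>m A x * (m A x - 1)\<close> counts ordered pairs of distinct blocks of A through
  x; fixing the first block i reduces to \<open>triple_m\<close> for the classes {i}, A - {i} and
  C.\<close>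

lemma triple_m2:
  assumes "A \<subseteq> D" "C \<subseteq> D" "A \<inter> C = {}"
  shows "(\<Sum>x\<in>X. m A x * (m A x - 1) * m C x) \<le> int (card A) * (int (card A) - 1) * int (card C)"
proof -
  have fA: "finite A" using assms finD finite_subset by blast
  have eq: "m A x * (m A x - 1) * c = (\<Sum>i\<in>A. a x i * m (A - {i}) x * c)" for x c
  proof -
    have "(\<Sum>i\<in>A. a x i * m (A - {i}) x) = (\<Sum>i\<in>A. a x i * (m A x - 1))"
    proof (rule sum.cong)
      fix i assume "i \<in> A"
      then have "m A x = a x i + m (A - {i}) x" unfolding m_def using fA by (simp add: sum.remove)
      then show "a x i * m (A - {i}) x = a x i * (m A x - 1)" using a01[of x i] by auto
    qed simp
    also have "\<dots> = m A x * (m A x - 1)" unfolding m_def by (simp add: sum_distrib_right)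
    finally show ?thesis by (simp add: sum_distrib_right[symmetric])
  qed
  have "(\<Sum>x\<in>X. m A x * (m A x - 1) * m C x) = (\<Sum>i\<in>A. \<Sum>x\<in>X. m {i} x * m (A - {i}) x * m C x)"
    unfolding eq by (subst sum.swap) (simp add: m_def)
  also have "\<dots> \<le> (\<Sum>i\<in>A. int (card {i}) * int (card (A - {i})) * int (card C))"
    by (intro sum_mono triple_m) (use assms in auto)
  also have "\<dots> = (\<Sum>i\<in>A. (int (card A) - 1) * int (card C))"
  proof (rule sum.cong)
    fix i assume i: "i \<in> A"
    then have "card A \<ge> 1" using fA by (metis card_gt_0_iff empty_iff Suc_leI One_nat_def)
    then show "int (card {i}) * int (card (A - {i})) * int (card C) = (int (card A) - 1) * int (card C)"
      using i fA by (simp add: of_nat_diff)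
  qed simp
  finally show ?thesis by simp
qed

text \<open>The linear function is the chord of \<open>q * ((q - 1) * (q - 2))\<close> through q = k
  and q = k + 1. The third root of the difference is 2 - 2 k, and its factor
  \<open>q + 2 * k - 2\<close> is nonnegative on the relevant range.\<close>

lemma triple_bound:
  assumes "k \<ge> (2::int)"
  shows "3 * k * (k - 1) * n \<le> r * ((r - 1) * (r - 2)) + 2 * k * (k - 1) * (k + 1) * int (card X)"
proof -
  have "3 * k * (k - 1) * q - 2 * k * (k - 1) * (k + 1) \<le> q * ((q - 1) * (q - 2))" if "q \<ge> 0" for q :: int
  proof -
    have "(q - k) * (q - k - 1) \<ge> 0"
      by (cases "q \<ge> k + 1") (auto intro: mult_nonneg_nonneg mult_nonpos_nonpos)
    then have "(q - k) * (q - k - 1) * (q + 2 * k - 2) \<ge> 0" using assms that by simp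
    then show ?thesis by (simp add: algebra_simps)
  qed
  then have "(\<Sum>x\<in>X. 3 * k * (k - 1) * p x - 2 * k * (k - 1) * (k + 1)) \<le> (\<Sum>x\<in>X. p x * ((p x - 1) * (p x - 2)))"
    by (intro sum_mono) (simp add: p_nonneg)
  then have "3 * k * (k - 1) * n - 2 * k * (k - 1) * (k + 1) * int (card X) \<le> r * ((r - 1) * (r - 2))"
    using triple_total by (simp add: sum_subtractf sum_distrib_left[symmetric] sum_distrib_right[symmetric] n_def mult.commute)
  then show ?thesis by simp
qed

text \<open>Shows that a point on nearly all blocks keeps \<open>n\<close> small. Any other point z
  shares at most two blocks with x, so more than three blocks through z means at least two outside
  \<open>supp x\<close>; these form triples with blocks in \<open>supp x\<close>, and triples are
  limited by \<open>triple_m2\<close>. The factor 4 is tight for two blocks inside and two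
  outside.\<close>

lemma excess_le:
  assumes x: "x \<in> X" and big: "r - p x \<le> 3"
  shows "4 * (n - p x - 3 * (int (card X) - 1)) \<le> (r - p x) * (r - p x - 1) * p x"
proof -
  let ?Z = "D - supp x"
  have cZ: "int (card ?Z) = r - p x"
    using supp_sub[of x] finD card_supp[of x] card_mono[OF finD supp_sub[of x]]
    by (simp add: card_Diff_subset finite_subset of_nat_diff)
  have pt: "4 * (p z - 3) \<le> m ?Z z * (m ?Z z - 1) * m (supp x) z" if z: "z \<in> X - {x}" for z
  proof -
    have "p z = m ?Z z + m (supp x) z"
    proof -
      have "?Z \<union> supp x = D" using supp_sub[of x] by auto
      then show ?thesis using m_union[of ?Z "supp x" z] supp_sub[of x] m_D[of z] by auto
    qed
    moreover have "m (supp x) z \<le> 2" using z x dd_le[of z x] by (simp add: m_supp dd_sym[of x])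
    moreover have "0 \<le> m (supp x) z" "0 \<le> m ?Z z" by (rule m_nonneg)+
    moreover have "m ?Z z \<le> 3" using m_le_card[of ?Z z] cZ big by simp
    ultimately have "p z = m ?Z z + m (supp x) z" "m (supp x) z \<in> {0,1,2}" "m ?Z z \<in> {0,1,2,3}" by auto
    then show ?thesis by auto
  qed
  have "(\<Sum>z\<in>X-{x}. 4 * (p z - 3)) \<le> (\<Sum>z\<in>X-{x}. m ?Z z * (m ?Z z - 1) * m (supp x) z)"
    by (rule sum_mono) (rule pt)
  also have "\<dots> \<le> (\<Sum>z\<in>X. m ?Z z * (m ?Z z - 1) * m (supp x) z)"
  proof (rule sum_mono2)
    fix z
    have "m ?Z z * (m ?Z z - 1) \<ge> 0" using m_nonneg[of ?Z z]
      by (cases "m ?Z z = 0") auto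
    then show "0 \<le> m ?Z z * (m ?Z z - 1) * m (supp x) z" by (simp add: m_nonneg)
  qed (use finX in auto)
  also have "\<dots> \<le> int (card ?Z) * (int (card ?Z) - 1) * int (card (supp x))"
    by (rule triple_m2) (use supp_sub in auto)
  finally have s: "(\<Sum>z\<in>X-{x}. 4 * (p z - 3)) \<le> (r - p x) * (r - p x - 1) * p x"
    by (simp add: cZ card_supp)
  have "card X \<ge> 1" using x finX by (metis card_gt_0_iff empty_iff Suc_leI One_nat_def)
  then have "(\<Sum>z\<in>X-{x}. 4 * (p z - 3)) = 4 * (n - p x - 3 * (int (card X) - 1))"
    using x finX by (simp add: sum_distrib_left[symmetric] sum_subtractf n_def sum_diff1 of_nat_diff)
  with s show ?thesis by simp
qed

end

section \<open>Incidence bounds on eleven points\<close>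

locale block_family11 = block_family X D a for X :: "'x set" and D :: "'d set" and a +
  assumes cX: "card X = 11"
begin

lemma n_le_r: "n \<le> 11 * r"
  using sum_mono[of X p "\<lambda>_. r"] p_le_r cX by (simp add: n_def)

text \<open>Here and in the next five bounds, k satisfies 11 * k <= n <= 11 * (k + 1) at the bound
  itself, so that the chord is taken where the average of \<open>p\<close> lies.\<close>

lemma n_le_7: "r = 7 \<Longrightarrow> n \<le> 41" using triple_bound[of 3] cX by simp
lemma n_le_6: "r = 6 \<Longrightarrow> n \<le> 36" using triple_bound[of 3] cX by simp
lemma n_le_5: "r = 5 \<Longrightarrow> n \<le> 32" using triple_bound[of 2] cX by simp
lemma n_le_4: "r = 4 \<Longrightarrow> n \<le> 26" using triple_bound[of 2] cX by simp
lemma n_le_3: "r = 3 \<Longrightarrow> n \<le> 23" using triple_bound[of 2] cX by simp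
lemma n_le_2: "r = 2 \<Longrightarrow> n \<le> 22" using triple_bound[of 2] cX by simp

lemma n_le_big: "2 * n \<le> 55 + 5 * r" using n_capacity[of 11 4] cX by simp

text \<open>\<open>excess_le\<close> refutes every value \<open>p x\<close> >= 5 except r =
  \<open>p x\<close> = 6 with n = 36, where it only says 0 <= 0. In that case x lies on all blocks,
  so every other point lies on at most two.\<close>

lemma p_le_4:
  assumes "x \<in> X" and "r = 8 \<and> n \<ge> 43 \<or> r = 7 \<and> n \<ge> 38 \<or> r = 6 \<and> n \<ge> 36"
  shows "p x \<le> 4"
proof (rule ccontr)
  assume "\<not> p x \<le> 4"
  then have p5: "p x \<ge> 5" by simp
  have e: "4 * (n - p x - 30) \<le> (r - p x) * (r - p x - 1) * p x"
    using excess_le[OF assms(1)] assms(2) cX p5 by auto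
  have pr: "p x \<le> r" by (rule p_le_r)
  have "p x = 5 \<or> p x = 6 \<or> p x = 7 \<or> p x = 8" using pr p5 assms(2) by auto
  then have c: "r = 6 \<and> p x = 6" using e assms(2) pr by auto
  then have "card (D - supp x) = 0"
    using supp_sub[of x] finD card_supp[of x] by (simp add: card_Diff_subset finite_subset)
  then have "supp x = D" using finD supp_sub[of x] by auto
  then have "p z \<le> 2" if "z \<in> X - {x}" for z
    using that assms(1) dd_le[of x z] m_supp[of x z] m_D[of z] by auto
  then have "(\<Sum>z\<in>X-{x}. p z) \<le> (\<Sum>z\<in>X-{x}. 2)" by (rule sum_mono)
  then have "n - p x \<le> 20" using assms(1) finX cX by (simp add: n_def sum_diff1)
  then show False using c assms(2) by auto
qed

lemma n_le_8: "r = 8 \<Longrightarrow> n \<le> 44"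
proof (rule ccontr)
  assume r: "r = 8" and "\<not> n \<le> 44"
  then have "\<And>x. x \<in> X \<Longrightarrow> p x \<le> 4" by (auto intro: p_le_4)
  then have "n \<le> (\<Sum>x\<in>X. 4)" unfolding n_def by (rule sum_mono)
  with cX \<open>\<not> n \<le> 44\<close> show False by simp
qed

text \<open>n >= 47 forces three points on five blocks and eight points on four. The three heavy
  points cut the nine blocks into six classes of known sizes. Each light point needs a triple of
  blocks of one of four types, and only seven such triples are available.\<close>

lemma n_le_9:
  assumes r9: "r = 9"
  shows "n \<le> 46"
proof (rule ccontr)
  assume n47: "\<not> n \<le> 46"
  have p5: "p x \<le> 5" if x: "x \<in> X" for x
  proof (rule ccontr)
    assume "\<not> p x \<le> 5"
    then have p6: "p x \<ge> 6" by simp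
    have e: "4 * (n - p x - 30) \<le> (r - p x) * (r - p x - 1) * p x"
      using excess_le[OF x] r9 cX p6 by auto
    have "p x = 6 \<or> p x = 7 \<or> p x = 8 \<or> p x = 9" using p_le_r[of x] r9 p6 by auto
    then show False using e r9 n47 by auto
  qed
  let ?H = "{x\<in>X. p x = 5}"
  have fH: "finite ?H" using finX by auto
  have nH: "n \<le> 44 + int (card ?H) - (\<Sum>x\<in>X-?H. 4 - p x)"
  proof -
    have "n = (\<Sum>x\<in>?H. p x) + (\<Sum>x\<in>X-?H. p x)"
      unfolding n_def using finX by (subst add.commute, intro sum.subset_diff) auto
    moreover have "(\<Sum>x\<in>?H. p x) = 5 * int (card ?H)" by simp
    moreover have "(\<Sum>x\<in>X-?H. p x) = 4 * int (card (X-?H)) - (\<Sum>x\<in>X-?H. 4 - p x)" by (simp add: sum_subtractf)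
    moreover have "int (card (X - ?H)) = 11 - int (card ?H)"
      using finX cX card_mono[OF finX, of ?H] by (subst card_Diff_subset) (auto simp: of_nat_diff)
    ultimately show ?thesis by simp
  qed
  \<comment> \<open>The pair count for heavy points only. The right side is -2 for h = 4, k = 2,
    which excludes four heavy points, and 0 for h = 3, k = 1, which puts one or two of three heavy
    points on every block.\<close>
  have cov: "(\<Sum>d\<in>D. (m' d - k) * (m' d - k - 1)) \<le> 2 * int h * (int h - 1) - 10 * k * int h + 9 * k * (k+1)"
    if H: "H \<subseteq> ?H" "card H = h" and m': "m' = (\<lambda>d. \<Sum>x\<in>H. a x d)" for H h m' k
  proof -
    interpret H: block_family H D a 
    proof
      show "finite H" using finite_subset[OF H(1) fH] .
      show "(\<Sum>d\<in>D. a x d * a z d) \<le> 2" if "x \<in> H" "z \<in> H" "x \<noteq> z" for x z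
        using that H(1) by (intro pair_le) auto
    qed (use finD a01 in auto)
    have "H.n = (\<Sum>x\<in>H. 5)" unfolding H.n_def by (rule sum.cong) (use H in auto)
    then have "H.n = 5 * int h" using H by simp
    moreover have "(\<Sum>d\<in>D. H.b d * (H.b d - 1)) \<le> 2 * int h * (int h - 1)" using H.block_pairs_le H(2) by simp
    moreover have "(\<Sum>d\<in>D. (m' d - k) * (m' d - k - 1)) = (\<Sum>d\<in>D. H.b d * (H.b d - 1) - 2 * k * H.b d + k * (k + 1))"
      unfolding m' H.b_def[symmetric] by (rule sum.cong) (auto simp: algebra_simps)
    moreover have "\<dots> = (\<Sum>d\<in>D. H.b d * (H.b d - 1)) - 2 * k * H.n + 9 * k * (k + 1)"
      using r9 by (simp add: sum.distrib sum_subtractf sum_distrib_left H.n_blocks)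
    ultimately show ?thesis by (simp add: algebra_simps)
  qed
  have H3: "card ?H \<le> 3"
  proof (rule ccontr)
    assume "\<not> card ?H \<le> 3"
    then have "4 \<le> card ?H" by simp
    then obtain H where H: "H \<subseteq> ?H" "card H = 4" by (meson obtain_subset_with_card_n)
    have "(\<Sum>d\<in>D. ((\<Sum>x\<in>H. a x d) - 2) * ((\<Sum>x\<in>H. a x d) - 2 - 1)) \<le> -2"
      using cov[OF H refl, of 2] by simp
    moreover have "(\<Sum>d\<in>D. ((\<Sum>x\<in>H. a x d) - 2) * ((\<Sum>x\<in>H. a x d) - 2 - 1)) \<ge> 0"
    proof (rule sum_nonneg)
      fix d show "((\<Sum>x\<in>H. a x d) - 2) * ((\<Sum>x\<in>H. a x d) - 2 - 1) \<ge> 0"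
        by (cases "(\<Sum>x\<in>H. a x d) \<ge> 3") (auto intro: mult_nonneg_nonneg mult_nonpos_nonpos)
    qed
    ultimately show False by simp
  qed
  have le4: "4 - p x \<ge> 0" if "x \<in> X - ?H" for x using that p5[of x] by auto
  have s1: "0 \<le> (\<Sum>x\<in>X-?H. 4 - p x)" by (rule sum_nonneg) (rule le4)
  have c3: "card ?H = 3" using nH n47 H3 s1 by linarith
  have s0: "(\<Sum>x\<in>X-?H. 4 - p x) = 0" using nH n47 H3 s1 by linarith
  have p4: "p x = 4" if "x \<in> X - ?H" for x
    using sum_nonneg_0[OF _ le4 s0 that] finX by simp
  obtain u v w where uvw: "?H = {u,v,w}" "u \<noteq> v" "u \<noteq> w" "v \<noteq> w" using c3 by (auto simp: card_3_iff)
  have uX: "u \<in> X" "v \<in> X" "w \<in> X" and pu: "p u = 5" "p v = 5" "p w = 5" using uvw(1) by auto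
  define t where "t = (\<lambda>d. a u d + a v d + a w d)"
  have tH: "(\<Sum>x\<in>?H. a x d) = t d" for d unfolding uvw(1) t_def using uvw by simp
  have t0: "(\<Sum>d\<in>D. (t d - 1) * (t d - 1 - 1)) \<le> 0" using cov[OF subset_refl c3 refl, of 1] unfolding tH by simp
  moreover have tge: "0 \<le> (t d - 1) * (t d - 1 - 1)" for d
    by (cases "t d \<ge> 2") (auto intro: mult_nonneg_nonneg mult_nonpos_nonpos)
  ultimately have ts: "(\<Sum>d\<in>D. (t d - 1) * (t d - 1 - 1)) = 0" by (meson order_antisym sum_nonneg)
  have t12: "t d = 1 \<or> t d = 2" if "d \<in> D" for d
  proof -
    have "(t d - 1) * (t d - 1 - 1) = 0" by (rule sum_nonneg_0[OF finD _ ts that]) (rule tge)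
    then show ?thesis by simp
  qed
  define S1 where "S1 = {d\<in>D. a u d = 1 \<and> a v d = 0 \<and> a w d = 0}"
  define S2 where "S2 = {d\<in>D. a u d = 0 \<and> a v d = 1 \<and> a w d = 0}"
  define S3 where "S3 = {d\<in>D. a u d = 0 \<and> a v d = 0 \<and> a w d = 1}"
  define U12 where "U12 = {d\<in>D. a u d = 1 \<and> a v d = 1 \<and> a w d = 0}"
  define U13 where "U13 = {d\<in>D. a u d = 1 \<and> a v d = 0 \<and> a w d = 1}"
  define U23 where "U23 = {d\<in>D. a u d = 0 \<and> a v d = 1 \<and> a w d = 1}"
  note defs = S1_def S2_def S3_def U12_def U13_def U23_def
  have sub: "S1 \<subseteq> D" "S2 \<subseteq> D" "S3 \<subseteq> D" "U12 \<subseteq> D" "U13 \<subseteq> D" "U23 \<subseteq> D" unfolding defs by auto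
  have dsj: "S1 \<inter> S2 = {}" "S1 \<inter> S3 = {}" "S2 \<inter> S3 = {}" "S1 \<inter> U12 = {}" "S1 \<inter> U13 = {}" "S1 \<inter> U23 = {}"
    "S2 \<inter> U12 = {}" "S2 \<inter> U13 = {}" "S2 \<inter> U23 = {}" "S3 \<inter> U12 = {}" "S3 \<inter> U13 = {}" "S3 \<inter> U23 = {}"
    "U12 \<inter> U13 = {}" "U12 \<inter> U23 = {}" "U13 \<inter> U23 = {}" unfolding defs by auto
  have key: "d \<in> S1 \<or> d \<in> S2 \<or> d \<in> S3 \<or> d \<in> U12 \<or> d \<in> U13 \<or> d \<in> U23" if "d \<in> D" for d
    using t12[OF that] a01[of u d] a01[of v d] a01[of w d] that unfolding defs t_def by auto
  have Dall: "D = S1 \<union> (S2 \<union> (S3 \<union> (U12 \<union> (U13 \<union> U23))))"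
    using key sub by blast
  have su: "supp u = S1 \<union> (U12 \<union> U13)" "supp v = S2 \<union> (U12 \<union> U23)" "supp w = S3 \<union> (U13 \<union> U23)"
  proof -
    have "d \<in> supp u \<longleftrightarrow> d \<in> S1 \<union> (U12 \<union> U13)" "d \<in> supp v \<longleftrightarrow> d \<in> S2 \<union> (U12 \<union> U23)"
      "d \<in> supp w \<longleftrightarrow> d \<in> S3 \<union> (U13 \<union> U23)" for d
      using key[of d] unfolding defs supp_def by auto
    then show "supp u = S1 \<union> (U12 \<union> U13)" "supp v = S2 \<union> (U12 \<union> U23)" "supp w = S3 \<union> (U13 \<union> U23)"
      by blast+
  qed
  have mu: "dd u x = m S1 x + m U12 x + m U13 x" "dd v x = m S2 x + m U12 x + m U23 x"
    "dd w x = m S3 x + m U13 x + m U23 x"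
    "p x = m S1 x + m S2 x + m S3 x + m U12 x + m U13 x + m U23 x" for x
  proof -
    show "dd u x = m S1 x + m U12 x + m U13 x" "dd v x = m S2 x + m U12 x + m U23 x"
      "dd w x = m S3 x + m U13 x + m U23 x"
      unfolding m_supp[symmetric] su using sub dsj by (simp_all add: m_union Int_Un_distrib)
    have "p x = m (S1 \<union> (S2 \<union> (S3 \<union> (U12 \<union> (U13 \<union> U23))))) x"
      using m_D[of x] Dall by simp
    then show "p x = m S1 x + m S2 x + m S3 x + m U12 x + m U13 x + m U23 x"
      using sub dsj by (simp add: m_union Int_Un_distrib)
  qed
  have fin: "finite S1" "finite S2" "finite S3" "finite U12" "finite U13" "finite U23"
    using sub finite_subset[OF _ finD] by auto
  have cu: "int (card S1) + int (card U12) + int (card U13) = 5"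
     "int (card S2) + int (card U12) + int (card U23) = 5" "int (card S3) + int (card U13) + int (card U23) = 5"
  proof -
    have "card (supp u) = 5" "card (supp v) = 5" "card (supp w) = 5"
      using card_supp[of u] card_supp[of v] card_supp[of w] pu by simp_all
    then show "int (card S1) + int (card U12) + int (card U13) = 5"
     "int (card S2) + int (card U12) + int (card U23) = 5" "int (card S3) + int (card U13) + int (card U23) = 5"
      unfolding su using fin dsj by (simp_all add: card_Un_disjoint Int_Un_distrib)
  qed
  have cU: "int (card U12) \<le> 2" "int (card U13) \<le> 2" "int (card U23) \<le> 2"
  proof -
    have "m U12 v = (\<Sum>d\<in>U12. 1)" "m U13 w = (\<Sum>d\<in>U13. 1)" "m U23 w = (\<Sum>d\<in>U23. 1)"
      unfolding m_def defs by (auto intro!: sum.cong)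
    then show "int (card U12) \<le> 2" "int (card U13) \<le> 2" "int (card U23) \<le> 2"
      using dd_le[OF uX(1,2) uvw(2)] dd_le[OF uX(1,3) uvw(3)] dd_le[OF uX(2,3) uvw(4)]
        mu(1)[of v] mu(1)[of w] mu(2)[of w] m_nonneg[of S1 v] m_nonneg[of U13 v]
        m_nonneg[of S1 w] m_nonneg[of U12 w] m_nonneg[of S2 w] by simp_all
  qed
  have cD: "int (card S1) + int (card S2) + int (card S3) + int (card U12) + int (card U13) + int (card U23) = 9"
  proof -
    have "card (S1 \<union> (S2 \<union> (S3 \<union> (U12 \<union> (U13 \<union> U23))))) = 9" using r9 Dall by simp
    then show ?thesis using fin dsj by (simp add: card_Un_disjoint Int_Un_distrib)
  qed
  have c1: "int (card S1) = 1" "int (card S2) = 1" "int (card S3) = 1" 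
    "int (card U12) = 2" "int (card U13) = 2" "int (card U23) = 2"
    using cU cu cD by auto
  \<comment> \<open>A light point shares at most two blocks with each of u, v, w. Adding these
    bounds to its total of four blocks leaves two possibilities: it meets all three S classes, or
    exactly two of them with all three bounds tight, which fixes its U classes. Each possibility
    makes one summand positive.\<close>
  let ?f = "\<lambda>x. m S1 x * m S2 x * m U13 x + m S2 x * m S3 x * m U12 x + m S1 x * m S3 x * m U23 x + m S1 x * m S2 x * m S3 x"
  have f1: "?f x \<ge> 1" if x: "x \<in> X - ?H" for x
  proof -
    have "dd u x \<le> 2" "dd v x \<le> 2" "dd w x \<le> 2" using x uvw uX by (auto intro: dd_le)
    note le = this[unfolded mu]
    have "m S1 x + m S2 x + m S3 x + m U12 x + m U13 x + m U23 x = 4" using p4[OF x] mu(4) by simp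
    moreover have "m S1 x = 0 \<or> m S1 x = 1" "m S2 x = 0 \<or> m S2 x = 1" "m S3 x = 0 \<or> m S3 x = 1"
      using m_nonneg[of _ x] m_le_card[of S1 x] m_le_card[of S2 x] m_le_card[of S3 x] c1
      by (smt (verit))+
    moreover have "m U12 x \<ge> 0" "m U13 x \<ge> 0" "m U23 x \<ge> 0" by (simp_all add: m_nonneg)
    ultimately show ?thesis using le by auto
  qed
  have fge: "?f x \<ge> 0" for x by (simp add: m_nonneg)
  have cXH: "int (card (X - ?H)) = 8" using finX cX c3 by (subst card_Diff_subset) auto
  have "8 \<le> (\<Sum>x\<in>X-?H. ?f x)" using sum_mono[OF f1, of "X-?H"] cXH by simp
  also have "\<dots> \<le> (\<Sum>x\<in>X. ?f x)" by (rule sum_mono2) (use finX fge in auto)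
  also have "\<dots> \<le> 2 + 2 + 2 + 1" unfolding sum.distrib
    using triple_m[of S1 S2 U13] triple_m[of S2 S3 U12] triple_m[of S1 S3 U23] triple_m[of S1 S2 S3] sub dsj c1
    by (intro add_mono) auto
  finally show False by simp
qed

end

section \<open>Block variance\<close>

lemma prod_consec_nonneg: "0 \<le> (q - k) * (q - k - (1::int))"
  by (cases "q \<ge> k + 1") (auto intro: mult_nonneg_nonneg mult_nonpos_nonpos)

lemma int_upto_11: "0 \<le> (q::int) \<Longrightarrow> q \<le> 11 \<Longrightarrow> q \<in> {0,1,2,3,4,5,6,7,8,9,10,11}"
  by (smt (verit) insert_iff)

lemma sum_sq_offdiag:
  assumes "finite X" "\<And>x. x \<in> X \<Longrightarrow> f x * f x = (f x :: int)"
  shows "sum f X * (sum f X - 1) = (\<Sum>x\<in>X. \<Sum>z\<in>X-{x}. f x * f z)"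
proof -
  have "(\<Sum>x\<in>X. \<Sum>z\<in>X-{x}. f x * f z) = (\<Sum>x\<in>X. f x * sum f X - f x)"
  proof (rule sum.cong)
    fix x assume x: "x \<in> X"
    have "(\<Sum>z\<in>X-{x}. f x * f z) = f x * (sum f X - f x)"
      using x assms(1) by (simp add: sum_distrib_left[symmetric] sum_diff1)
    then show "(\<Sum>z\<in>X-{x}. f x * f z) = f x * sum f X - f x"
      using assms(2)[OF x] by (simp add: right_diff_distrib)
  qed simp
  then show ?thesis by (simp add: sum_subtractf sum_distrib_right[symmetric] algebra_simps)
qed

context block_family begin

text \<open>The constant 5 is the number of blocks through a point of the biplane, so
  \<open>kb d\<close> adds up the point deficits along the block d.\<close>

definition kb :: "'d \<Rightarrow> int" where "kb d = (\<Sum>x\<in>X. a x d * (5 - p x))"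
text \<open>The deficits from the extremal case, in which two points share exactly two blocks.\<close>
definition Del :: "'x \<Rightarrow> int" where "Del x = (\<Sum>z\<in>X-{x}. 2 - dd x z)"
definition Db :: "'d \<Rightarrow> int" where "Db d = (\<Sum>x\<in>X. \<Sum>z\<in>X-{x}. a x d * a z d * (2 - dd x z))"
definition kk :: "'d \<Rightarrow> 'd \<Rightarrow> int" where "kk d e = (\<Sum>x\<in>X. a x d * a x e)"

lemma Db_nonneg: "0 \<le> Db d"
  unfolding Db_def by (intro sum_nonneg) (use dd_le in \<open>auto intro!: mult_nonneg_nonneg\<close>)

lemma Del_part_le: "x \<in> X \<Longrightarrow> S \<subseteq> X - {x} \<Longrightarrow> (\<Sum>z\<in>S. 2 - dd x z) \<le> Del x"
  unfolding Del_def by (rule sum_mono2) (use finX dd_le in auto)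

lemma Del_nonneg: "x \<in> X \<Longrightarrow> 0 \<le> Del x"
  using Del_part_le[of x "{}"] by simp

lemma sum_kk:
  assumes "d \<in> D"
  shows "(\<Sum>e\<in>D-{d}. kk d e) = 4 * b d - kb d"
proof -
  have "(\<Sum>e\<in>D-{d}. kk d e) = (\<Sum>x\<in>X. \<Sum>e\<in>D-{d}. a x d * a x e)"
    unfolding kk_def by (rule sum.swap)
  also have "\<dots> = (\<Sum>x\<in>X. 4 * a x d - a x d * (5 - p x))"
  proof (rule sum.cong)
    fix x
    have "(\<Sum>e\<in>D-{d}. a x d * a x e) = a x d * (p x - a x d)"
      using assms finD by (simp add: sum_distrib_left[symmetric] sum_diff1 p_def)
    then show "(\<Sum>e\<in>D-{d}. a x d * a x e) = 4 * a x d - a x d * (5 - p x)"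
      by (simp add: right_diff_distrib)
  qed simp
  finally show ?thesis unfolding b_def kb_def by (simp add: sum_subtractf sum_distrib_left)
qed

text \<open>Both sides count ordered pairs of points on d, once for each further block through both;
  a pair x, z has \<open>dd x z - 1\<close> of these.\<close>

lemma sum_kk_sq:
  assumes "d \<in> D"
  shows "(\<Sum>e\<in>D-{d}. kk d e * (kk d e - 1)) = b d * (b d - 1) - Db d"
proof -
  have "(\<Sum>e\<in>D-{d}. kk d e * (kk d e - 1)) = (\<Sum>e\<in>D-{d}. \<Sum>x\<in>X. \<Sum>z\<in>X-{x}. a x d * a x e * (a z d * a z e))"
    unfolding kk_def
    by (rule sum.cong[OF refl], rule sum_sq_offdiag[OF finX]) (use a01 in \<open>auto simp: mult.assoc mult.left_commute\<close>)
  also have "\<dots> = (\<Sum>x\<in>X. \<Sum>e\<in>D-{d}. \<Sum>z\<in>X-{x}. a x d * a x e * (a z d * a z e))"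
    by (rule sum.swap)
  also have "\<dots> = (\<Sum>x\<in>X. \<Sum>z\<in>X-{x}. \<Sum>e\<in>D-{d}. a x d * a x e * (a z d * a z e))"
    by (rule sum.cong[OF refl], rule sum.swap)
  also have "\<dots> = (\<Sum>x\<in>X. \<Sum>z\<in>X-{x}. a x d * a z d - a x d * a z d * (2 - dd x z))"
  proof (intro sum.cong refl)
    fix x z
    have "(\<Sum>e\<in>D-{d}. a x d * a x e * (a z d * a z e)) = a x d * a z d * (\<Sum>e\<in>D-{d}. a x e * a z e)"
      by (simp add: sum_distrib_left mult_ac)
    also have "(\<Sum>e\<in>D-{d}. a x e * a z e) = dd x z - a x d * a z d"
      using assms finD by (simp add: dd_def sum_diff1)
    finally show "(\<Sum>e\<in>D-{d}. a x d * a x e * (a z d * a z e)) = a x d * a z d - a x d * a z d * (2 - dd x z)"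
      using a01[of x d] a01[of z d] by auto
  qed
  also have "\<dots> = (\<Sum>x\<in>X. \<Sum>z\<in>X-{x}. a x d * a z d) - Db d"
    unfolding Db_def by (simp add: sum_subtractf)
  also have "(\<Sum>x\<in>X. \<Sum>z\<in>X-{x}. a x d * a z d) = b d * (b d - 1)"
    unfolding b_def by (rule sum_sq_offdiag[symmetric, OF finX]) simp
  finally show ?thesis .
qed

text \<open>The left side is nonnegative, being a sum of products of consecutive integers, and is
  small only if d meets the other blocks in k or k + 1 points each. It therefore bounds
  \<open>kb d\<close> from below; which k is best depends on \<open>b d\<close>, so later uses offer
  several values of k at once.\<close>

lemma block_variance:
  assumes "d \<in> D"
  shows "(\<Sum>e\<in>D-{d}. (kk d e - k) * (kk d e - k - 1))
    = b d * (b d - 1) - Db d - 2 * k * (4 * b d - kb d) + (r - 1) * (k * (k + 1))"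
proof -
  have c: "int (card (D - {d})) = r - 1"
    using assms finD by (simp add: card_Diff_singleton) (metis One_nat_def Suc_leI card_gt_0_iff empty_iff of_nat_1 of_nat_diff)
  have "(\<Sum>e\<in>D-{d}. (kk d e - k) * (kk d e - k - 1))
     = (\<Sum>e\<in>D-{d}. kk d e * (kk d e - 1) - 2 * k * kk d e + k * (k + 1))"
    by (rule sum.cong) (auto simp: algebra_simps)
  also have "\<dots> = (\<Sum>e\<in>D-{d}. kk d e * (kk d e - 1)) - 2 * k * (\<Sum>e\<in>D-{d}. kk d e) + int (card (D - {d})) * (k * (k + 1))"
    by (simp add: sum.distrib sum_subtractf sum_distrib_left)
  finally show ?thesis by (simp only: sum_kk[OF assms] sum_kk_sq[OF assms] c)
qed

lemma kb_ge:
  assumes "d \<in> D"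
  shows "8 * k * b d - b d * (b d - 1) - (r - 1) * (k * (k + 1)) \<le> 2 * k * kb d"
proof -
  have "0 \<le> (\<Sum>e\<in>D-{d}. (kk d e - k) * (kk d e - k - 1))"
    by (intro sum_nonneg prod_consec_nonneg)
  then show ?thesis using block_variance[OF assms, of k] Db_nonneg[of d] by (simp add: algebra_simps)
qed

lemma sum_kb: "(\<Sum>d\<in>D. kb d) = (\<Sum>x\<in>X. p x * (5 - p x))"
proof -
  have "(\<Sum>d\<in>D. kb d) = (\<Sum>x\<in>X. \<Sum>d\<in>D. a x d * (5 - p x))" unfolding kb_def by (rule sum.swap)
  then show ?thesis unfolding p_def by (simp add: sum_distrib_right)
qed

lemma b_le_card: "b d \<le> int (card X)"
  unfolding b_def using sum_mono[of X "\<lambda>x. a x d" "\<lambda>_. 1"] by simp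

end

section \<open>Ten and eleven blocks near the biplane\<close>

context block_family11 begin

text \<open>As \<open>Del x\<close> is nonnegative, a point with \<open>p x\<close> > 5 must lie on
  blocks of size below 5 with total shortfall at least 4. This is how points on too many blocks are
  excluded later.\<close>

lemma Del_eq:
  assumes "x \<in> X"
  shows "Del x = 4 * (5 - p x) - (\<Sum>d\<in>D. a x d * (b d - 5))"
proof -
  have "int (card (X - {x})) = 10" using assms finX cX by simp
  then have "Del x = 20 - (\<Sum>d\<in>D. a x d * (b d - 1))"
    unfolding Del_def by (simp add: sum_subtractf dd_row[OF assms])
  also have "(\<Sum>d\<in>D. a x d * (b d - 1)) = (\<Sum>d\<in>D. a x d * (b d - 5) + 4 * a x d)"
    by (rule sum.cong) (auto simp: algebra_simps)
  also have "\<dots> = (\<Sum>d\<in>D. a x d * (b d - 5)) + 4 * p x"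
    unfolding p_def by (simp add: sum.distrib sum_distrib_left)
  finally show ?thesis by simp
qed

text \<open>Turns an incidence bound for r - 1 blocks into a lower bound on every block size for r
  blocks.\<close>

lemma remove_block:
  assumes "d \<in> D"
  shows "block_family11 X (D - {d}) a" "block_family.n X (D - {d}) a = n - b d" "int (card (D - {d})) = r - 1"
proof -
  show F: "block_family11 X (D - {d}) a"
  proof
    fix x z assume xz: "x \<in> X" "z \<in> X" "x \<noteq> z"
    have "(\<Sum>d\<in>D-{d}. a x d * a z d) \<le> (\<Sum>d\<in>D. a x d * a z d)"
      by (rule sum_mono2) (use finD in auto)
    then show "(\<Sum>d\<in>D-{d}. a x d * a z d) \<le> 2" using pair_le[OF xz] by simp
  qed (use finX finD a01 cX in auto)
  interpret G: block_family11 X "D - {d}" a by (rule F)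
  have "G.b e = b e" for e unfolding G.b_def b_def ..
  then show "block_family.n X (D - {d}) a = n - b d"
    unfolding G.n_blocks n_blocks using assms finD by (simp add: sum_diff1)
  show "int (card (D - {d})) = r - 1"
    using assms finD by (simp add: card_Diff_singleton) (metis One_nat_def Suc_leI card_gt_0_iff empty_iff of_nat_1 of_nat_diff)
qed

lemma sum_kap: "(\<Sum>x\<in>X. 5 - p x) = 55 - n"
  using cX by (simp add: sum_subtractf n_def)

lemma sum_kb_kap: "(\<Sum>d\<in>D. kb d) = 5 * (55 - n) - (\<Sum>x\<in>X. (5 - p x) * (5 - p x))"
proof -
  have "(\<Sum>d\<in>D. kb d) = (\<Sum>x\<in>X. 5 * (5 - p x) - (5 - p x) * (5 - p x))"
    unfolding sum_kb by (rule sum.cong) (auto simp: algebra_simps)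
  then show ?thesis by (simp add: sum_subtractf sum_kap[symmetric] sum_distrib_left)
qed

lemma b_range: "b d \<in> {0,1,2,3,4,5,6,7,8,9,10,11}"
proof -
  have "0 \<le> b d" "b d \<le> 11" using b_nonneg[of d] b_le_card[of d] cX by auto
  then show ?thesis by (rule int_upto_11)
qed

text \<open>Summing \<open>kb d >= b d - 3\<close> and using (5 - p)^2 >= 5 - p gives 4 * (55 - n)
  >= n - 30, that is n <= 50. At n = 50 every inequality used is an equality, which yields the
  structural claims.\<close>

lemma ten_blocks:
  assumes r10: "r = 10" and n50: "n \<ge> 50"
  shows "n = 50" "\<And>x. x \<in> X \<Longrightarrow> p x = 4 \<or> p x = 5" "\<And>x. x \<in> X \<Longrightarrow> p x = 5 \<Longrightarrow> Del x = 0"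
proof -
  have b4: "b d \<ge> 4" if d: "d \<in> D" for d
  proof -
    interpret G: block_family11 X "D - {d}" a by (rule remove_block(1)[OF d])
    have "G.n \<le> 46" using remove_block(3)[OF d] r10 by (intro G.n_le_9) simp
    then show ?thesis using remove_block(2)[OF d] n50 by simp
  qed
  have kb3: "kb d \<ge> b d - 3" if d: "d \<in> D" for d
    using b4[OF d] b_range[of d] kb_ge[OF d, of 1] kb_ge[OF d, of 2] kb_ge[OF d, of 3] r10 by auto
  let ?s = "\<Sum>x\<in>X. (5 - p x) * (5 - p x)"
  have s1: "(\<Sum>x\<in>X. (5 - p x) * (5 - p x - 1)) = ?s - (55 - n)"
    unfolding sum_kap[symmetric] sum_subtractf[symmetric] by (rule sum.cong) (auto simp: algebra_simps)
  have s0: "0 \<le> (\<Sum>x\<in>X. (5 - p x) * (5 - p x - 1))"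
    by (rule sum_nonneg) (use prod_consec_nonneg[of _ 0, unfolded diff_zero] in blast)
  have kbs: "(\<Sum>d\<in>D. kb d - (b d - 3)) = 5 * (55 - n) - ?s - (n - 30)"
    using r10 by (simp add: sum_subtractf sum_kb_kap n_blocks[symmetric])
  have kb0: "0 \<le> (\<Sum>d\<in>D. kb d - (b d - 3))" by (rule sum_nonneg) (use kb3 in simp)
  have arith: "N = 50 \<and> u = 0 \<and> v = 0" if "0 \<le> u" "u = s - (55 - N)" "0 \<le> v" "v = 5 * (55 - N) - s - (N - 30)" "N \<ge> 50"
    for N u v s :: int using that by presburger
  show n: "n = 50" using arith[OF s0 s1 kb0 kbs n50] by blast
  have z: "(\<Sum>x\<in>X. (5 - p x) * (5 - p x - 1)) = 0" "(\<Sum>d\<in>D. kb d - (b d - 3)) = 0"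
    using arith[OF s0 s1 kb0 kbs n50] by blast+
  show p45: "p x = 4 \<or> p x = 5" if "x \<in> X" for x
  proof -
    have "(5 - p x) * (5 - p x - 1) = 0"
      by (rule sum_nonneg_0[OF finX _ z(1) that]) (use prod_consec_nonneg[of _ 0, unfolded diff_zero] in blast)
    then show ?thesis by auto
  qed
  have kbe: "kb d = b d - 3" if "d \<in> D" for d
    using sum_nonneg_0[OF finD _ z(2) that] kb3 by simp
  show "Del x = 0" if x: "x \<in> X" and p5: "p x = 5" for x
  proof -
    \<comment> \<open>The weight \<open>p x - 4\<close> selects the points on five blocks. After
      exchanging sums, \<open>kb d = b d - 3\<close> leaves -3 times the sum of
      \<open>b d - 5\<close>, which is 0 for ten blocks with 50 incidences; so nonnegative terms sum
      to 0.\<close>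
    have "(\<Sum>x\<in>X. (p x - 4) * Del x) = (\<Sum>x\<in>X. (p x - 4) * (- (\<Sum>d\<in>D. a x d * (b d - 5))))"
    proof (rule sum.cong)
      fix x assume x: "x \<in> X"
      show "(p x - 4) * Del x = (p x - 4) * (- (\<Sum>d\<in>D. a x d * (b d - 5)))"
        using p45[OF x] Del_eq[OF x] by (cases "p x = 4") simp_all
    qed simp
    also have "\<dots> = - (\<Sum>x\<in>X. \<Sum>d\<in>D. (a x d - a x d * (5 - p x)) * (b d - 5))"
      by (simp add: sum_negf[symmetric] sum_distrib_left algebra_simps)
    also have "(\<Sum>x\<in>X. \<Sum>d\<in>D. (a x d - a x d * (5 - p x)) * (b d - 5)) = (\<Sum>d\<in>D. (b d - kb d) * (b d - 5))"
      by (subst sum.swap) (simp add: sum_distrib_right[symmetric] sum_subtractf b_def[symmetric] kb_def[symmetric])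
    also have "\<dots> = (\<Sum>d\<in>D. 3 * (b d - 5))" by (rule sum.cong) (auto simp: kbe)
    also have "\<dots> = 0" using r10 n by (simp add: sum_distrib_left[symmetric] sum_subtractf n_blocks[symmetric])
    finally have t: "(\<Sum>x\<in>X. (p x - 4) * Del x) = 0" by simp
    have "(p x - 4) * Del x = 0"
      by (rule sum_nonneg_0[OF finX _ t x]) (use p45 Del_nonneg in fastforce)
    then show ?thesis using p5 by simp
  qed
qed

lemma eleven_blocks_b_ge:
  assumes r11: "r = 11" and n54: "n \<ge> 54" and d: "d \<in> D"
  shows "b d \<ge> 4"
proof -
  interpret G: block_family11 X "D - {d}" a by (rule remove_block(1)[OF d])
  have "G.n \<le> 50" using remove_block(3)[OF d] r11 G.ten_blocks(1) by fastforce
  then show ?thesis using remove_block(2)[OF d] n54 by simp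
qed

lemma eleven_blocks_kb:
  assumes r11: "r = 11" and d: "d \<in> D" and "b d \<ge> 4"
  shows "kb d \<ge> 0" "b d \<ge> 6 \<Longrightarrow> kb d \<ge> b d - 5" "b d \<ge> 6 \<Longrightarrow> kb d \<ge> 2"
  using b_range[of d] kb_ge[OF d, of 1] kb_ge[OF d, of 2] kb_ge[OF d, of 3] r11 assms(3) by auto

lemma eleven_blocks_le: "r = 11 \<Longrightarrow> n \<le> 55"
  using n_le_big by simp

text \<open>The sum of the nonnegative \<open>kb d\<close> equals minus a sum of squares, so both
  vanish. Blocks of size at least 6 would have positive \<open>kb d\<close>, hence all sizes are
  exactly the average 5: the parameters of the biplane.\<close>

lemma eleven_blocks_55:
  assumes r11: "r = 11" and n55: "n = 55" and x: "x \<in> X"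
  shows "p x = 5" "Del x = 0"
proof -
  note bge = eleven_blocks_b_ge[OF r11] 
  have kb0: "kb d \<ge> 0" if "d \<in> D" for d using eleven_blocks_kb(1)[OF r11 that] bge[OF _ that] n55 by simp
  let ?s = "\<Sum>x\<in>X. (5 - p x) * (5 - p x)"
  have k: "(\<Sum>d\<in>D. kb d) = - ?s" using sum_kb_kap n55 by simp
  moreover have "(\<Sum>d\<in>D. kb d) \<ge> 0" by (rule sum_nonneg) (rule kb0)
  moreover have "?s \<ge> 0" by (rule sum_nonneg) simp
  ultimately have z: "?s = 0" "(\<Sum>d\<in>D. kb d) = 0" by linarith+
  have "(5 - p x) * (5 - p x) = 0" by (rule sum_nonneg_0[OF finX _ z(1) x]) simp
  then show p5: "p x = 5" by simp
  have "b d \<le> 5" if d: "d \<in> D" for d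
    using eleven_blocks_kb(3)[OF r11 d] bge[OF _ d] n55 sum_nonneg_0[OF finD _ z(2) d] kb0 by fastforce
  then have b5: "5 - b d \<ge> 0" if "d \<in> D" for d using that by simp
  have "(\<Sum>d\<in>D. 5 - b d) = 0" using r11 n55 by (simp add: sum_subtractf n_blocks[symmetric])
  then have "b d = 5" if "d \<in> D" for d using sum_nonneg_0[OF finD b5 _ that] by simp
  then show "Del x = 0" using Del_eq[OF x] p5 by simp
qed

lemma eleven_blocks_54:
  assumes r11: "r = 11" and n54: "n = 54"
  obtains x0 d4 where "x0 \<in> X" "d4 \<in> D" "\<And>x. x \<in> X \<Longrightarrow> p x = (if x = x0 then 4 else 5)"
    "\<And>x. x \<in> X \<Longrightarrow> Del x = (if x = x0 then 4 else 0) + a x d4"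
proof -
  have b4: "b d \<ge> 4" if "d \<in> D" for d using eleven_blocks_b_ge[OF r11 _ that] n54 by simp
  note kb = eleven_blocks_kb[OF r11 _ b4]
  let ?s = "\<Sum>x\<in>X. (5 - p x) * (5 - p x)"
  have k: "(\<Sum>d\<in>D. kb d) = 5 - ?s" using sum_kb_kap n54 by simp
  have ks: "(\<Sum>x\<in>X. 5 - p x) = 1" using sum_kap n54 by simp
  have bs: "(\<Sum>d\<in>D. 5 - b d) = 1" using r11 n54 by (simp add: sum_subtractf n_blocks[symmetric])
  \<comment> \<open>With \<open>p x\<close> > 5 the small blocks through x must fall short of 5 by
    at least 4 in total. Adding \<open>kb d\<close> compensates the blocks larger than 5, so the
    available shortfall is at most 1 + (5 - s) with s the sum of the squared point deficits. Then s
    <= 2, too small when a negative deficit must be offset to reach the sum 1.\<close>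
  have kapge: "5 - p x \<ge> 0" if x: "x \<in> X" for x
  proof (rule ccontr)
    assume neg: "\<not> 5 - p x \<ge> 0"
    have "0 \<le> 4 * (5 - p x) + (\<Sum>d\<in>D. a x d * (5 - b d))"
      using Del_nonneg[OF x] Del_eq[OF x] by (simp add: sum_negf[symmetric] minus_mult_right[symmetric] sum_subtractf right_diff_distrib)
    then have "4 \<le> (\<Sum>d\<in>D. a x d * (5 - b d))" using neg by simp
    also have "\<dots> \<le> (\<Sum>d\<in>D. max 0 (5 - b d))"
    proof (rule sum_mono)
      fix d show "a x d * (5 - b d) \<le> max 0 (5 - b d)" using a01[of x d] by auto
    qed
    also have "\<dots> \<le> (\<Sum>d\<in>D. (5 - b d) + kb d)"
      by (rule sum_mono) (use kb(1,2) in force)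
    also have "\<dots> = 6 - ?s" using bs k by (simp add: sum.distrib)
    finally have s: "?s \<le> 2" by simp
    have "(5 - p x) * (5 - p x) \<ge> 1" using neg by (simp add: mult_le_0_iff) (smt (verit) mult_neg_neg)
    have rest: "(\<Sum>z\<in>X-{x}. (5 - p z)) \<le> (\<Sum>z\<in>X-{x}. (5 - p z) * (5 - p z))"
    proof (rule sum_mono)
      fix z show "(5 - p z) \<le> (5 - p z) * (5 - p z)" using prod_consec_nonneg[of "5 - p z" 0] by (simp add: right_diff_distrib)
    qed
    have "1 - (5 - p x) \<le> ?s - (5 - p x) * (5 - p x)"
      using rest ks x finX by (simp add: sum_diff1)
    then show False using s neg \<open>(5 - p x) * (5 - p x) \<ge> 1\<close> by linarith
  qed
  obtain x0 where x0: "x0 \<in> X" "5 - p x0 \<ge> 1"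
  proof -
    have "\<exists>x\<in>X. 5 - p x \<ge> 1"
    proof (rule ccontr)
      assume "\<not> ?thesis"
      then have "(\<Sum>x\<in>X. 5 - p x) \<le> (\<Sum>x\<in>X. 0)" by (intro sum_mono) force
      then show False using ks by simp
    qed
    then show ?thesis using that by blast
  qed
  have r0: "(\<Sum>x\<in>X-{x0}. 5 - p x) = 1 - (5 - p x0)" using ks x0 finX by (simp add: sum_diff1)
  moreover have "0 \<le> (\<Sum>x\<in>X-{x0}. 5 - p x)" by (rule sum_nonneg) (use kapge in auto)
  ultimately have p0: "p x0 = 4" "(\<Sum>x\<in>X-{x0}. 5 - p x) = 0" using x0 by linarith+
  have px: "p x = (if x = x0 then 4 else 5)" if "x \<in> X" for x
  proof (cases "x = x0")
    case False
    then have "5 - p x = 0" using that kapge finX by (intro sum_nonneg_0[OF _ _ p0(2)]) auto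
    then show ?thesis using False by simp
  qed (simp add: p0)
  have kbx: "kb d = a x0 d" for d
  proof -
    have "kb d = (\<Sum>x\<in>X. if x = x0 then a x0 d else 0)" unfolding kb_def
      by (rule sum.cong) (auto simp: px)
    then show ?thesis using x0(1) finX by simp
  qed
  have b5: "5 - b d \<ge> 0" if "d \<in> D" for d
    using kb(3)[OF that that] kbx[of d] a_le1[of x0 d] by force
  obtain d4 where d4: "d4 \<in> D" "5 - b d4 \<ge> 1"
  proof -
    have "\<exists>d\<in>D. 5 - b d \<ge> 1"
    proof (rule ccontr)
      assume "\<not> ?thesis"
      then have "(\<Sum>d\<in>D. 5 - b d) \<le> (\<Sum>d\<in>D. 0)" by (intro sum_mono) force
      then show False using bs by simp
    qed
    then show ?thesis using that by blast
  qed
  have d4b: "b d4 = 4" using b4[OF d4(1)] d4(2) by simp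
  then have r1: "(\<Sum>d\<in>D-{d4}. 5 - b d) = 0" using bs d4 finD by (simp add: sum_diff1)
  have bd: "5 - b d = (if d = d4 then 1 else 0)" if "d \<in> D" for d
  proof (cases "d = d4")
    case False
    then have "5 - b d = 0" using that b5 finD by (intro sum_nonneg_0[OF _ _ r1]) auto
    then show ?thesis using False by simp
  qed (simp add: d4b)
  have "Del x = (if x = x0 then 4 else 0) + a x d4" if x: "x \<in> X" for x
  proof -
    have "(\<Sum>d\<in>D. a x d * (b d - 5)) = (\<Sum>d\<in>D. if d = d4 then - a x d4 else 0)"
    proof (rule sum.cong)
      fix d assume "d \<in> D"
      then show "a x d * (b d - 5) = (if d = d4 then - a x d4 else 0)" using bd[of d] by (cases "d = d4") auto
    qed simp
    then show ?thesis using Del_eq[OF x] px[OF x] d4(1) finD by simp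
  qed
  then show ?thesis using that[OF x0(1) d4(1) px] by blast
qed

end

section \<open>Columns that avoid the chosen row\<close>

context block_family11 begin

text \<open>\<open>n_le_big\<close> allows 57 for twelve blocks. The point deficits then sum to -2,
  so some point lies on six or more blocks and needs shortfall 4 from small blocks. This forces one
  block of size 3, one of size 6 and two of size 4, and two points on six blocks that both lie on
  all three small blocks.\<close>

lemma twelve_blocks:
  assumes r12: "r = 12" and n57: "n = 57"
  shows False
proof -
  have sq: "(\<Sum>d\<in>D. (b d - 4) * (b d - 4 - 1)) \<le> 4"
  proof -
    have "(\<Sum>d\<in>D. (b d - 4) * (b d - 4 - 1)) = (\<Sum>d\<in>D. b d * (b d - 1) - 8 * b d + 20)"
      by (rule sum.cong) (auto simp: algebra_simps)
    also have "\<dots> = (\<Sum>d\<in>D. b d * (b d - 1)) - 8 * n + 20 * r"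
      by (simp add: sum.distrib sum_subtractf sum_distrib_left n_blocks)
    finally show ?thesis using block_pairs_le cX r12 n57 by simp
  qed
  have b36: "b d = 3 \<or> b d = 4 \<or> b d = 5 \<or> b d = 6" if d: "d \<in> D" for d
  proof -
    have "(b d - 4) * (b d - 4 - 1) \<le> (\<Sum>d\<in>D. (b d - 4) * (b d - 4 - 1))"
      by (rule member_le_sum[OF d prod_consec_nonneg finD])
    then show ?thesis using sq b_range[of d] by auto
  qed
  define i3 i6 where "i3 = (\<lambda>d. if b d = 3 then 1 else 0 :: int)" and "i6 = (\<lambda>d. if b d = 6 then 1 else 0 :: int)"
  define n3 n6 where "n3 = (\<Sum>d\<in>D. i3 d)" and "n6 = (\<Sum>d\<in>D. i6 d)"
  have "(\<Sum>d\<in>D. (b d - 4) * (b d - 4 - 1)) = (\<Sum>d\<in>D. 2 * i3 d + 2 * i6 d)"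
    by (rule sum.cong) (use b36 in \<open>fastforce simp: i3_def i6_def\<close>)+
  then have n36: "n3 + n6 \<le> 2" using sq by (simp add: sum.distrib n3_def n6_def sum_distrib_left[symmetric])
  have n0: "n3 \<ge> 0" "n6 \<ge> 0" unfolding n3_def n6_def i3_def i6_def by (auto intro: sum_nonneg)
  have "kb d \<ge> i6 d - i3 d - 1" if d: "d \<in> D" for d
    using b36[OF d] kb_ge[OF d, of 1] kb_ge[OF d, of 2] r12 by (auto simp: i3_def i6_def)
  then have "(\<Sum>d\<in>D. i6 d - i3 d - 1) \<le> (\<Sum>d\<in>D. kb d)" by (rule sum_mono)
  then have "n6 - n3 - 12 \<le> (\<Sum>d\<in>D. kb d)" using r12 by (simp add: sum_subtractf n3_def n6_def)
  then have s_le: "(\<Sum>x\<in>X. (5 - p x) * (5 - p x)) \<le> 2 + n3 - n6" using sum_kb_kap n57 by simp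
  let ?q = "\<lambda>x. (5 - p x - (-1)) * (5 - p x - (-1) - 1)"
  have "(\<Sum>x\<in>X. ?q x) = (\<Sum>x\<in>X. (5 - p x) * (5 - p x) + (5 - p x))"
    by (rule sum.cong) (auto simp: algebra_simps)
  also have "\<dots> = (\<Sum>x\<in>X. (5 - p x) * (5 - p x)) - 2" using sum_kap n57 by (simp add: sum.distrib)
  finally have q: "(\<Sum>x\<in>X. ?q x) \<le> n3 - n6" using s_le by simp
  have q0: "0 \<le> (\<Sum>x\<in>X. ?q x)" by (intro sum_nonneg prod_consec_nonneg)
  have pos: "(\<Sum>d\<in>D. max 0 (5 - b d)) = 3 + n6"
  proof -
    have "(\<Sum>d\<in>D. max 0 (5 - b d)) = (\<Sum>d\<in>D. (5 - b d) + i6 d)"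
      by (rule sum.cong) (use b36 in \<open>fastforce simp: i6_def\<close>)+
    then show ?thesis using r12 n57 by (simp add: sum.distrib sum_subtractf n_blocks[symmetric] n6_def)
  qed
  have low: "(\<Sum>d\<in>D. (1 - a x d) * max 0 (5 - b d)) \<le> n6 - 1" if x: "x \<in> X" "p x \<ge> 6" for x
  proof -
    have "0 \<le> 4 * (5 - p x) + (\<Sum>d\<in>D. a x d * (5 - b d))"
      using Del_nonneg[OF x(1)] Del_eq[OF x(1)] by (simp add: sum_subtractf right_diff_distrib)
    then have "4 \<le> (\<Sum>d\<in>D. a x d * (5 - b d))" using x by simp
    also have "\<dots> \<le> (\<Sum>d\<in>D. a x d * max 0 (5 - b d))" by (intro sum_mono mult_left_mono) auto
    finally show ?thesis using pos by (simp add: left_diff_distrib sum_subtractf)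
  qed
  have ex: "\<exists>x\<in>S. p x \<ge> 6" if "(\<Sum>x\<in>S. 5 - p x) < 0" for S
  proof (rule ccontr)
    assume "\<not> ?thesis"
    then have "(\<Sum>x\<in>S. 5 - p x) \<ge> 0" by (intro sum_nonneg) force
    then show False using that by simp
  qed
  have "(\<Sum>x\<in>X. 5 - p x) < 0" using sum_kap n57 by simp
  then obtain x where x: "x \<in> X" "p x \<ge> 6" using ex by blast
  have "0 \<le> (\<Sum>d\<in>D. (1 - a x d) * max 0 (5 - b d))" by (intro sum_nonneg mult_nonneg_nonneg) auto
  then have n61: "n6 = 1" "n3 = 1" using low[OF x] n36 n0 q q0 by linarith+
  then have q00: "(\<Sum>x\<in>X. ?q x) = 0" using q q0 by simp
  have "?q x = 0" by (rule sum_nonneg_0[OF finX _ q00 x(1)]) (rule prod_consec_nonneg)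
  then have "p x = 6" using x by simp
  then have "(\<Sum>x\<in>X-{x}. 5 - p x) < 0" using sum_kap n57 x finX by (simp add: sum_diff1)
  then obtain z where z: "z \<in> X" "z \<noteq> x" "p z \<ge> 6" using ex by blast
  have all1: "a x d = 1" if "x \<in> X" "p x \<ge> 6" "d \<in> D" "b d \<le> 4" for x d
  proof -
    have g: "0 \<le> (1 - a x d) * max 0 (5 - b d)" for d by (intro mult_nonneg_nonneg) auto
    have "(\<Sum>d\<in>D. (1 - a x d) * max 0 (5 - b d)) = 0" using low[OF that(1,2)] n61 sum_nonneg[of D "\<lambda>d. (1 - a x d) * max 0 (5 - b d)"] g by (smt (verit))
    then have "(1 - a x d) * max 0 (5 - b d) = 0" using g sum_nonneg_0[OF finD, of "\<lambda>d. (1 - a x d) * max 0 (5 - b d)" d] that(3) by blast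
    then show ?thesis using that(4) by simp
  qed
  \<comment> \<open>The summand is the indicator of size at most 4: the corrections reduce the 2 of
    a block of size 3 to 1 and raise the -1 of the block of size 6 to 0.\<close>
  have "3 = (\<Sum>d\<in>D. (5 - b d) - i3 d + i6 d)"
    using r12 n57 n61 by (simp add: sum.distrib sum_subtractf n_blocks[symmetric] n6_def n3_def)
  also have "\<dots> \<le> (\<Sum>d\<in>D. a x d * a z d)"
  proof (rule sum_mono)
    fix d assume d: "d \<in> D"
    show "(5 - b d) - i3 d + i6 d \<le> a x d * a z d"
      using b36[OF d] all1[OF x d] all1[OF z(1,3) d] by (auto simp: i3_def i6_def)
  qed
  also have "\<dots> = dd x z" unfolding dd_def ..
  finally show False using dd_le[OF x(1) z(1)] z(2) by simp
qed

end

section \<open>The block system together with the columns outside it\<close>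

locale block_family_ext = block_family11 X D a for X :: "'x set" and D :: "'d set" and a +
  fixes R :: "'d set"
  assumes finR: "finite R" and DR: "D \<inter> R = {}"
    and col3: "\<And>i j k. \<lbrakk>i \<in> D \<union> R; j \<in> D \<union> R; k \<in> D \<union> R; i \<noteq> j; i \<noteq> k; j \<noteq> k\<rbrakk>
      \<Longrightarrow> (\<Sum>x\<in>X. a x i * a x j * a x k) \<le> 2"
begin

definition rho :: "'x \<Rightarrow> int" where "rho x = (\<Sum>S\<in>R. a x S)"
definition I :: "'d \<Rightarrow> 'd \<Rightarrow> 'x set" where "I S T = {x\<in>X. a x S = 1 \<and> a x T = 1}"

lemma fin_I: "finite (I S T)" unfolding I_def using finX by simp
lemma I_sub: "I S T \<subseteq> X" unfolding I_def by auto

lemma sum_I: "(\<Sum>x\<in>I S T. f x) = (\<Sum>x\<in>X. a x S * a x T * f x)"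
  unfolding I_def by (rule sum.mono_neutral_cong_left) (use finX a01 in fastforce)+

lemma card_I: "int (card (I S T)) = (\<Sum>x\<in>X. a x S * a x T)"
  using sum_I[of "\<lambda>_. 1" S T] by simp

lemma K33_cols:
  assumes "i \<in> D \<union> R" "j \<in> D \<union> R" "k \<in> D \<union> R" "i \<noteq> j" "i \<noteq> k" "j \<noteq> k"
    and "G \<subseteq> X" "\<And>x. x \<in> G \<Longrightarrow> a x i = 1 \<and> a x j = 1 \<and> a x k = 1"
  shows "card G \<le> 2"
proof -
  have "int (card G) = (\<Sum>x\<in>G. a x i * a x j * a x k)" using assms(8) by simp
  also have "\<dots> \<le> (\<Sum>x\<in>X. a x i * a x j * a x k)" by (rule sum_mono2) (use finX assms(7) in auto)
  finally show ?thesis using col3[OF assms(1-6)] by simp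
qed

text \<open>A block of D through z meets I S T in at most one further row, because three columns share at most two rows.\<close>
lemma I_dd_le:
  assumes "S \<in> R" "T \<in> R" "S \<noteq> T" "z \<in> I S T"
  shows "(\<Sum>u\<in>I S T - {z}. dd z u) \<le> p z"
proof -
  have "(\<Sum>u\<in>I S T - {z}. dd z u) = (\<Sum>d\<in>D. a z d * (\<Sum>u\<in>I S T - {z}. a u d))"
    unfolding dd_def by (subst sum.swap) (simp add: sum_distrib_left)
  also have "\<dots> \<le> (\<Sum>d\<in>D. a z d)"
  proof (rule sum_mono)
    fix d assume d: "d \<in> D"
    have "(\<Sum>u\<in>I S T. a u d) \<le> 2"
      unfolding sum_I using d assms DR by (intro col3) auto
    then show "a z d * (\<Sum>u\<in>I S T - {z}. a u d) \<le> a z d"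
      using assms(4) fin_I[of S T] a01[of z d] by (auto simp: sum_diff1)
  qed
  finally show ?thesis unfolding p_def .
qed

lemma I_Del_ge:
  assumes "S \<in> R" "T \<in> R" "S \<noteq> T" "z \<in> I S T"
  shows "2 * (int (card (I S T)) - 1) - p z \<le> (\<Sum>u\<in>I S T - {z}. 2 - dd z u)"
proof -
  have "card (I S T) \<ge> 1" using assms(4) fin_I by (metis One_nat_def Suc_leI card_gt_0_iff empty_iff)
  then have "int (card (I S T - {z})) = int (card (I S T)) - 1" using assms(4) fin_I[of S T] by simp
  then show ?thesis using I_dd_le[OF assms] by (simp add: sum_subtractf)
qed

text \<open>The missing pairs forced inside one intersection cannot exceed all missing pairs at z.
  In particular a point with \<open>p z = 5\<close> and \<open>Del z = 0\<close> lies in no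
  intersection of four or more points.\<close>

lemma I_le_Del:
  assumes "S \<in> R" "T \<in> R" "S \<noteq> T" "z \<in> I S T"
  shows "2 * (int (card (I S T)) - 1) \<le> p z + Del z"
  using I_Del_ge[OF assms] Del_part_le[of z "I S T - {z}"] assms(4) I_sub[of S T] by fastforce

lemma sum_I_row:
  assumes "S \<in> R"
  shows "(\<Sum>T\<in>R-{S}. int (card (I S T))) = (\<Sum>x\<in>X. a x S * (rho x - 1))"
proof -
  have "(\<Sum>T\<in>R-{S}. int (card (I S T))) = (\<Sum>x\<in>X. a x S * (\<Sum>T\<in>R-{S}. a x T))"
    unfolding card_I by (subst sum.swap) (simp add: sum_distrib_left)
  also have "\<dots> = (\<Sum>x\<in>X. a x S * (rho x - 1))"
  proof (rule sum.cong)
    fix x show "a x S * (\<Sum>T\<in>R-{S}. a x T) = a x S * (rho x - 1)"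
      using assms finR a01[of x S] by (auto simp: sum_diff1 rho_def)
  qed simp
  finally show ?thesis .
qed

lemma sum_I_total: "(\<Sum>S\<in>R. \<Sum>T\<in>R-{S}. int (card (I S T))) = (\<Sum>x\<in>X. rho x * (rho x - 1))"
proof -
  have "(\<Sum>S\<in>R. \<Sum>T\<in>R-{S}. int (card (I S T))) = (\<Sum>S\<in>R. \<Sum>x\<in>X. a x S * (rho x - 1))"
    by (rule sum.cong) (auto simp: sum_I_row)
  also have "\<dots> = (\<Sum>x\<in>X. rho x * (rho x - 1))"
    by (subst sum.swap) (simp add: rho_def sum_distrib_right)
  finally show ?thesis .
qed

lemma rho_consec: "(\<Sum>x\<in>X. (rho x - k) * (rho x - k - 1)) = (\<Sum>x\<in>X. rho x * (rho x - 1)) - 2 * k * (\<Sum>x\<in>X. rho x) + 11 * (k * (k + 1))"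
proof -
  have "(\<Sum>x\<in>X. (rho x - k) * (rho x - k - 1)) = (\<Sum>x\<in>X. rho x * (rho x - 1) - 2 * k * rho x + k * (k + 1))"
    by (rule sum.cong) (auto simp: algebra_simps)
  then show ?thesis using cX by (simp add: sum.distrib sum_subtractf sum_distrib_left)
qed

lemma sum_pairs_const: "(\<Sum>S\<in>R. \<Sum>T\<in>R-{S}. c) = int (card R) * (int (card R) - 1) * (c::int)"
proof -
  have "(\<Sum>S\<in>R. \<Sum>T\<in>R-{S}. c) = (\<Sum>S\<in>R. (int (card R) - 1) * c)"
  proof (rule sum.cong)
    fix S assume "S \<in> R"
    then show "(\<Sum>T\<in>R-{S}. c) = (int (card R) - 1) * c"
      using finR by simp (metis One_nat_def Suc_leI card_gt_0_iff empty_iff of_nat_1 of_nat_diff)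
  qed simp
  then show ?thesis by simp
qed

text \<open>If n = 50, an intersection of at least four points lies in the set F of the five points
  with \<open>p x = 4\<close>. Convexity of rho (rho - 1) demands 172 over ordered pairs of columns,
  against 56 * 3 = 168. Hence exactly one pair exceeds 3, it meets in all of F, and everything is
  tight; the column sizes then add up to at least 50 instead of 49.\<close>

lemma ten_blocks_le:
  assumes r10: "r = 10" and R8: "card R = 8" and tot: "(\<Sum>x\<in>X. rho x) = 99 - n"
  shows "n \<le> 49"
proof (rule ccontr)
  assume "\<not> n \<le> 49"
  then have n50: "n \<ge> 50" by simp
  note tb = ten_blocks[OF r10 n50]
  let ?F = "{x\<in>X. p x = 4}"
  have fF: "finite ?F" using finX by simp
  have cF: "card ?F = 5"
  proof -
    have "(\<Sum>x\<in>X. 5 - p x) = (\<Sum>x\<in>?F. 1)"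
      by (rule sum.mono_neutral_cong_right) (use finX tb(2) in force)+
    then show ?thesis using sum_kap tb(1) by simp
  qed
  have sq: "172 \<le> (\<Sum>x\<in>X. rho x * (rho x - 1))"
  proof -
    have "0 \<le> (\<Sum>x\<in>X. (rho x - 4) * (rho x - 4 - 1))" by (intro sum_nonneg prod_consec_nonneg)
    then show ?thesis using rho_consec[of 4] tot tb(1) by simp
  qed
  have big: "I S T \<subseteq> ?F" if "S \<in> R" "T \<in> R" "S \<noteq> T" "card (I S T) \<ge> 4" for S T
  proof
    fix z assume z: "z \<in> I S T"
    then have zX: "z \<in> X" using I_sub by auto
    show "z \<in> ?F" using I_le_Del[OF that(1-3) z] tb(2,3)[OF zX] that(4) zX by auto
  qed
  have exb: "\<exists>S\<in>R. \<exists>T\<in>R-{S}. card (I S T) \<ge> 4"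
  proof (rule ccontr)
    assume "\<not> ?thesis"
    then have "(\<Sum>S\<in>R. \<Sum>T\<in>R-{S}. int (card (I S T))) \<le> (\<Sum>S\<in>R. \<Sum>T\<in>R-{S}. 3)"
      by (intro sum_mono) force
    then show False using sq sum_I_total sum_pairs_const[of 3] R8 by simp
  qed
  then obtain S S' where S: "S \<in> R" "S' \<in> R" "S \<noteq> S'" "card (I S S') \<ge> 4" by auto
  have others: "card (I T U) \<le> 3" if TU: "T \<in> R" "U \<in> R" "T \<noteq> U" "T \<notin> {S,S'} \<or> U \<notin> {S,S'}" for T U
  proof (rule ccontr)
    assume "\<not> card (I T U) \<le> 3"
    then have c4: "card (I T U) \<ge> 4" by simp
    have TU': "T \<noteq> U" by (rule TU(3))
    \<comment> \<open>Two sets of size at least 4 inside the 5-set F share three points, which would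
      lie on three common columns.\<close>
    have "card (I S S' \<union> I T U) \<le> 5"
      using card_mono[OF fF Un_least[OF big[OF S] big[OF TU(1-3) c4]]] cF by simp
    then have "card (I S S' \<inter> I T U) \<ge> 3"
      using card_Un_Int[of "I S S'" "I T U"] fin_I c4 S(4) by simp
    moreover have "card (I S S' \<inter> I T U) \<le> 2"
    proof (cases "T \<notin> {S,S'}")
      case True
      then show ?thesis using S TU I_sub by (intro K33_cols[of S S' T]) (auto simp: I_def)
    next
      case False
      then show ?thesis using S TU I_sub by (intro K33_cols[of S S' U]) (auto simp: I_def)
    qed
    ultimately show False by simp
  qed
  have IF: "card (I S S') \<le> 5" using card_mono[OF fF big[OF S]] cF by simp
  define g where "g = (\<lambda>T U. 3 - int (card (I T U)) + (if {T,U} = {S,S'} then 2 else 0))"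
  have g0: "g T U \<ge> 0" if "T \<in> R" "U \<in> R - {T}" for T U
  proof (cases "{T,U} = {S,S'}")
    case True
    then have "I T U = I S S'" by (auto simp: doubleton_eq_iff I_def)
    then show ?thesis using True IF by (simp add: g_def)
  next
    case False
    then have "T \<notin> {S,S'} \<or> U \<notin> {S,S'}" using that S(3) by auto
    then have "card (I T U) \<le> 3" using that by (intro others) auto
    then show ?thesis using False by (simp add: g_def)
  qed
  have corr: "(\<Sum>T\<in>R. \<Sum>U\<in>R-{T}. if {T,U} = {S,S'} then 2 else 0 :: int) = 4"
  proof -
    have "(\<Sum>T\<in>R. \<Sum>U\<in>R-{T}. if {T,U} = {S,S'} then 2 else 0 :: int)
        = (\<Sum>T\<in>R. if T = S then 2 else if T = S' then 2 else 0)"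
    proof (rule sum.cong)
      fix T assume T: "T \<in> R"
      have "(\<Sum>U\<in>R-{T}. if {T,U} = {S,S'} then 2 else 0 :: int)
         = (\<Sum>U\<in>R-{T}. if T = S \<and> U = S' \<or> T = S' \<and> U = S then 2 else 0)"
        by (rule sum.cong) (auto simp: doubleton_eq_iff)
      also have "\<dots> = (if T = S then 2 else if T = S' then 2 else 0)"
        using S finR by (cases "T = S"; cases "T = S'") auto
      finally show "(\<Sum>U\<in>R-{T}. if {T,U} = {S,S'} then 2 else 0 :: int) = (if T = S then 2 else if T = S' then 2 else 0)" .
    qed simp
    also have "\<dots> = (\<Sum>T\<in>{S,S'}. 2)"
      by (rule sum.mono_neutral_cong_right) (use finR S in auto)
    finally show ?thesis using S(3) by simp
  qed
  have "(\<Sum>T\<in>R. \<Sum>U\<in>R-{T}. g T U) = 168 - (\<Sum>x\<in>X. rho x * (rho x - 1)) + 4"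
    unfolding g_def sum.distrib sum_subtractf corr sum_I_total sum_pairs_const using R8 by simp
  moreover have "0 \<le> (\<Sum>T\<in>R. \<Sum>U\<in>R-{T}. g T U)" by (intro sum_nonneg) (rule g0)
  ultimately have gz: "(\<Sum>T\<in>R. \<Sum>U\<in>R-{T}. g T U) = 0" and s172: "(\<Sum>x\<in>X. rho x * (rho x - 1)) = 172"
    using sq by linarith+
  have gT: "(\<Sum>U\<in>R-{T}. g T U) = 0" if "T \<in> R" for T
  proof -
    have nn: "0 \<le> (\<Sum>U\<in>R-{T}. g T U)" if "T \<in> R" for T by (rule sum_nonneg) (use g0 that in auto)
    then show ?thesis by (rule sum_nonneg_0[OF finR _ gz that])
  qed
  have geq: "g T U = 0" if "T \<in> R" "U \<in> R" "T \<noteq> U" for T U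
    by (rule sum_nonneg_0[OF _ _ gT[OF that(1)]]) (use that finR g0 in auto)
  have I3: "card (I T U) = 3" if "T \<in> R" "U \<in> R" "T \<noteq> U" "{T,U} \<noteq> {S,S'}" for T U
    using geq[OF that(1-3)] that(4) by (simp add: g_def)
  have I5: "card (I S S') = 5" using geq[OF S(1-3)] by (simp add: g_def)
  have rho45: "rho x \<le> 5" if "x \<in> X" for x
  proof -
    have z: "(\<Sum>x\<in>X. (rho x - 4) * (rho x - 4 - 1)) = 0" using rho_consec[of 4] tot tb(1) s172 by simp
    have "(rho x - 4) * (rho x - 4 - 1) = 0" by (rule sum_nonneg_0[OF finX prod_consec_nonneg z that])
    then show ?thesis by auto
  qed
  define sz where "sz = (\<lambda>T. \<Sum>x\<in>X. a x T)"
  \<comment> \<open>The seven intersections of T have size 3 each, and a point of T lies on at most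
    four other columns, so 21 <= 4 * sz T.\<close>
  have sz_rest: "sz T \<ge> 6" if T: "T \<in> R" "T \<noteq> S" "T \<noteq> S'" for T
  proof -
    have "(\<Sum>U\<in>R-{T}. int (card (I T U))) = (\<Sum>U\<in>R-{T}. 3)"
    proof (rule sum.cong)
      fix U assume "U \<in> R - {T}"
      then show "int (card (I T U)) = 3" using I3[of T U] T by (auto simp: doubleton_eq_iff)
    qed simp
    also have "\<dots> = 21" using T finR R8 by simp
    finally have "21 = (\<Sum>x\<in>X. a x T * (rho x - 1))" using sum_I_row[OF T(1)] by simp
    also have "\<dots> \<le> (\<Sum>x\<in>X. a x T * 4)" by (intro sum_mono mult_left_mono) (use rho45 in force)+
    finally show ?thesis unfolding sz_def by (simp add: sum_distrib_right[symmetric])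
  qed
  \<comment> \<open>Each of the six other columns meets T in three points, at most two of them on
    T', so it has a point on T outside T'. Such a point serves at most four of the six columns, so
    at least two points of T lie off T', besides the five common ones.\<close>
  have sz_S: "sz T \<ge> 7" if T: "T \<in> R" "T' \<in> R" "T \<noteq> T'" and E: "{T,T'} = {S,S'}" for T T'
  proof -
    have c5: "card (I T T') = 5" using I5 E by (auto simp: doubleton_eq_iff I_def conj_commute)
    let ?G = "\<lambda>x. a x T * (1 - a x T')"
    have "(\<Sum>x\<in>X. ?G x * (\<Sum>U\<in>R-{T,T'}. a x U)) = (\<Sum>U\<in>R-{T,T'}. \<Sum>x\<in>X. ?G x * a x U)"
      by (simp add: sum_distrib_left) (rule sum.swap)
    also have "\<dots> \<ge> (\<Sum>U\<in>R-{T,T'}. 1)"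
    proof (rule sum_mono)
      fix U assume U: "U \<in> R - {T,T'}"
      have "(\<Sum>x\<in>X. ?G x * a x U) = int (card (I T U)) - (\<Sum>x\<in>X. a x T * a x T' * a x U)"
        unfolding card_I by (simp add: sum_subtractf[symmetric] algebra_simps)
      moreover have "(\<Sum>x\<in>X. a x T * a x T' * a x U) \<le> 2" using U T by (intro col3) auto
      moreover have "card (I T U) = 3" using U T E by (intro I3) (auto simp: doubleton_eq_iff)
      ultimately show "1 \<le> (\<Sum>x\<in>X. ?G x * a x U)" by simp
    qed
    moreover have "(\<Sum>U\<in>R-{T,T'}. 1) = (6::int)" using T R8 finR by (simp add: card_Diff_subset)
    ultimately have "6 \<le> (\<Sum>x\<in>X. ?G x * (\<Sum>U\<in>R-{T,T'}. a x U))" by simp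
    also have "\<dots> \<le> (\<Sum>x\<in>X. ?G x * 4)"
    proof (rule sum_mono)
      fix x assume x: "x \<in> X"
      have "(\<Sum>U\<in>R-{T,T'}. a x U) = rho x - (a x T + a x T')"
        unfolding rho_def using T finR sum.subset_diff[of "{T,T'}" R "a x"] by auto
      then show "?G x * (\<Sum>U\<in>R-{T,T'}. a x U) \<le> ?G x * 4"
        using rho45[OF x] a01[of x T] a01[of x T'] by auto
    qed
    finally have "2 \<le> (\<Sum>x\<in>X. ?G x)" by (simp add: sum_distrib_right[symmetric])
    moreover have "(\<Sum>x\<in>X. ?G x) = sz T - int (card (I T T'))"
      unfolding sz_def card_I by (simp add: sum_subtractf[symmetric] algebra_simps)
    ultimately show ?thesis using c5 by simp
  qed
  have "49 = (\<Sum>T\<in>R. sz T)" using tot tb(1) unfolding rho_def sz_def by (subst sum.swap) simp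
  also have "\<dots> = (\<Sum>T\<in>R-{S,S'}. sz T) + (sz S + sz S')"
    using sum.subset_diff[of "{S,S'}" R sz] S finR by auto
  also have "\<dots> \<ge> (\<Sum>T\<in>R-{S,S'}. 6) + (7 + 7)"
    by (intro add_mono sum_mono sz_rest sz_S[of S S'] sz_S[of S' S]) (use S in auto)
  moreover have "(\<Sum>T\<in>R-{S,S'}. 6) = (36::int)" using S R8 finR by (simp add: card_Diff_subset)
  ultimately show False by simp
qed

text \<open>For n = 54 convexity demands 132 over ordered pairs, more than 42 * 3 = 126, so some
  intersection has four points; all of them except possibly \<open>x0\<close> lie on
  \<open>d4\<close>, giving three points on three columns. For n = 55 all intersections have size
  exactly 3, and a column S through the only point with rho = 3 satisfies 18 = 3 * size - 1,
  impossible modulo 3.\<close>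

lemma eleven_blocks_le_53:
  assumes r11: "r = 11" and R7: "card R = 7" and tot: "(\<Sum>x\<in>X. rho x) = 98 - n"
  shows "n \<le> 53"
proof (rule ccontr)
  assume "\<not> n \<le> 53"
  then have n: "n = 54 \<or> n = 55" using eleven_blocks_le[OF r11] by linarith
  have sq: "6 * (98 - n) - 132 \<le> (\<Sum>x\<in>X. rho x * (rho x - 1))"
  proof -
    have "0 \<le> (\<Sum>x\<in>X. (rho x - 3) * (rho x - 3 - 1))" by (intro sum_nonneg prod_consec_nonneg)
    then show ?thesis using rho_consec[of 3] tot by simp
  qed
  show False
  proof (cases "n = 54")
    case True
    obtain x0 d4 where x0: "x0 \<in> X" "d4 \<in> D" "\<And>x. x \<in> X \<Longrightarrow> p x = (if x = x0 then 4 else 5)"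
      "\<And>x. x \<in> X \<Longrightarrow> Del x = (if x = x0 then 4 else 0) + a x d4"
      using eleven_blocks_54[OF r11 True] by metis
    have "card (I S T) \<le> 3" if ST: "S \<in> R" "T \<in> R - {S}" for S T
    proof (rule ccontr)
      assume "\<not> card (I S T) \<le> 3"
      then have c4: "card (I S T) \<ge> 4" by simp
      have "a z d4 = 1" if z: "z \<in> I S T - {x0}" for z
      proof -
        have zX: "z \<in> X" using z I_sub by auto
        show ?thesis using I_le_Del[of S T z] ST z c4 x0(3,4)[OF zX] a01[of z d4] by auto
      qed
      then have "card (I S T - {x0}) \<le> 2" using ST x0(2) DR I_sub[of S T]
        by (intro K33_cols[of S T d4]) (auto simp: I_def)
      moreover have "card (I S T) \<le> card (I S T - {x0}) + 1"
        using card_Diff1_le[of "I S T" x0] fin_I[of S T] by (cases "x0 \<in> I S T") (auto simp: card_Suc_Diff1)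
      ultimately show False using c4 by simp
    qed
    then have "(\<Sum>S\<in>R. \<Sum>T\<in>R-{S}. int (card (I S T))) \<le> (\<Sum>S\<in>R. \<Sum>T\<in>R-{S}. 3)"
      by (intro sum_mono) force
    then show False using sq sum_I_total sum_pairs_const[of 3] R7 True by simp
  next
    case False
    then have n55: "n = 55" using n by simp
    note e = eleven_blocks_55[OF r11 n55]
    have I3: "card (I S T) \<le> 3" if ST: "S \<in> R" "T \<in> R - {S}" for S T
    proof (cases "I S T = {}")
      case False
      then obtain z where z: "z \<in> I S T" by blast
      then have "z \<in> X" using I_sub by auto
      then show ?thesis using I_le_Del[of S T z] ST z e[of z] by auto
    qed simp
    let ?h = "\<lambda>S T. 3 - int (card (I S T))"
    have h0: "0 \<le> ?h S T" if "S \<in> R" "T \<in> R - {S}" for S T using I3[OF that] by simp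
    have hs: "(\<Sum>S\<in>R. \<Sum>T\<in>R-{S}. ?h S T) = 126 - (\<Sum>x\<in>X. rho x * (rho x - 1))"
      unfolding sum_subtractf sum_I_total sum_pairs_const using R7 by simp
    have nn: "0 \<le> (\<Sum>T\<in>R-{S}. ?h S T)" if "S \<in> R" for S by (rule sum_nonneg) (use h0 that in auto)
    have s126: "(\<Sum>x\<in>X. rho x * (rho x - 1)) = 126"
      using hs sq n55 sum_nonneg[of R "\<lambda>S. \<Sum>T\<in>R-{S}. ?h S T"] nn by (smt (verit))
    then have h00: "(\<Sum>S\<in>R. \<Sum>T\<in>R-{S}. ?h S T) = 0" using hs by simp
    have hS: "(\<Sum>T\<in>R-{S}. ?h S T) = 0" if "S \<in> R" for S by (rule sum_nonneg_0[OF finR nn h00 that])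
    have rz: "(\<Sum>x\<in>X. (rho x - 3) * (rho x - 3 - 1)) = 0" using rho_consec[of 3] tot n55 s126 by simp
    have rho34: "rho x = 3 \<or> rho x = 4" if "x \<in> X" for x
      using sum_nonneg_0[OF finX prod_consec_nonneg rz that] by auto
    have r1: "(\<Sum>x\<in>X. 4 - rho x) = 1" using cX tot n55 by (simp add: sum_subtractf)
    then obtain x0 where x0: "x0 \<in> X" "rho x0 = 3"
      using rho34 by (metis (no_types, lifting) diff_self sum.neutral zero_neq_one)
    have "(\<Sum>x\<in>X-{x0}. 4 - rho x) = 0" using r1 x0 finX by (simp add: sum_diff1)
    then have r4: "rho x = 4" if "x \<in> X" "x \<noteq> x0" for x
      using sum_nonneg_0[of "X-{x0}" "\<lambda>x. 4 - rho x" x] finX rho34 that by fastforce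
    obtain S where S: "S \<in> R" "a x0 S = 1"
    proof -
      have "\<exists>S\<in>R. a x0 S = 1"
      proof (rule ccontr)
        assume "\<not> ?thesis"
        then have "a x0 S = 0" if "S \<in> R" for S using that a01[of x0 S] by blast
        then have "rho x0 = 0" unfolding rho_def by simp
        then show False using x0(2) by simp
      qed
      then show ?thesis using that by blast
    qed
    have "18 = (\<Sum>T\<in>R-{S}. int (card (I S T)))"
      using hS[OF S(1)] S(1) R7 finR by (simp add: sum_subtractf)
    also have "\<dots> = (\<Sum>x\<in>X. a x S * (rho x - 1))" by (rule sum_I_row[OF S(1)])
    also have "\<dots> = (\<Sum>x\<in>X. 3 * a x S - (if x = x0 then 1 else 0))"
      by (rule sum.cong) (use r4 x0 S in auto)
    also have "\<dots> = 3 * (\<Sum>x\<in>X. a x S) - 1" using x0(1) finX by (simp add: sum_subtractf sum_distrib_left)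
    finally show False by presburger
  qed
qed

end

section \<open>Column degrees and row bounds\<close>

locale K33_free_grid =
  fixes A :: "nat \<Rightarrow> nat \<Rightarrow> int"
  assumes A01: "\<And>i c. A i c = 0 \<or> A i c = 1"
    and K33: "\<And>I J. \<lbrakk>I \<subseteq> {..<12}; J \<subseteq> {..<18}; card I = 3; card J = 3; \<And>i c. \<lbrakk>i \<in> I; c \<in> J\<rbrakk> \<Longrightarrow> A i c = 1\<rbrakk> \<Longrightarrow> False"
    and total: "(\<Sum>i<12. \<Sum>c<18. A i c) = 109"
begin

definition Xs :: "nat \<Rightarrow> nat set" where "Xs y = {..<12} - {y}"
definition Ds :: "nat \<Rightarrow> nat set" where "Ds y = {c. c < 18 \<and> A y c = 1}"
definition Rr :: "nat \<Rightarrow> nat set" where "Rr y = {c. c < 18 \<and> A y c = 0}"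
definition pp :: "nat \<Rightarrow> nat \<Rightarrow> int" where "pp y x = (\<Sum>c<18. A y c * A x c)"
definition rs :: "nat \<Rightarrow> int" where "rs y = (\<Sum>c<18. A y c)"
definition e :: "nat \<Rightarrow> int" where "e c = (\<Sum>y<12. A y c) - 6"
definition eps :: "nat \<Rightarrow> int" where "eps y = (\<Sum>c<18. A y c * e c)"
definition V :: int where "V = (\<Sum>c<18. e c * e c)"
definition W :: int where "W = (\<Sum>c<18. max 0 (e c))"
definition P :: "nat set" where "P = {c. c < 18 \<and> e c \<ge> 1}"
definition N :: "nat set" where "N = {c. c < 18 \<and> e c \<le> -1}"
text \<open>
  With D = 5 rs y + eps y for the number of ones that row y shares with the other rows,
  psi y = 2 D - 6 rs y - 38. It is at most rs y - 9, except on some rows of size at most 8, where it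
  is at most 2.
\<close>
definition psi :: "nat \<Rightarrow> int" where "psi y = 4 * rs y + 2 * eps y - 38"

lemma A_le1: "A y c \<le> 1" and A_ge0: "0 \<le> A y c" using A01[of y c] by auto

lemma K33_ge:
  assumes "I \<subseteq> {..<12}" "J \<subseteq> {..<18}" "card I \<ge> 3" "card J \<ge> 3" "\<And>i c. \<lbrakk>i \<in> I; c \<in> J\<rbrakk> \<Longrightarrow> A i c = 1"
  shows False
proof -
  obtain I' J' where "I' \<subseteq> I" "card I' = 3" "J' \<subseteq> J" "card J' = 3"
    using assms(3,4) by (meson obtain_subset_with_card_n)
  then have "A i c = 1" if "i \<in> I'" "c \<in> J'" for i c using assms(5) that by blast
  then show False using \<open>I' \<subseteq> I\<close> \<open>J' \<subseteq> J\<close> \<open>card I' = 3\<close> \<open>card J' = 3\<close> assms(1,2) by (intro K33[of I' J']) auto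
qed

lemma sum3_le:
  assumes "finite S" "\<And>x. x \<in> S \<Longrightarrow> f x = 0 \<or> f x = (1::int)" "\<not> card {x\<in>S. f x = 1} \<ge> 3"
  shows "(\<Sum>x\<in>S. f x) \<le> 2"
proof -
  have "(\<Sum>x\<in>S. f x) = (\<Sum>x\<in>{x\<in>S. f x = 1}. 1)"
    by (rule sum.mono_neutral_cong_right) (use assms in auto)
  then show ?thesis using assms(3) by simp
qed

lemma rows3:
  assumes "i < 12" "j < 12" "k < 12" "i \<noteq> j" "i \<noteq> k" "j \<noteq> k"
  shows "(\<Sum>c<18. A i c * A j c * A k c) \<le> 2"
proof (rule sum3_le)
  show "\<not> card {x \<in> {..<18}. A i x * A j x * A k x = 1} \<ge> 3"
  proof
    assume "card {x \<in> {..<18}. A i x * A j x * A k x = 1} \<ge> 3"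
    moreover have "A i c = 1 \<and> A j c = 1 \<and> A k c = 1" if "A i c * A j c * A k c = 1" for c
      using that A01[of i c] A01[of j c] A01[of k c] by auto
    ultimately show False using assms
      by (intro K33_ge[of "{i,j,k}" "{x \<in> {..<18}. A i x * A j x * A k x = 1}"]) auto
  qed
next
  fix c show "A i c * A j c * A k c = 0 \<or> A i c * A j c * A k c = 1"
    using A01[of i c] A01[of j c] A01[of k c] by auto
qed simp

lemma cols3:
  assumes "i < 18" "j < 18" "k < 18" "i \<noteq> j" "i \<noteq> k" "j \<noteq> k"
  shows "(\<Sum>y<12. A y i * A y j * A y k) \<le> 2"
proof (rule sum3_le)
  show "\<not> card {y \<in> {..<12}. A y i * A y j * A y k = 1} \<ge> 3"
  proof
    assume "card {y \<in> {..<12}. A y i * A y j * A y k = 1} \<ge> 3"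
    moreover have "A y i = 1 \<and> A y j = 1 \<and> A y k = 1" if "A y i * A y j * A y k = 1" for y
      using that A01[of y i] A01[of y j] A01[of y k] by auto
    ultimately show False using assms
      by (intro K33_ge[of "{y \<in> {..<12}. A y i * A y j * A y k = 1}" "{i,j,k}"]) auto
  qed
next
  fix y show "A y i * A y j * A y k = 0 \<or> A y i * A y j * A y k = 1"
    using A01[of y i] A01[of y j] A01[of y k] by auto
qed simp

lemma sum_Ds: "(\<Sum>c\<in>Ds y. f c) = (\<Sum>c<18. A y c * f c)"
  unfolding Ds_def by (rule sum.mono_neutral_cong_left) (use A01 in fastforce)+

lemma sum_Rr: "(\<Sum>c\<in>Rr y. f c) = (\<Sum>c<18. (1 - A y c) * f c)"
  unfolding Rr_def by (rule sum.mono_neutral_cong_left) (use A01 in fastforce)+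

lemma famR_row: "y < 12 \<Longrightarrow> block_family_ext (Xs y) (Ds y) A (Rr y)"
proof
  assume y: "y < 12"
  show "finite (Xs y)" "card (Xs y) = 11" unfolding Xs_def using y by auto
  show "finite (Ds y)" "finite (Rr y)" unfolding Ds_def Rr_def by auto
  show "Ds y \<inter> Rr y = {}" unfolding Ds_def Rr_def by auto
  show "A x d = 0 \<or> A x d = 1" for x d by (rule A01)
  show "(\<Sum>d\<in>Ds y. A x d * A z d) \<le> 2" if "x \<in> Xs y" "z \<in> Xs y" "x \<noteq> z" for x z
    using rows3[of y x z] that y unfolding sum_Ds Xs_def by (auto simp: mult.assoc)
  show "(\<Sum>x\<in>Xs y. A x i * A x j * A x k) \<le> 2"
    if "i \<in> Ds y \<union> Rr y" "j \<in> Ds y \<union> Rr y" "k \<in> Ds y \<union> Rr y" "i \<noteq> j" "i \<noteq> k" "j \<noteq> k" for i j k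
  proof -
    have "(\<Sum>x\<in>Xs y. A x i * A x j * A x k) \<le> (\<Sum>x<12. A x i * A x j * A x k)"
      unfolding Xs_def by (rule sum_mono2) (auto simp: A_ge0)
    also have "\<dots> \<le> 2" using that by (intro cols3) (auto simp: Ds_def Rr_def)
    finally show ?thesis .
  qed
qed

lemma row_facts:
  assumes y: "y < 12"
  shows "int (card (Ds y)) = rs y" "int (card (Rr y)) = 18 - rs y" "\<And>d. d \<in> Ds y \<Longrightarrow> block_family.b (Xs y) A d = e d + 5"
    "block_family.n (Xs y) (Ds y) A = 5 * rs y + eps y" "\<And>x. block_family.p (Ds y) A x = pp y x"
    "(\<Sum>x\<in>Xs y. block_family_ext.rho A (Rr y) x) = 109 - rs y - (5 * rs y + eps y)"
    "\<And>x. block_family_ext.rho A (Rr y) x = rs x - pp y x"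
proof -
  interpret F: block_family_ext "Xs y" "Ds y" A "Rr y" by (rule famR_row[OF y])
  show r: "int (card (Ds y)) = rs y" unfolding rs_def using sum_Ds[of "\<lambda>_. 1" y] by simp
  show "int (card (Rr y)) = 18 - rs y" unfolding rs_def using sum_Rr[of "\<lambda>_. 1" y] by (simp add: sum_subtractf)
  show b: "F.b d = e d + 5" if "d \<in> Ds y" for d
  proof -
    have "F.b d = (\<Sum>x\<in>{..<12}-{y}. A x d)" using F.b_def[of d] by (simp add: Xs_def)
    then show ?thesis using that y unfolding e_def Ds_def by (simp add: sum_diff1)
  qed
  have "F.n = (\<Sum>d\<in>Ds y. e d + 5)" unfolding F.n_blocks by (rule sum.cong) (use b in auto)
  then show n: "F.n = 5 * rs y + eps y"
    unfolding sum_Ds eps_def rs_def by (simp add: distrib_left sum.distrib sum_distrib_left mult.commute)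
  show p: "F.p x = pp y x" for x unfolding F.p_def sum_Ds pp_def ..
  show rho: "F.rho x = rs x - pp y x" for x
    unfolding F.rho_def sum_Rr pp_def rs_def by (simp add: left_diff_distrib sum_subtractf)
  have "(\<Sum>x\<in>Xs y. F.rho x) = (\<Sum>x\<in>Xs y. rs x) - F.n" unfolding rho F.n_def p by (simp add: sum_subtractf)
  also have "(\<Sum>x\<in>Xs y. rs x) = 109 - rs y" unfolding Xs_def using y total by (simp add: sum_diff1 rs_def)
  finally show "(\<Sum>x\<in>Xs y. F.rho x) = 109 - rs y - (5 * rs y + eps y)" unfolding n by simp
qed

lemma pp_sym: "pp x y = pp y x" unfolding pp_def by (simp add: mult.commute)

lemma rs_range: "0 \<le> rs y" "rs y \<le> 18"
  unfolding rs_def using A_ge0 sum_mono[of "{..<18}" "A y" "\<lambda>_. 1"] A_le1 by (auto intro: sum_nonneg)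

lemma row_bounds:
  assumes y: "y < 12"
  shows "10 * rs y + 2 * eps y \<le> 55 + 5 * rs y" "5 * rs y + eps y \<le> 11 * rs y"
    "rs y = 2 \<Longrightarrow> 5 * rs y + eps y \<le> 22" "rs y = 3 \<Longrightarrow> 5 * rs y + eps y \<le> 23" "rs y = 4 \<Longrightarrow> 5 * rs y + eps y \<le> 26"
    "rs y = 5 \<Longrightarrow> 5 * rs y + eps y \<le> 32" "rs y = 6 \<Longrightarrow> 5 * rs y + eps y \<le> 36" "rs y = 7 \<Longrightarrow> 5 * rs y + eps y \<le> 41"
    "rs y = 8 \<Longrightarrow> 5 * rs y + eps y \<le> 44" "rs y = 9 \<Longrightarrow> 5 * rs y + eps y \<le> 46" "rs y = 10 \<Longrightarrow> 5 * rs y + eps y \<le> 49"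
    "rs y = 11 \<Longrightarrow> 5 * rs y + eps y \<le> 53" "rs y = 12 \<Longrightarrow> 5 * rs y + eps y \<le> 56"
proof -
  interpret F: block_family_ext "Xs y" "Ds y" A "Rr y" by (rule famR_row[OF y])
  note f = row_facts[OF y]
  note g = f(4)[symmetric]
  show 1: "10 * rs y + 2 * eps y \<le> 55 + 5 * rs y" using F.n_le_big unfolding f(1,4) by simp
  show "5 * rs y + eps y \<le> 11 * rs y" using F.n_le_r unfolding f(1,4) .
  show "rs y = 2 \<Longrightarrow> 5 * rs y + eps y \<le> 22" "rs y = 3 \<Longrightarrow> 5 * rs y + eps y \<le> 23" "rs y = 4 \<Longrightarrow> 5 * rs y + eps y \<le> 26"
    "rs y = 5 \<Longrightarrow> 5 * rs y + eps y \<le> 32" "rs y = 6 \<Longrightarrow> 5 * rs y + eps y \<le> 36" "rs y = 7 \<Longrightarrow> 5 * rs y + eps y \<le> 41"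
    "rs y = 8 \<Longrightarrow> 5 * rs y + eps y \<le> 44" "rs y = 9 \<Longrightarrow> 5 * rs y + eps y \<le> 46"
    using F.n_le_2 F.n_le_3 F.n_le_4 F.n_le_5 F.n_le_6 F.n_le_7 F.n_le_8 F.n_le_9 unfolding f(1,4) by blast+
  show "5 * rs y + eps y \<le> 49" if "rs y = 10"
    using F.ten_blocks_le that f(1,2,4,6) by simp
  show "5 * rs y + eps y \<le> 53" if "rs y = 11"
    using F.eleven_blocks_le_53 that f(1,2,4,6) by simp
  show "5 * rs y + eps y \<le> 56" if "rs y = 12"
  proof (rule ccontr)
    assume "\<not> 5 * rs y + eps y \<le> 56"
    then have "5 * rs y + eps y = 57" using 1 that by simp
    then show False using F.twelve_blocks that f(1,4) by simp
  qed
qed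

lemma rs_cases: "rs y \<in> {0,1,2,3,4,5,6,7,8,9,10,11,12} \<or> rs y \<ge> 13"
proof (cases "rs y \<le> 11")
  case True then show ?thesis using int_upto_11[OF rs_range(1) True] by auto
qed auto

text \<open>In terms of D the claim reads 2 D <= 7 rs + 29, with equality at D = 46 for size 9 and D
  = 53 for size 11; from size 13 on it follows from 2 D <= 55 + 5 rs. The disjunction is stated so
  that it covers every row outside \<open>AA\<close>.\<close>

lemma psi_le:
  assumes y: "y < 12" and "rs y \<ge> 9 \<or> psi y \<le> rs y - 9"
  shows "psi y \<le> rs y - 9"
  using rs_cases[of y] row_bounds[OF y] assms(2) unfolding psi_def by auto

text \<open>The row bounds leave only the sizes 8, 7, 6 and 2. For the first three, D is large
  enough for \<open>p_le_4\<close>; for size 2 the last claim is trivial.\<close>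

lemma psi_small:
  assumes y: "y < 12" and "rs y \<le> 8" "psi y > rs y - 9"
  shows "psi y \<le> 2" "psi y \<le> rs y - 5" "x < 12 \<Longrightarrow> x \<noteq> y \<Longrightarrow> pp y x \<le> 4"
proof -
  have c: "rs y = 8 \<and> 5 * rs y + eps y \<ge> 43 \<or> rs y = 7 \<and> 5 * rs y + eps y \<ge> 40 \<or> rs y = 6 \<and> 5 * rs y + eps y \<ge> 36 \<or> rs y = 2"
    using rs_cases[of y] row_bounds[OF y] assms(2,3) unfolding psi_def by auto
  show "psi y \<le> 2" "psi y \<le> rs y - 5" using c row_bounds[OF y] assms(3) unfolding psi_def by auto
  interpret F: block_family_ext "Xs y" "Ds y" A "Rr y" by (rule famR_row[OF y])
  note f = row_facts[OF y]
  show "pp y x \<le> 4" if "x < 12" "x \<noteq> y"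
  proof (cases "rs y = 2")
    case True then show ?thesis using F.p_le_r[of x] f(1,5) by simp
  next
    case False
    have "x \<in> Xs y" using that unfolding Xs_def by simp
    then have "F.p x \<le> 4" using c False f(1,4) by (intro F.p_le_4) auto
    then show ?thesis using f(5) by simp
  qed
qed

text \<open>Rows of H contribute at most four each, and the pair count is applied to the other 11 -
  card H rows only, where the number of pairs is much smaller.\<close>

lemma row_capacity:
  assumes y: "y < 12" and H: "H \<subseteq> Xs y" "\<And>x. x \<in> H \<Longrightarrow> pp y x \<le> 4" and m: "m \<ge> 0"
  shows "2 * m * (5 * rs y + eps y) \<le> 8 * m * int (card H) + 2 * (11 - int (card H)) * (10 - int (card H)) + m * (m + 1) * rs y"
proof -
  interpret F: block_family_ext "Xs y" "Ds y" A "Rr y" by (rule famR_row[OF y])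
  note f = row_facts[OF y]
  have fH: "finite H" using H(1) F.finX finite_subset by blast
  interpret G: block_family "Xs y - H" "Ds y" A
    by standard (use F.finX F.finD A01 F.pair_le in auto)
  have c: "card (Xs y - H) = 11 - card H" "card H \<le> 11"
    using H(1) fH F.cX card_mono[OF F.finX H(1)] by (auto simp: card_Diff_subset)
  have "F.n = (\<Sum>x\<in>Xs y - H. F.p x) + (\<Sum>x\<in>H. F.p x)"
    unfolding F.n_def by (rule sum.subset_diff[OF H(1) F.finX])
  moreover have "(\<Sum>x\<in>H. F.p x) \<le> (\<Sum>x\<in>H. 4)" by (rule sum_mono) (use H(2) f(5) in auto)
  moreover have "2 * m * G.n \<le> 2 * int (11 - card H) * (int (11 - card H) - 1) + m * (m + 1) * int (card (Ds y))"
    using G.n_capacity[OF c(1) m] .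
  ultimately have "F.n \<le> G.n + 4 * int (card H)" unfolding G.n_def by simp
  then have "2 * m * F.n \<le> 2 * m * (G.n + 4 * int (card H))" using m by (intro mult_left_mono) auto
  then show ?thesis using G.n_capacity[OF c(1) m] c(2) unfolding f(1,4) by (simp add: of_nat_diff algebra_simps)
qed

lemma sum_rs: "(\<Sum>y<12. rs y) = 109" unfolding rs_def by (rule total)

lemma sum_e: "(\<Sum>c<18. e c) = 1"
proof -
  have "(\<Sum>c<18. \<Sum>y<12. A y c) = 109" using total by (subst sum.swap)
  then show ?thesis unfolding e_def by (simp add: sum_subtractf)
qed

lemma sum_eps: "(\<Sum>y<12. eps y) = V + 6"
proof -
  have "(\<Sum>y<12. eps y) = (\<Sum>c<18. (e c + 6) * e c)"
    unfolding eps_def by (subst sum.swap) (simp add: e_def sum_distrib_right)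
  then show ?thesis unfolding V_def using sum_e by (simp add: distrib_right sum.distrib sum_distrib_left[symmetric])
qed

lemma sum_psi: "(\<Sum>y<12. psi y) = 2 * V - 8"
  unfolding psi_def using sum_rs sum_eps by (simp add: sum.distrib sum_subtractf sum_distrib_left[symmetric])

lemma V_odd: "odd V" and V_pos: "V \<ge> 1"
proof -
  have e: "V - 1 = (\<Sum>c<18. e c * (e c - 1))"
    unfolding V_def using sum_e by (simp add: right_diff_distrib sum_subtractf)
  have "even (V - 1)" unfolding e by (rule dvd_sum) auto
  then show "odd V" by simp
  have "0 \<le> (\<Sum>c<18. e c * (e c - 1))" by (rule sum_nonneg) (use prod_consec_nonneg[of _ 0, unfolded diff_zero] in blast)
  then show "V \<ge> 1" using e by simp
qed

lemma W_neg: "(\<Sum>c<18. max 0 (- e c)) = W - 1"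
proof -
  have "(\<Sum>c<18. max 0 (- e c)) = (\<Sum>c<18. max 0 (e c) - e c)" by (rule sum.cong) auto
  then show ?thesis unfolding W_def using sum_e by (simp add: sum_subtractf)
qed

lemma sq_ge: "max 0 (q::int) + max 0 (- q) \<le> q * q"
proof (cases "q \<ge> 1")
  case True then show ?thesis using mult_mono[of 1 q q q] by simp
next
  case False
  then show ?thesis using mult_mono[of 1 "- q" "- q" "- q"] by (cases "q = 0") auto
qed

lemma W_le: "2 * W - 1 \<le> V"
proof -
  have "(\<Sum>c<18. max 0 (e c) + max 0 (- e c)) \<le> V" unfolding V_def by (rule sum_mono) (rule sq_ge)
  then show ?thesis using W_neg by (simp add: sum.distrib W_def)
qed

lemma eps_le: "eps y \<le> W"
  unfolding eps_def W_def
proof (rule sum_mono)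
  fix c show "A y c * e c \<le> max 0 (e c)" using A01[of y c] by auto
qed

lemma eps_ge: "1 - W \<le> eps y"
proof -
  have "- (\<Sum>c<18. max 0 (- e c)) \<le> eps y"
    unfolding eps_def sum_negf[symmetric]
  proof (rule sum_mono)
    fix c show "- max 0 (- e c) \<le> A y c * e c" using A01[of y c] by auto
  qed
  then show ?thesis using W_neg by simp
qed

lemma eps_eq_W:
  assumes "eps y = W" "c \<in> P" shows "A y c = 1"
proof (rule ccontr)
  assume "A y c \<noteq> 1"
  then have z: "A y c = 0" using A01 by blast
  have "0 = (\<Sum>c<18. max 0 (e c) - A y c * e c)" using assms(1) unfolding W_def eps_def by (simp add: sum_subtractf)
  moreover have g: "0 \<le> max 0 (e c) - A y c * e c" for c using A01[of y c] by auto
  ultimately have "max 0 (e c) - A y c * e c = 0"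
    using sum_nonneg_0[of "{..<18}" "\<lambda>c. max 0 (e c) - A y c * e c" c] assms(2) unfolding P_def by simp
  then show False using z assms(2) unfolding P_def by simp
qed

text \<open>The tangent 4 q - 4 <= q * q at q = 2, used on the positive columns: a large positive
  part with a small sum of squares must be spread over many columns.\<close>

lemma card_P_ge: "5 * W - 1 - V \<le> 4 * int (card P)"
proof -
  have "(\<Sum>c<18. 4 * max 0 (e c) + max 0 (- e c) - (if e c \<ge> 1 then 4 else 0)) \<le> (\<Sum>c<18. e c * e c)"
  proof (rule sum_mono)
    fix c
    have "(e c - 2) * (e c - 2) \<ge> 0" by simp
    then have "4 * e c - 4 \<le> e c * e c" by (simp add: algebra_simps)
    then show "4 * max 0 (e c) + max 0 (- e c) - (if e c \<ge> 1 then 4 else 0) \<le> e c * e c"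
      using sq_ge[of "e c"] by auto
  qed
  moreover have "(\<Sum>c<18. if e c \<ge> 1 then 4 else 0) = 4 * int (card P)"
    unfolding P_def by (simp add: sum.If_cases Int_def)
  moreover have "(\<Sum>c<18. 4 * max 0 (e c)) = 4 * W" unfolding W_def by (simp add: sum_distrib_left)
  ultimately show ?thesis using W_neg by (simp add: sum.distrib sum_subtractf V_def)
qed

text \<open>Equality in \<open>W_le\<close> forces the square of each deviation to equal its
  absolute value, so every column has size 5, 6 or 7.\<close>

lemma flat:
  assumes "V = 2 * W - 1"
  shows "\<And>c. c < 18 \<Longrightarrow> e c = (if c \<in> P then 1 else if c \<in> N then -1 else 0)"
    "int (card P) = W" "int (card N) = W - 1" "P \<inter> N = {}" "P \<subseteq> {..<18}" "N \<subseteq> {..<18}"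
    "\<And>y. eps y = (\<Sum>c\<in>P. A y c) - (\<Sum>c\<in>N. A y c)"
proof -
  have "0 = (\<Sum>c<18. e c * e c - max 0 (e c) - max 0 (- e c))"
    using assms W_neg unfolding V_def by (simp add: sum_subtractf W_def)
  moreover have "0 \<le> e c * e c - max 0 (e c) - max 0 (- e c)" for c using sq_ge[of "e c"] by linarith
  ultimately have z: "e c * e c - max 0 (e c) - max 0 (- e c) = 0" if "c < 18" for c
    using sum_nonneg_0[of "{..<18}" "\<lambda>c. e c * e c - max 0 (e c) - max 0 (- e c)" c] that by simp
  have "e c = 1 \<or> e c = 0 \<or> e c = -1" if "c < 18" for c
  proof (cases "e c \<ge> 0")
    case True then have "e c * (e c - 1) = 0" using z[OF that] by (simp add: right_diff_distrib)
    then show ?thesis by auto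
  next
    case False then have "e c * (e c + 1) = 0" using z[OF that] by (simp add: distrib_left)
    then show ?thesis by auto
  qed
  then show ec: "e c = (if c \<in> P then 1 else if c \<in> N then -1 else 0)" if "c < 18" for c
    using that unfolding P_def N_def by fastforce
  show d: "P \<inter> N = {}" "P \<subseteq> {..<18}" "N \<subseteq> {..<18}" unfolding P_def N_def by auto
  have split: "(\<Sum>c<18. f c * e c) = (\<Sum>c\<in>P. f c) - (\<Sum>c\<in>N. f c)" for f :: "nat \<Rightarrow> int"
  proof -
    have "(\<Sum>c<18. f c * e c) = (\<Sum>c<18. (if c \<in> P then f c else 0) - (if c \<in> N then f c else 0))"
      by (rule sum.cong) (use ec d(1) in auto)
    also have "\<dots> = (\<Sum>c\<in>P. f c) - (\<Sum>c\<in>N. f c)"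
      using d(2,3) by (simp add: sum_subtractf sum.If_cases Int_absorb1)
    finally show ?thesis .
  qed
  show "eps y = (\<Sum>c\<in>P. A y c) - (\<Sum>c\<in>N. A y c)" for y unfolding eps_def by (rule split)
  have "W = (\<Sum>c<18. if c \<in> P then 1 else 0)" unfolding W_def by (rule sum.cong) (use ec d(1) in auto)
  then show "int (card P) = W" using d(2) by (simp add: sum.If_cases Int_absorb1)
  then show "int (card N) = W - 1" using split[of "\<lambda>_. 1"] sum_e by simp
qed

lemma sum_P_cols: "V = 2 * W - 1 \<Longrightarrow> (\<Sum>y<12. \<Sum>c\<in>P. A y c) = 7 * W"
proof -
  assume v: "V = 2 * W - 1"
  note fl = flat[OF v]
  have "(\<Sum>y<12. \<Sum>c\<in>P. A y c) = (\<Sum>c\<in>P. e c + 6)" by (subst sum.swap) (simp add: e_def)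
  also have "\<dots> = (\<Sum>c\<in>P. 7)" by (rule sum.cong) (use fl(1,5) in auto)
  finally show ?thesis using fl(2) by simp
qed

lemma sum_N_cols: "V = 2 * W - 1 \<Longrightarrow> (\<Sum>y<12. \<Sum>c\<in>N. A y c) = 5 * (W - 1)"
proof -
  assume v: "V = 2 * W - 1"
  note fl = flat[OF v]
  have "(\<Sum>y<12. \<Sum>c\<in>N. A y c) = (\<Sum>c\<in>N. e c + 6)" by (subst sum.swap) (simp add: e_def)
  also have "\<dots> = (\<Sum>c\<in>N. 5)" 
  proof (rule sum.cong)
    fix c assume c: "c \<in> N"
    then have "c < 18" "c \<notin> P" using fl(4,6) by auto
    then show "e c + 6 = 5" using fl(1)[of c] c by simp
  qed simp
  finally show ?thesis using fl(3) by simp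
qed

end

section \<open>Excluding all column variances but five\<close>

context K33_free_grid begin

text \<open>Counts ordered triples of columns of Q through a row. The factor 2, absent from
  \<open>triple_total\<close>, is there because all twelve rows are counted and three columns may
  share two of them.\<close>

lemma triple_count:
  assumes Q: "Q \<subseteq> {..<18}" and q: "card Q = q"
  shows "(\<Sum>y<12. (\<Sum>c\<in>Q. A y c) * (((\<Sum>c\<in>Q. A y c) - 1) * ((\<Sum>c\<in>Q. A y c) - 2))) \<le> 2 * (int q * ((int q - 1) * (int q - 2)))"
proof -
  have fQ: "finite Q" using Q finite_subset by blast
  let ?t = "\<lambda>y. \<Sum>c\<in>Q. A y c"
  have "?t y * ((?t y - 1) * (?t y - 2)) = (\<Sum>i\<in>Q. \<Sum>j\<in>Q-{i}. \<Sum>k\<in>Q-{i,j}. A y i * A y j * A y k)" for y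
  proof -
    have 1: "(\<Sum>k\<in>Q-{i,j}. A y i * A y j * A y k) = A y i * A y j * (?t y - 2)" if "i \<in> Q" "j \<in> Q - {i}" for i j
    proof -
      have "?t y = (\<Sum>k\<in>Q-{i,j}. A y k) + (A y i + A y j)"
        using sum.subset_diff[of "{i,j}" Q "A y"] that fQ by auto
      then have "(\<Sum>k\<in>Q-{i,j}. A y i * A y j * A y k) = A y i * A y j * (?t y - A y i - A y j)"
        by (simp add: sum_distrib_left[symmetric])
      then show ?thesis using A01[of y i] A01[of y j] by auto
    qed
    have 2: "(\<Sum>j\<in>Q-{i}. A y i * A y j * (?t y - 2)) = A y i * ((?t y - 1) * (?t y - 2))" if i: "i \<in> Q" for i
    proof -
      have "(\<Sum>j\<in>Q-{i}. A y j) = ?t y - A y i" using i fQ by (simp add: sum_diff1)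
      then have "(\<Sum>j\<in>Q-{i}. A y i * A y j * (?t y - 2)) = A y i * (?t y - A y i) * (?t y - 2)"
        by (simp only: sum_distrib_left[symmetric] sum_distrib_right[symmetric])
      then show ?thesis using A01[of y i] by auto
    qed
    have "(\<Sum>i\<in>Q. \<Sum>j\<in>Q-{i}. \<Sum>k\<in>Q-{i,j}. A y i * A y j * A y k) = (\<Sum>i\<in>Q. \<Sum>j\<in>Q-{i}. A y i * A y j * (?t y - 2))"
      by (intro sum.cong refl 1)
    also have "\<dots> = (\<Sum>i\<in>Q. A y i * ((?t y - 1) * (?t y - 2)))" by (intro sum.cong refl 2)
    finally show ?thesis by (simp only: sum_distrib_right[symmetric])
  qed
  then have "(\<Sum>y<12. ?t y * ((?t y - 1) * (?t y - 2))) = (\<Sum>y<12. \<Sum>i\<in>Q. \<Sum>j\<in>Q-{i}. \<Sum>k\<in>Q-{i,j}. A y i * A y j * A y k)"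
    by (intro sum.cong refl)
  also have "\<dots> = (\<Sum>i\<in>Q. \<Sum>y<12. \<Sum>j\<in>Q-{i}. \<Sum>k\<in>Q-{i,j}. A y i * A y j * A y k)" by (rule sum.swap)
  also have "\<dots> = (\<Sum>i\<in>Q. \<Sum>j\<in>Q-{i}. \<Sum>y<12. \<Sum>k\<in>Q-{i,j}. A y i * A y j * A y k)"
    by (rule sum.cong[OF refl], rule sum.swap)
  also have "\<dots> = (\<Sum>i\<in>Q. \<Sum>j\<in>Q-{i}. \<Sum>k\<in>Q-{i,j}. \<Sum>y<12. A y i * A y j * A y k)"
    by (intro sum.cong[OF refl], rule sum.swap)
  also have "\<dots> \<le> (\<Sum>i\<in>Q. \<Sum>j\<in>Q-{i}. \<Sum>k\<in>Q-{i,j}. 2)"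
    by (intro sum_mono cols3) (use Q in auto)
  also have "\<dots> = (\<Sum>i\<in>Q. \<Sum>j\<in>Q-{i}. 2 * (int q - 2))"
  proof (intro sum.cong refl)
    fix i j assume "i \<in> Q" "j \<in> Q - {i}"
    then have "card {i,j} \<le> q" "card (Q - {i,j}) = q - 2" using q fQ card_mono[OF fQ, of "{i,j}"] by (auto simp: card_Diff_subset)
    then show "(\<Sum>k\<in>Q-{i,j}. 2) = 2 * (int q - 2)" using \<open>j \<in> Q - {i}\<close> by (auto simp: of_nat_diff)
  qed
  also have "\<dots> = (\<Sum>i\<in>Q. (int q - 1) * (2 * (int q - 2)))"
  proof (intro sum.cong refl)
    fix i assume i: "i \<in> Q"
    then have "q \<ge> 1" using q fQ card_gt_0_iff[of Q] by auto
    then show "(\<Sum>j\<in>Q-{i}. 2 * (int q - 2)) = (int q - 1) * (2 * (int q - 2))" using i q fQ by (simp add: of_nat_diff)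
  qed
  finally show ?thesis using q by (simp add: algebra_simps)
qed

section \<open>The exceptional rows of size at most 8\<close>

definition AA :: "nat set" where "AA = {y. y < 12 \<and> rs y \<le> 8 \<and> psi y > rs y - 9}"
definition Out :: "nat set" where "Out = {..<12} - AA"

lemma AA_sub: "AA \<subseteq> {..<12}" and fin_AA: "finite AA" and fin_Out: "finite Out"
  unfolding AA_def Out_def by auto

lemma sum_AA_Out: "(\<Sum>y<12. f y) = (\<Sum>y\<in>AA. f y) + (\<Sum>y\<in>Out. (f y :: int))"
  unfolding Out_def using sum.subset_diff[OF AA_sub, of f] by simp

lemma card_Out: "int (card Out) = 12 - int (card AA)" and card_AA: "card AA \<le> 12"
  unfolding Out_def using card_mono[OF _ AA_sub] AA_sub fin_AA by (auto simp: card_Diff_subset of_nat_diff)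

lemma Out_psi: "y \<in> Out \<Longrightarrow> psi y \<le> rs y - 9"
  by (rule psi_le) (auto simp: Out_def AA_def)

lemma AA_psi:
  assumes "y \<in> AA" shows "psi y \<le> 2" "psi y \<le> rs y - 5"
  using psi_small(1,2)[of y] assms by (auto simp: AA_def)

lemma sum_phi: "(\<Sum>y<12. psi y - (rs y - 9)) = 2 * V - 9"
  using sum_psi sum_rs by (simp add: sum_subtractf)

text \<open>The bound on common ones comes from the exceptional row; by symmetry a row outside
  \<open>AA\<close> shares at most four ones with every row of \<open>AA\<close>, so these can play
  the part of H.\<close>

lemma Out_capacity:
  assumes y: "y \<in> Out" and m: "m \<ge> 0"
  shows "2 * m * (5 * rs y + eps y) \<le> 8 * m * int (card AA) + 2 * (11 - int (card AA)) * (10 - int (card AA)) + m * (m + 1) * rs y"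
proof (rule row_capacity[OF _ _ _ m])
  show "y < 12" using y by (simp add: Out_def)
  show "AA \<subseteq> Xs y" using y AA_sub by (auto simp: Out_def Xs_def)
  show "pp y x \<le> 4" if "x \<in> AA" for x
    using psi_small(3)[of x y] that y unfolding pp_sym[of y] by (auto simp: AA_def Out_def)
qed

lemma psi_nonpos_le_10: "y < 12 \<Longrightarrow> psi y \<le> rs y - 9 \<Longrightarrow> rs y \<le> 10 \<Longrightarrow> psi y \<le> 0"
proof (cases "rs y = 10")
  case True
  assume "y < 12"
  then have "eps y \<le> -1" using row_bounds(11)[of y] True by simp
  then show ?thesis using True by (simp add: psi_def)
qed auto

lemma Out_psi_nonpos:
  assumes y: "y \<in> Out" and a: "card AA = 3 \<or> card AA = 4 \<or> card AA = 5"
  shows "psi y \<le> 0"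
proof (cases "rs y \<le> 10")
  case True then show ?thesis using psi_nonpos_le_10 Out_psi[OF y] y by (auto simp: Out_def)
next
  case False
  then have "2 * rs y + eps y \<le> 19"
    using Out_capacity[OF y, of 3] Out_capacity[OF y, of 2] a by auto
  then show ?thesis unfolding psi_def by simp
qed

text \<open>With at most two exceptional rows the sum of psi - (rs - 9) is at most 8, but equals 2 V
  - 9 >= 9. With three or four the sum of psi is at most 8, but equals 2 V - 8 >= 10.\<close>

lemma V_ge_9_small: "V \<ge> 9 \<Longrightarrow> card AA \<ge> 5"
proof (rule ccontr)
  assume V: "V \<ge> 9" and "\<not> card AA \<ge> 5"
  then consider "card AA \<le> 2" | "card AA = 3 \<or> card AA = 4" by linarith
  then show False
  proof cases
    case 1
    have "(\<Sum>y\<in>AA. psi y - (rs y - 9)) \<le> (\<Sum>y\<in>AA. 4)" by (rule sum_mono) (use AA_psi in force)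
    moreover have "(\<Sum>y\<in>Out. psi y - (rs y - 9)) \<le> 0" by (rule sum_nonpos) (use Out_psi in force)
    ultimately show False using 1 V sum_phi sum_AA_Out[of "\<lambda>y. psi y - (rs y - 9)"] by simp
  next
    case 2
    have "(\<Sum>y\<in>AA. psi y) \<le> (\<Sum>y\<in>AA. 2)" by (rule sum_mono) (rule AA_psi)
    moreover have "(\<Sum>y\<in>Out. psi y) \<le> 0" by (rule sum_nonpos) (use Out_psi_nonpos 2 in blast)
    ultimately show False using 2 V sum_psi sum_AA_Out[of psi] by auto
  qed
qed

text \<open>The sizes exceed 12 * 9 by 1 in total and every exceptional row is below 9, so the rows
  outside \<open>AA\<close> exceed 9 by at least 1 + card AA together. Their psi decreases linearly
  in the size by \<open>Out_capacity\<close>.\<close>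

lemma Out_psi_sum:
  assumes a6: "card AA \<ge> 6"
  shows "(\<Sum>y\<in>Out. psi y) \<le> 9 - 2 * int (card AA)"
proof -
  have "(\<Sum>y\<in>AA. rs y - 9) \<le> (\<Sum>y\<in>AA. -1)" by (rule sum_mono) (auto simp: AA_def)
  moreover have "(\<Sum>y<12. rs y - 9) = 1" using sum_rs by (simp add: sum_subtractf)
  ultimately have t: "(\<Sum>y\<in>Out. rs y - 9) \<ge> 1 + int (card AA)" using sum_AA_Out[of "\<lambda>y. rs y - 9"] by simp
  \<comment> \<open>In each case below, \<open>Out_capacity\<close> with parameter m gives slope be
    = 6 - (m + 1), that is 3 for m = 2 and 4 for m = 1; al is the resulting value at size 9.\<close>
  have key: "\<lbrakk>al \<ge> 0; be \<ge> 0; \<And>y. y \<in> Out \<Longrightarrow> rs y \<ge> 10 \<Longrightarrow> psi y \<le> al - be * (rs y - 9)\<rbrakk>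
     \<Longrightarrow> (\<Sum>y\<in>Out. psi y) \<le> al * int (card Out) - be * (1 + int (card AA))" for al be :: int
  proof -
    assume ab: "al \<ge> 0" "be \<ge> 0" and h: "\<And>y. y \<in> Out \<Longrightarrow> rs y \<ge> 10 \<Longrightarrow> psi y \<le> al - be * (rs y - 9)"
    have "psi y \<le> al - be * (rs y - 9)" if y: "y \<in> Out" for y
    proof (cases "rs y \<ge> 10")
      case False
      have "psi y \<le> 0" using Out_psi[OF y] False by simp
      moreover have "be * (rs y - 9) \<le> 0" using False ab by (simp add: mult_nonneg_nonpos)
      ultimately show ?thesis using ab by simp
    qed (rule h[OF y])
    then have "(\<Sum>y\<in>Out. psi y) \<le> (\<Sum>y\<in>Out. al - be * (rs y - 9))" by (rule sum_mono)
    also have "\<dots> = al * int (card Out) - be * (\<Sum>y\<in>Out. rs y - 9)"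
      by (simp only: sum_subtractf[of "\<lambda>_. al"] sum_constant sum_distrib_left[symmetric] mult.commute[of al])
    also have "\<dots> \<le> al * int (card Out) - be * (1 + int (card AA))" using t ab by (simp add: mult_left_mono)
    finally show ?thesis .
  qed
  have "card AA \<in> {6,7,8,9,10,11,12}" using a6 card_AA by auto
  then consider "card AA = 6 \<or> card AA = 7" | "card AA = 8 \<or> card AA = 9" | "card AA = 10" | "card AA = 11" | "card AA = 12" by auto
  then show ?thesis
  proof cases
    case 1
    have "psi y \<le> 3 - 3 * (rs y - 9)" if "y \<in> Out" for y
      using Out_capacity[OF that, of 2] 1 by (auto simp: psi_def)
    then show ?thesis using key[of 3 3] 1 card_Out by auto
  next
    case 2
    have "psi y \<le> 2 - 4 * (rs y - 9)" if "y \<in> Out" for y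
      using Out_capacity[OF that, of 1] 2 by (auto simp: psi_def)
    then show ?thesis using key[of 2 4] 2 card_Out by auto
  next
    case 3
    have "psi y \<le> 6 - 4 * (rs y - 9)" if "y \<in> Out" for y
      using Out_capacity[OF that, of 1] 3 by (auto simp: psi_def)
    then show ?thesis using key[of 6 4] 3 card_Out by auto
  next
    case 4
    have "psi y \<le> 14 - 4 * (rs y - 9)" if "y \<in> Out" for y
      using Out_capacity[OF that, of 1] 4 by (auto simp: psi_def)
    then show ?thesis using key[of 14 4] 4 card_Out by auto
  next
    case 5
    then have "Out = {}" using card_Out fin_Out by auto
    then show ?thesis using t by simp
  qed
qed

lemma V_ge_9_large: "V \<ge> 9 \<Longrightarrow> card AA \<le> 5"
proof (rule ccontr)
  assume V: "V \<ge> 9" and "\<not> card AA \<le> 5"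
  then have "(\<Sum>y\<in>Out. psi y) \<le> 9 - 2 * int (card AA)" by (intro Out_psi_sum) simp
  moreover have "(\<Sum>y\<in>AA. psi y) \<le> (\<Sum>y\<in>AA. 2)" by (rule sum_mono) (rule AA_psi)
  ultimately show False using V sum_psi sum_AA_Out[of psi] by simp
qed

lemma V_lt_9: "V < 9"
proof (rule ccontr)
  assume "\<not> V < 9"
  then have V: "V \<ge> 9" by simp
  have a5: "card AA = 5" using V_ge_9_small[OF V] V_ge_9_large[OF V] by simp
  have o: "(\<Sum>y\<in>Out. psi y) \<le> 0" by (rule sum_nonpos) (use Out_psi_nonpos a5 in blast)
  have a: "(\<Sum>y\<in>AA. 2 - psi y) = 10 - (\<Sum>y\<in>AA. psi y)" using a5 by (simp add: sum_subtractf)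
  have a0: "0 \<le> (\<Sum>y\<in>AA. 2 - psi y)" by (rule sum_nonneg) (use AA_psi(1) in force)
  have s: "(\<Sum>y\<in>AA. psi y) + (\<Sum>y\<in>Out. psi y) = 2 * V - 8" using sum_psi sum_AA_Out[of psi] by simp
  have V9: "V = 9" using o a a0 s V by linarith
  have az: "(\<Sum>y\<in>AA. 2 - psi y) = 0" using o a a0 s V by linarith
  have W5: "W \<le> 5" using W_le V9 by simp
  have AA4: "rs y = 8 \<and> eps y = 4" if y: "y \<in> AA" for y
  proof -
    have "2 - psi y = 0" by (rule sum_nonneg_0[OF fin_AA _ az y]) (use AA_psi(1) in force)
    then have "2 * rs y + eps y = 20" by (simp add: psi_def)
    moreover have "rs y \<le> 8" "eps y \<le> 5" using y eps_le[of y] W5 by (auto simp: AA_def)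
    ultimately show ?thesis by presburger
  qed
  obtain y0 where y0: "y0 \<in> AA" using a5 by fastforce
  have "W \<ge> 4" using AA4[OF y0] eps_le[of y0] by simp
  then consider "W = 4" | "W = 5" using W5 by linarith
  then show False
  proof cases
    case 1
    have "card P \<ge> 3" using card_P_ge V9 1 by simp
    then show False using AA4 eps_eq_W 1 a5 AA_sub
      by (intro K33_ge[of AA P]) (auto simp: P_def)
  next
    case 2
    then have fl: "V = 2 * W - 1" using V9 by simp
    note f = flat[OF fl]
    let ?t = "\<lambda>y. \<Sum>c\<in>P. A y c"
    let ?f = "\<lambda>q :: int. q * ((q - 1) * (q - 2))"
    have t0: "0 \<le> ?t y" "?t y \<le> 5" for y
      using sum_mono[of P "A y" "\<lambda>_. 1"] A_le1 A_ge0 f(2) 2 by (auto intro: sum_nonneg)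
    have t5: "?t y \<in> {0,1,2,3,4,5}" for y using t0[of y] by (smt (verit) insert_iff)
    have t4: "?t y \<ge> 4" if "y \<in> AA" for y
      using AA4[OF that] f(7)[of y] sum_nonneg[of N "A y"] A_ge0 by fastforce
    \<comment> \<open>Chords of t (t - 1) (t - 2): through 4 and 5 on the five exceptional rows,
      through 2 and 3 on the others. As the t sum to 35, the two chords add up to 30 times the sum
      of t over \<open>AA\<close> minus 474, at least 126 and thus above the 120 available
      triples.\<close>
    have "(\<Sum>y\<in>AA. 24 + 36 * (?t y - 4)) \<le> (\<Sum>y\<in>AA. ?f (?t y))"
    proof (rule sum_mono)
      fix y assume "y \<in> AA"
      show "24 + 36 * (?t y - 4) \<le> ?f (?t y)" using t4[OF \<open>y \<in> AA\<close>] t5[of y] by auto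
    qed
    moreover have "(\<Sum>y\<in>Out. 6 * (?t y - 2)) \<le> (\<Sum>y\<in>Out. ?f (?t y))"
    proof (rule sum_mono)
      fix y show "6 * (?t y - 2) \<le> ?f (?t y)" using t5[of y] by auto
    qed
    moreover have "(\<Sum>y<12. ?f (?t y)) \<le> 120" using triple_count[OF f(5) refl] f(2) 2 by simp
    moreover have "(\<Sum>y\<in>AA. 24 + 36 * (?t y - 4)) = 36 * (\<Sum>y\<in>AA. ?t y) - 600"
      using a5 by (simp add: sum.distrib sum_subtractf sum_distrib_left)
    moreover have "(\<Sum>y\<in>Out. 6 * (?t y - 2)) = 6 * (\<Sum>y\<in>Out. ?t y) - 84"
      using card_Out a5 by (simp add: sum_subtractf sum_distrib_left)
    moreover have "(\<Sum>y\<in>AA. ?t y) + (\<Sum>y\<in>Out. ?t y) = 35"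
      using sum_P_cols[OF fl] 2 sum_AA_Out[of ?t] by simp
    moreover have "(\<Sum>y\<in>AA. 4) \<le> (\<Sum>y\<in>AA. ?t y)" by (rule sum_mono) (rule t4)
    ultimately show False using a5 sum_AA_Out[of "\<lambda>y. ?f (?t y)"] by simp
  qed
qed

text \<open>Only rows with eps = 4 have positive psi inside \<open>AA\<close>. They contain all of
  P, which then has at least three columns, so there are at most two of them. This suffices unless
  card AA = 2 and both rows are of this kind. Then every other row meets P exactly twice, and one of
  size 10 must contain the three columns of N; the total 109 requires three such rows.\<close>

lemma V_ne_7: "V \<noteq> 7"
proof
  assume V: "V = 7"
  have W4: "W \<le> 4" using W_le V by simp
  have AA8: "rs y = 8 \<and> psi y = 2 * eps y - 6 \<and> eps y \<le> 4" if y: "y \<in> AA" for y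
  proof -
    have "3 * rs y + 2 * eps y \<ge> 30" "rs y \<le> 8" "eps y \<le> 4" using y eps_le[of y] W4 by (auto simp: AA_def psi_def)
    then show ?thesis by (auto simp: psi_def)
  qed
  let ?S = "{y\<in>AA. eps y = 4}"
  have SP: "A y c = 1" if "y \<in> ?S" "c \<in> P" for y c
    using that eps_eq_W[of y c] eps_le[of y] W4 by auto
  have S2: "card ?S \<le> 2"
  proof (rule ccontr)
    assume "\<not> card ?S \<le> 2"
    then have c3: "card ?S \<ge> 3" by simp
    then have "?S \<noteq> {}" by (metis card.empty not_numeral_le_zero)
    then obtain y where "y \<in> ?S" by blast
    then have "W = 4" using eps_le[of y] W4 by auto
    then have "card P \<ge> 3" using card_P_ge V by simp
    then show False using SP c3 AA_sub by (intro K33_ge[of ?S P]) (auto simp: P_def)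
  qed
  consider "card AA \<le> 2" | "card AA = 3 \<or> card AA = 4 \<or> card AA = 5 \<or> card AA \<ge> 6" by linarith
  then show False
  proof cases
    case 2
    have "(\<Sum>y\<in>AA. psi y) \<le> (\<Sum>y\<in>AA. if eps y = 4 then 2 else 0)"
      by (rule sum_mono) (use AA8 in force)
    also have "\<dots> = 2 * int (card ?S)" using fin_AA by (simp add: sum.If_cases Int_def)
    finally have "(\<Sum>y\<in>AA. psi y) \<le> 4" using S2 by simp
    moreover have "(\<Sum>y\<in>Out. psi y) \<le> 0"
    proof (cases "card AA \<ge> 6")
      case True then show ?thesis using Out_psi_sum by simp
    next
      case False then show ?thesis by (intro sum_nonpos) (use Out_psi_nonpos 2 in blast)
    qed
    ultimately show False using V sum_psi sum_AA_Out[of psi] by simp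
  next
    case 1
    have ph: "(\<Sum>y\<in>AA. psi y - (rs y - 9)) + (\<Sum>y\<in>Out. psi y - (rs y - 9)) = 5"
      using sum_phi V sum_AA_Out[of "\<lambda>y. psi y - (rs y - 9)"] by simp
    have "(\<Sum>y\<in>AA. psi y - (rs y - 9)) \<le> (\<Sum>y\<in>AA. 1 + (if eps y = 4 then 2 else 0))"
      by (rule sum_mono) (use AA8 in force)
    also have "\<dots> = int (card AA) + 2 * int (card ?S)" using fin_AA by (simp add: sum.distrib sum.If_cases Int_def)
    finally have sA: "(\<Sum>y\<in>AA. psi y - (rs y - 9)) \<le> int (card AA) + 2 * int (card ?S)" .
    have "(\<Sum>y\<in>Out. psi y - (rs y - 9)) \<le> 0" by (rule sum_nonpos) (use Out_psi in force)
    then have "int (card AA) + 2 * int (card ?S) \<ge> 5" using sA ph by linarith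
    moreover have "card ?S \<le> card AA" by (intro card_mono fin_AA) auto
    ultimately have c2: "card ?S = 2" "card AA = 2" using S2 1 by linarith+
    then have AS: "AA = ?S" using fin_AA by (metis (no_types, lifting) card_subset_eq mem_Collect_eq subsetI)
    obtain a1 a2 where a12: "AA = {a1,a2}" "a1 \<noteq> a2" using c2(2) by (auto simp: card_2_iff)
    have "a1 \<in> ?S" using AS a12 by blast
    then have W: "W = 4" using eps_le[of a1] W4 by auto
    then have fl: "V = 2 * W - 1" using V by simp
    note f = flat[OF fl]
    let ?t = "\<lambda>y. \<Sum>c\<in>P. A y c" and ?s = "\<lambda>y. \<Sum>c\<in>N. A y c"
    have t2: "?t y \<le> 2" if y: "y \<in> Out" for y
    proof (rule sum3_le)
      show "finite P" using f(5) finite_subset by blast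
      show "A y x = 0 \<or> A y x = 1" for x by (rule A01)
      show "\<not> card {x\<in>P. A y x = 1} \<ge> 3"
      proof
        assume c: "card {x\<in>P. A y x = 1} \<ge> 3"
        have "card {a1,a2,y} = 3" using y a12 by (auto simp: Out_def)
        then show False using c SP AS a12 y AA_sub f(5) by (intro K33_ge[of "{a1,a2,y}" "{x\<in>P. A y x = 1}"]) (auto simp: Out_def)
      qed
    qed
    have tA: "?t y = 4" if "y \<in> AA" for y
    proof -
      have "?t y = (\<Sum>c\<in>P. 1)" by (rule sum.cong) (use SP that AS in auto)
      then show ?thesis using f(2) W by simp
    qed
    have "(\<Sum>y\<in>AA. ?t y) + (\<Sum>y\<in>Out. ?t y) = 28" using sum_P_cols[OF fl] W sum_AA_Out[of ?t] by simp
    moreover have "(\<Sum>y\<in>AA. ?t y) = (\<Sum>y\<in>AA. 4)" by (rule sum.cong) (use tA in auto)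
    ultimately have tz: "(\<Sum>y\<in>Out. 2 - ?t y) = 0" using c2 card_Out by (simp add: sum_subtractf)
    have t22: "?t y = 2" if "y \<in> Out" for y
      using sum_nonneg_0[OF fin_Out _ tz that] t2 by force
    have s3: "0 \<le> ?s y" "?s y \<le> 3" for y
      using sum_mono[of N "A y" "\<lambda>_. 1"] A_le1 A_ge0 f(3) W by (auto intro: sum_nonneg)
    have r10: "rs y \<le> 10 \<and> (rs y = 10 \<longrightarrow> ?s y = 3)" if y: "y \<in> Out" for y
    proof -
      have "y < 12" using y by (simp add: Out_def)
      then show ?thesis using row_bounds(1,11,12,13)[of y] rs_cases[of y] f(7)[of y] t22[OF y] s3[of y] by auto
    qed
    let ?T = "{y\<in>Out. rs y = 10}"
    have "(\<Sum>y\<in>AA. rs y) = (\<Sum>y\<in>AA. 8)" by (rule sum.cong) (use AA8 in auto)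
    then have "(\<Sum>y\<in>Out. rs y) = 93" using sum_rs sum_AA_Out[of rs] c2 by simp
    moreover have "(\<Sum>y\<in>Out. rs y) \<le> (\<Sum>y\<in>Out. 9 + (if rs y = 10 then 1 else 0))"
      by (rule sum_mono) (use r10 in force)
    moreover have "\<dots> = 90 + int (card ?T)" using fin_Out card_Out c2 by (simp add: sum.distrib sum.If_cases Int_def)
    ultimately have T3: "card ?T \<ge> 3" by simp
    have TN: "A y c = 1" if y: "y \<in> ?T" and c: "c \<in> N" for y c
    proof -
      have fN: "finite N" using f(6) finite_subset by blast
      have z: "(\<Sum>c\<in>N. 1 - A y c) = 0" using r10[of y] y f(3) W by (simp add: sum_subtractf)
      show ?thesis using sum_nonneg_0[OF fN _ z c] A_le1 by force
    qed
    show False using T3 TN f(3,6) W by (intro K33_ge[of ?T N]) (auto simp: Out_def)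
  qed
qed

text \<open>A row of size 10 or more needs negative eps, whereas eps >= 1 - W >= 0; twelve rows of
  size 9 have only 108 ones.\<close>

lemma W_not_le_1: "W \<le> 1 \<Longrightarrow> False"
proof -
  assume W: "W \<le> 1"
  have "rs y \<le> 9" if "y < 12" for y
    using row_bounds(1,11,12,13)[OF that] rs_cases[of y] eps_ge[of y] W by auto
  then have "(\<Sum>y<12. rs y) \<le> (\<Sum>y\<in>{..<12::nat}. 9)" by (intro sum_mono) auto
  then show False using sum_rs by simp
qed

lemma V_ne_1: "V \<noteq> 1" and V_ne_3: "V \<noteq> 3"
proof -
  show "V \<noteq> 1"
  proof
    assume "V = 1"
    then have "W \<le> 1" using W_le by simp
    then show False by (rule W_not_le_1)
  qed
  show "V \<noteq> 3"
  proof
    assume V: "V = 3"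
    have "\<not> W \<le> 1" using W_not_le_1 by blast
    then have W: "W = 2" using W_le V by linarith
    then have fl: "V = 2 * W - 1" using V by simp
    note f = flat[OF fl]
    have "card P = 2" "card N = 1" using f(2,3) W by auto
    then obtain B1 B2 F where B: "P = {B1,B2}" "B1 \<noteq> B2" and F: "N = {F}"
      by (auto simp: card_2_iff card_1_singleton_iff)
    have lt: "B1 < 18" "B2 < 18" "F < 18" "F \<noteq> B1" "F \<noteq> B2" using f(4-6) B F by auto
    have ep: "eps y = A y B1 + A y B2 - A y F" for y using f(7)[of y] B F by simp
    \<comment> \<open>The row bounds in a form that can be summed: the left side totals 5 + 109 + 9
      - 120 = 3, but the three columns share at most two rows.\<close>
    have "A y F + rs y + eps y - 10 \<le> A y F * A y B1 * A y B2" if y: "y < 12" for y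
      using row_bounds(1,10,11,12,13)[OF y] rs_cases[of y] ep[of y] A01[of y F] A01[of y B1] A01[of y B2] by auto
    then have "(\<Sum>y<12. A y F + rs y + eps y - 10) \<le> (\<Sum>y<12. A y F * A y B1 * A y B2)" by (intro sum_mono) auto
    moreover have "(\<Sum>y<12. A y F) = 5" using sum_N_cols[OF fl] F W by simp
    moreover have "(\<Sum>y<12. A y F * A y B1 * A y B2) \<le> 2" using lt B by (intro cols3) auto
    ultimately show False using sum_rs sum_eps V by (simp add: sum.distrib sum_subtractf)
  qed
qed

text \<open>An exceptional row has size at most 8 and so needs eps >= 3. One must exist, because psi
  - (rs - 9) sums to 1 and is at most 0 on the other rows.\<close>

lemma V_5_W: "V = 5 \<Longrightarrow> W = 3"
proof -
  assume V: "V = 5"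
  have "AA = {}" if "W \<le> 2"
  proof (rule ccontr)
    assume "AA \<noteq> {}"
    then obtain y where "y \<in> AA" by blast
    then show False using eps_le[of y] that by (auto simp: AA_def psi_def)
  qed
  moreover have "AA \<noteq> {}"
  proof
    assume AA: "AA = {}"
    have "(\<Sum>y\<in>Out. psi y - (rs y - 9)) \<le> 0" by (rule sum_nonpos) (use Out_psi in force)
    then show False using sum_phi V sum_AA_Out[of "\<lambda>y. psi y - (rs y - 9)"] AA by simp
  qed
  ultimately show ?thesis using W_le V by linarith
qed

lemma V_eq_5: "V = 5"
proof -
  have "V \<in> {0,1,2,3,4,5,6,7,8,9,10,11}" using V_lt_9 V_pos by (intro int_upto_11) auto
  then show ?thesis using V_lt_9 V_ne_1 V_ne_3 V_ne_7 V_odd V_pos by auto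
qed

end

section \<open>The remaining configuration\<close>

locale exceptional_row = K33_free_grid +
  fixes u :: nat
  assumes u12: "u < 12" and ru: "rs u = 11" and eu: "eps u = -2" and V5: "V = 5" and W3: "W = 3"
    and rows: "\<And>y. \<lbrakk>y < 12; y \<noteq> u\<rbrakk> \<Longrightarrow> rs y = 8 \<and> eps y = 3 \<or> rs y = 9 \<and> eps y = 1 \<or> rs y = 10 \<and> eps y = -1"
begin

sublocale F: block_family_ext "Xs u" "Ds u" A "Rr u" by (rule famR_row[OF u12])

definition t7 :: "nat \<Rightarrow> int" where "t7 y = (\<Sum>c\<in>P. A y c)"
definition f5 :: "nat \<Rightarrow> int" where "f5 y = (\<Sum>c\<in>N. A y c)"
definition K :: "nat \<Rightarrow> int" where "K x = 5 - F.p x"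
definition Y :: "nat set" where "Y = {x \<in> Xs u. t7 x = 2}"
definition Z :: "nat set" where "Z = {x \<in> Xs u. t7 x = 1}"
definition s :: "nat \<Rightarrow> nat \<Rightarrow> int" where "s x z = 2 - F.dd x z"

lemmas Del_s = F.Del_def[folded s_def]
lemmas Del_part_s = F.Del_part_le[folded s_def]
lemmas I_Del_s = F.I_Del_ge[folded s_def]

lemma s_sym: "s x z = s z x" unfolding s_def by (simp add: F.dd_sym[of x])

lemma VW: "V = 2 * W - 1" using V5 W3 by simp
lemmas fl = flat[OF VW]

lemma cardP: "card P = 3" and cardN: "card N = 2" using fl(2,3) W3 by auto
lemma finP: "finite P" and finN: "finite N" using fl(5,6) finite_subset by blast+

lemma eps_eq: "eps y = t7 y - f5 y" unfolding t7_def f5_def by (rule fl(7))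

lemma t7_range: "0 \<le> t7 y" "t7 y \<le> 3" and f5_range: "0 \<le> f5 y" "f5 y \<le> 2"
  unfolding t7_def f5_def
  using sum_mono[of P "A y" "\<lambda>_. 1"] sum_mono[of N "A y" "\<lambda>_. 1"] A_le1 A_ge0 cardP cardN
  by (auto intro: sum_nonneg)

lemma t7_3: "t7 y = 3 \<Longrightarrow> c \<in> P \<Longrightarrow> A y c = 1"
proof -
  assume t: "t7 y = 3" and c: "c \<in> P"
  have "(\<Sum>c\<in>P. 1 - A y c) = 0" using t cardP by (simp add: sum_subtractf t7_def)
  then have "1 - A y c = 0" using sum_nonneg_0[OF finP, of "\<lambda>c. 1 - A y c" c] c A_le1 by simp
  then show ?thesis by simp
qed

lemma uP: "c \<in> P \<Longrightarrow> A u c = 0" and uN: "c \<in> N \<Longrightarrow> A u c = 1"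
proof -
  have z: "t7 u = 0" "f5 u = 2" using eps_eq[of u] eu t7_range[of u] f5_range[of u] by auto
  show "A u c = 0" if "c \<in> P"
    using sum_nonneg_0[OF finP, of "A u" c] z(1) that A_ge0 by (simp add: t7_def)
  have "(\<Sum>c\<in>N. 1 - A u c) = 0" using z(2) cardN by (simp add: sum_subtractf f5_def)
  then show "A u c = 1" if "c \<in> N"
    using sum_nonneg_0[OF finN, of "\<lambda>c. 1 - A u c" c] that A_le1 by simp
qed

lemma PR: "P \<subseteq> Rr u" and ND: "N \<subseteq> Ds u"
  using uP uN fl(5,6) unfolding Rr_def Ds_def by auto

lemma sum_Xs: "(\<Sum>x\<in>Xs u. g x) = (\<Sum>x<12. g x) - (g u :: int)"
  unfolding Xs_def using u12 by (simp add: sum_diff1)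

lemma sum_t7: "(\<Sum>x\<in>Xs u. t7 x) = 21"
  using sum_P_cols[OF VW] W3 eps_eq[of u] eu t7_range[of u] f5_range[of u] by (simp add: sum_Xs t7_def)

lemma sum_col: "S \<in> Rr u \<Longrightarrow> S \<notin> P \<Longrightarrow> (\<Sum>x\<in>Xs u. A x S) = 6"
proof -
  assume S: "S \<in> Rr u" "S \<notin> P"
  then have "S \<notin> N" using ND F.DR by auto
  then have "e S = 0" using fl(1)[of S] S by (auto simp: Rr_def)
  then show ?thesis using S by (simp add: sum_Xs e_def Rr_def)
qed

lemma n53: "F.n = 53" and r11: "int (card (Ds u)) = 11"
  using row_facts(1,4)[OF u12] ru eu by auto

lemma b_eq: "d \<in> Ds u \<Longrightarrow> F.b d = e d + 5" by (rule row_facts(3)[OF u12])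

text \<open>The row u avoids P, so its columns have size 6 except the two in N; the correction in
  \<open>Del_eq\<close> sees only these.\<close>

lemma Del_K: "x \<in> Xs u \<Longrightarrow> F.Del x = 4 * K x + f5 x"
proof -
  assume x: "x \<in> Xs u"
  have "(\<Sum>d\<in>Ds u. A x d * (F.b d - 5)) = (\<Sum>d\<in>Ds u. A x d * e d)"
    by (rule sum.cong) (auto simp: b_eq)
  also have "\<dots> = (\<Sum>c<18. A u c * (A x c * e c))" by (rule sum_Ds)
  also have "\<dots> = (\<Sum>c<18. if c \<in> N then - A x c else 0)"
    by (rule sum.cong) (use fl(1,4) uP uN in auto)
  also have "\<dots> = - f5 x" using fl(6) by (simp add: sum.If_cases Int_absorb1 f5_def sum_negf)
  finally show ?thesis using F.Del_eq[OF x] by (simp add: K_def)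
qed

lemma K_nonneg: "x \<in> Xs u \<Longrightarrow> 0 \<le> K x"
  using Del_K[of x] F.Del_nonneg[of x] f5_range[of x] by simp

lemma sum_K: "(\<Sum>x\<in>Xs u. K x) = 2" unfolding K_def using F.sum_kap n53 by simp

lemma rho_K: "F.rho x = rs x - 5 + K x"
  using row_facts(5,7)[OF u12] by (simp add: K_def)

lemma XsD: "x \<in> Xs u \<Longrightarrow> x < 12" "x \<in> Xs u \<Longrightarrow> x \<noteq> u" unfolding Xs_def by auto

text \<open>A row of size 8 with eps = 3 has psi = 0 > 8 - 9, so it is exceptional and shares at
  most four ones with u; this is the claim on K.\<close>

lemma row_type:
  assumes "x \<in> Xs u"
  shows "rs x = 8 \<and> t7 x = 3 \<and> f5 x = 0 \<and> 1 \<le> K x \<or> rs x = 9 \<and> t7 x = f5 x + 1 \<or> rs x = 10 \<and> t7 x = f5 x - 1"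
proof -
  have "1 \<le> K x" if "rs x = 8" "eps x = 3"
    using psi_small(3)[of x u] XsD[OF assms] u12 that row_facts(5)[OF u12] pp_sym[of x u]
    by (simp add: psi_def K_def)
  then show ?thesis using rows[OF XsD[OF assms]] eps_eq[of x] t7_range[of x] f5_range[of x] by auto
qed

lemma card_H: "card {x \<in> Xs u. t7 x = 3} \<le> 2"
proof (rule ccontr)
  assume "\<not> ?thesis"
  then have "card {x \<in> Xs u. t7 x = 3} \<ge> 3" by simp
  then show False using t7_3 cardP fl(5) XsD by (intro K33_ge[of "{x \<in> Xs u. t7 x = 3}" P]) auto
qed

text \<open>Otherwise the variance identity gives kb d at least 1 on both columns of N, which exceeds the available deficit.\<close>
lemma ex_f5_2:
  assumes a: "a \<in> Xs u" "rs a = 8"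
  shows "\<exists>x\<in>Xs u. f5 x = 2"
proof (rule ccontr)
  assume "\<not> ?thesis"
  then have f1: "f5 x \<le> 1" if "x \<in> Xs u" for x using that f5_range[of x] by force
  obtain c d where cd: "N = {c, d}" "c \<noteq> d" using cardN by (auto simp: card_2_iff)
  have kb: "1 \<le> F.kb i" if ij: "{i, j} = N" "i \<noteq> j" for i j
  proof -
    have D: "i \<in> Ds u" "j \<in> Ds u - {i}" using ij ND by auto
    have z: "A x i * A x j = 0" if "x \<in> Xs u" for x
      using f1[OF that] ij A01[of x i] A01[of x j] unfolding f5_def ij(1)[symmetric] by auto
    have "F.kk i j = 0" unfolding F.kk_def by (rule sum.neutral) (use z in blast)
    \<comment> \<open>An empty intersection contributes (-1) * (-2) = 2 to the variance of i at k =
      1. For a block of size 4 among eleven, the constants in \<open>block_variance\<close> cancel: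
      12 - 32 + 20 = 0.\<close>
    then have "2 = (F.kk i j - 1) * (F.kk i j - 1 - 1)" by simp
    also have "\<dots> \<le> (\<Sum>d\<in>Ds u-{i}. (F.kk i d - 1) * (F.kk i d - 1 - 1))"
      by (rule member_le_sum[OF D(2) prod_consec_nonneg]) (use F.finD in auto)
    also have "\<dots> \<le> 2 * F.kb i"
    proof -
      have "i \<in> N" "i < 18" "i \<notin> P" using ij(1) fl(4,6) by auto
      then have "F.b i = 4" using b_eq[OF D(1)] fl(1)[of i] by simp
      then show ?thesis using F.block_variance[OF D(1), of 1] F.Db_nonneg[of i] r11 by simp
    qed
    finally show ?thesis by simp
  qed
  have "2 \<le> F.kb c + F.kb d" using kb[of c d] kb[of d c] cd by (auto simp: insert_commute)
  also have "\<dots> = (\<Sum>x\<in>Xs u. f5 x * K x)"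
    unfolding F.kb_def f5_def K_def using cd by (simp add: sum.distrib[symmetric] distrib_right)
  \<comment> \<open>The row a lies on no column of N, so its share of the total deficit 2, at least
    1, is lost for \<open>kb\<close>.\<close>
  also have "\<dots> \<le> (\<Sum>x\<in>Xs u. K x - (if x = a then K a else 0))"
  proof (rule sum_mono)
    fix x assume x: "x \<in> Xs u"
    have "f5 a = 0" using row_type[OF a(1)] a(2) by auto
    moreover have "f5 x * K x \<le> 1 * K x" using f1[OF x] K_nonneg[OF x] by (intro mult_right_mono)
    ultimately show "f5 x * K x \<le> K x - (if x = a then K a else 0)" by auto
  qed
  also have "\<dots> = 2 - K a" using sum_K a(1) F.finX by (simp add: sum_subtractf)
  finally show False using row_type[OF a(1)] a(2) by auto
qed

end

section \<open>Two hub rows through all three columns of size 7\<close>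

locale hub_rows = exceptional_row +
  fixes h h' :: nat
  assumes hX: "h \<in> Xs u" "h' \<in> Xs u" and hne: "h \<noteq> h'" and t7h: "t7 h = 3" "t7 h' = 3"
    and others: "\<And>x. \<lbrakk>x \<in> Xs u; x \<noteq> h; x \<noteq> h'\<rbrakk> \<Longrightarrow> t7 x = 1 \<or> t7 x = 2 \<and> f5 x = 1"
    and hrho: "9 \<le> rs h + K h" "9 \<le> rs h' + K h'"
begin

lemma finYZ: "finite Y" "finite Z" unfolding Y_def Z_def using F.finX by auto
lemma YX: "y \<in> Y \<Longrightarrow> y \<in> Xs u \<and> y \<noteq> h \<and> y \<noteq> h' \<and> f5 y = 1 \<and> t7 y = 2"
proof -
  assume "y \<in> Y"
  then have y: "y \<in> Xs u" "t7 y = 2" by (auto simp: Y_def)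
  then have "y \<noteq> h" "y \<noteq> h'" using t7h by auto
  then show ?thesis using others[OF y(1)] y by auto
qed
lemma ZX: "z \<in> Z \<Longrightarrow> z \<in> Xs u \<and> z \<noteq> h \<and> z \<noteq> h' \<and> z \<notin> Y \<and> t7 z = 1"
  unfolding Y_def Z_def using t7h by auto

lemma sum_split: "(\<Sum>x\<in>Xs u. g x) = (g h + g h' + (\<Sum>y\<in>Y. g y) + (\<Sum>z\<in>Z. g z) :: int)"
proof -
  have "Xs u = {h, h'} \<union> (Y \<union> Z)" using others hX unfolding Y_def Z_def by auto
  moreover have "{h,h'} \<inter> (Y \<union> Z) = {}" "Y \<inter> Z = {}" using YX ZX by auto
  ultimately show ?thesis using finYZ hne by (simp add: sum.union_disjoint)
qed

lemma cards: "card Y = 6" "card Z = 3"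
proof -
  have "(\<Sum>x\<in>Xs u. (1::int)) = 11" using F.cX by simp
  then have 1: "int (card Y) + int (card Z) = 9" using sum_split[of "\<lambda>_. 1"] by simp
  have "(\<Sum>y\<in>Y. t7 y) = (\<Sum>y\<in>Y. 2)" "(\<Sum>z\<in>Z. t7 z) = (\<Sum>z\<in>Z. 1)" by (auto intro!: sum.cong simp: Y_def Z_def)
  then have "2 * int (card Y) + int (card Z) = 15" using sum_split[of t7] sum_t7 t7h by simp
  with 1 show "card Y = 6" "card Z = 3" by auto
qed

lemma s_nonneg: "x \<in> Xs u \<Longrightarrow> z \<in> Xs u \<Longrightarrow> x \<noteq> z \<Longrightarrow> 0 \<le> s x z"
  using F.dd_le[of x z] by (simp add: s_def)

text \<open>By \<open>I_le_Del\<close> five common rows would all need K >= 1, against the total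
  2.\<close>

lemma I_le_4:
  assumes "S \<in> Rr u" "T \<in> Rr u" "S \<noteq> T"
  shows "card (F.I S T) \<le> 4"
proof (rule ccontr)
  assume c: "\<not> ?thesis"
  have "1 \<le> K z" if z: "z \<in> F.I S T" for z
  proof -
    have "z \<in> Xs u" using z F.I_sub by auto
    then show ?thesis using F.I_le_Del[OF assms z] Del_K[of z] f5_range[of z] c by (simp add: K_def)
  qed
  then have "(\<Sum>z\<in>F.I S T. 1) \<le> (\<Sum>z\<in>F.I S T. K z)" by (rule sum_mono)
  also have "\<dots> \<le> (\<Sum>z\<in>Xs u. K z)" by (rule sum_mono2) (use F.finX F.I_sub K_nonneg in auto)
  finally show False using sum_K c by simp
qed

lemma sum_PP: "(\<Sum>S\<in>P. \<Sum>T\<in>P-{S}. \<Sum>x\<in>G. A x S * A x T * g x) = (\<Sum>x\<in>G. t7 x * (t7 x - 1) * g x)"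
proof -
  have "(\<Sum>S\<in>P. \<Sum>T\<in>P-{S}. \<Sum>x\<in>G. A x S * A x T * g x) = (\<Sum>S\<in>P. \<Sum>x\<in>G. \<Sum>T\<in>P-{S}. A x S * A x T * g x)"
    by (rule sum.cong[OF refl], rule sum.swap)
  also have "\<dots> = (\<Sum>x\<in>G. \<Sum>S\<in>P. \<Sum>T\<in>P-{S}. A x S * A x T * g x)" by (rule sum.swap)
  also have "\<dots> = (\<Sum>x\<in>G. t7 x * (t7 x - 1) * g x)"
  proof (rule sum.cong[OF refl])
    fix x
    have "t7 x * (t7 x - 1) = (\<Sum>S\<in>P. \<Sum>T\<in>P-{S}. A x S * A x T)"
      unfolding t7_def by (rule sum_sq_offdiag[OF finP]) simp
    then show "(\<Sum>S\<in>P. \<Sum>T\<in>P-{S}. A x S * A x T * g x) = t7 x * (t7 x - 1) * g x"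
      by (simp only: sum_distrib_right)
  qed
  finally show ?thesis .
qed

lemma PP_card: "(\<Sum>S\<in>P. \<Sum>T\<in>P-{S}. c) = 6 * (c::int)"
proof -
  have "(\<Sum>S\<in>P. \<Sum>T\<in>P-{S}. c) = (\<Sum>S\<in>P. 2 * c)" by (rule sum.cong) (use cardP finP in auto)
  then show ?thesis using cardP by simp
qed

text \<open>Each hub lies in all six ordered pairs of columns of P and each of the six rows of Y in
  two, 24 incidences in all; so the bound 4 of \<open>I_le_4\<close> is attained by every
  pair.\<close>

lemma I_PP:
  assumes "S \<in> P" "T \<in> P" "S \<noteq> T"
  shows "card (F.I S T) = 4" "F.I S T \<subseteq> {h, h'} \<union> Y" "h \<in> F.I S T"
proof -
  have "(\<Sum>S\<in>P. \<Sum>T\<in>P-{S}. int (card (F.I S T))) = (\<Sum>x\<in>Xs u. t7 x * (t7 x - 1) * 1)"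
    unfolding F.card_I using sum_PP[where G = "Xs u" and g = "\<lambda>_. 1"] by simp
  also have "\<dots> = 24"
  proof -
    have "(\<Sum>y\<in>Y. t7 y * (t7 y - 1) * 1) = (\<Sum>y\<in>Y. 2)" "(\<Sum>z\<in>Z. t7 z * (t7 z - 1) * 1) = 0"
      by (auto intro!: sum.cong simp: Y_def Z_def)
    then show ?thesis using cards t7h by (subst sum_split) simp
  qed
  finally have z: "(\<Sum>S\<in>P. \<Sum>T\<in>P-{S}. 4 - int (card (F.I S T))) = 0"
    unfolding sum_subtractf PP_card by simp
  have g: "0 \<le> 4 - int (card (F.I S T))" if "S \<in> P" "T \<in> P - {S}" for S T
    using I_le_4[of S T] that PR by auto
  have gS: "0 \<le> (\<Sum>T\<in>P-{S}. 4 - int (card (F.I S T)))" if "S \<in> P" for S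
    by (rule sum_nonneg) (rule g[OF that])
  have zS: "(\<Sum>T\<in>P-{S}. 4 - int (card (F.I S T))) = 0" by (rule sum_nonneg_0[OF finP gS z assms(1)])
  have "4 - int (card (F.I S T)) = 0"
    by (rule sum_nonneg_0[OF _ g[OF assms(1)] zS]) (use finP assms in auto)
  then show "card (F.I S T) = 4" by simp
  show "F.I S T \<subseteq> {h, h'} \<union> Y"
  proof
    fix x assume x: "x \<in> F.I S T"
    then have xX: "x \<in> Xs u" using F.I_sub by auto
    have "(\<Sum>c\<in>{S,T}. A x c) \<le> t7 x" unfolding t7_def
      by (rule sum_mono2) (use finP assms A_ge0 in auto)
    then have "t7 x \<ge> 2" using x assms(3) by (simp add: F.I_def)
    then show "x \<in> {h,h'} \<union> Y" using others[OF xX] xX unfolding Y_def by auto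
  qed
  show "h \<in> F.I S T" using t7_3[OF t7h(1)] assms hX by (auto simp: F.I_def)
qed

text \<open>Here \<open>Del y\<close> = 1, and the four-element intersection of the two columns of P
  through y already costs 2 * 3 - 5 = 1 at y, so nothing is missing outside it.\<close>

lemma Y_cell:
  assumes y: "y \<in> Y" and Ky: "K y = 0"
  obtains S T where "S \<in> P" "T \<in> P" "S \<noteq> T" "y \<in> F.I S T" "\<And>v. v \<in> Xs u \<Longrightarrow> v \<noteq> y \<Longrightarrow> v \<notin> F.I S T \<Longrightarrow> s y v = 0"
proof -
  note yX = YX[OF y]
  have "t7 y = (\<Sum>c\<in>{c\<in>P. A y c = 1}. 1)" unfolding t7_def
    by (rule sum.mono_neutral_cong_right) (use finP A01 in auto)
  then have "card {c\<in>P. A y c = 1} = 2" using yX by simp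
  then obtain S T where ST0: "{c\<in>P. A y c = 1} = {S,T}" "S \<noteq> T" by (auto simp: card_2_iff)
  then have ST: "S \<in> P" "T \<in> P" "S \<noteq> T" "A y S = 1" "A y T = 1" by blast+
  have yI: "y \<in> F.I S T" using ST yX by (simp add: F.I_def)
  have Del1: "F.Del y = 1" using Del_K[of y] yX Ky by simp
  have ge: "1 \<le> (\<Sum>v\<in>F.I S T - {y}. s y v)"
    using I_Del_s[of S T y] ST PR yI I_PP(1)[OF ST(1-3)] Ky by (auto simp: K_def)
  have "s y v = 0" if v: "v \<in> Xs u" "v \<noteq> y" "v \<notin> F.I S T" for v
  proof -
    have "(\<Sum>w\<in>insert v (F.I S T - {y}). s y w) \<le> 1"
      using Del_part_s[of y "insert v (F.I S T - {y})"] yX v F.I_sub[of S T] Del1 by auto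
    then have "s y v + (\<Sum>w\<in>F.I S T - {y}. s y w) \<le> 1" using v F.fin_I[of S T] by simp
    then show ?thesis using ge s_nonneg[of y v] yX v by simp
  qed
  then show ?thesis using that[OF ST(1-3) yI] by blast
qed

lemma Y_sZ: "\<lbrakk>y \<in> Y; K y = 0; z \<in> Z\<rbrakk> \<Longrightarrow> s z y = 0"
proof -
  assume y: "y \<in> Y" "K y = 0" and z: "z \<in> Z"
  obtain S T where ST: "S \<in> P" "T \<in> P" "S \<noteq> T" "\<And>v. v \<in> Xs u \<Longrightarrow> v \<noteq> y \<Longrightarrow> v \<notin> F.I S T \<Longrightarrow> s y v = 0"
    using Y_cell[OF y] by metis
  have "z \<notin> F.I S T" using I_PP(2)[OF ST(1-3)] ZX[OF z] by auto
  then show "s z y = 0" using ST(4)[of z] ZX[OF z] y(1) s_sym[of z y] by auto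
qed

lemma Del_hub: "F.Del h = s h h' + (\<Sum>y\<in>Y. s h y) + (\<Sum>z\<in>Z. s h z)"
proof -
  have "(\<Sum>x\<in>Xs u. if x = h then 0 else s h x) = F.Del h"
    unfolding Del_s by (rule sum.mono_neutral_cong_right) (use F.finX in auto)
  then have "F.Del h = s h h' + (\<Sum>y\<in>Y. if y = h then 0 else s h y) + (\<Sum>z\<in>Z. if z = h then 0 else s h z)"
    using sum_split[of "\<lambda>x. if x = h then 0 else s h x"] hne by simp
  moreover have "(\<Sum>y\<in>Y. if y = h then 0 else s h y) = (\<Sum>y\<in>Y. s h y)" "(\<Sum>z\<in>Z. if z = h then 0 else s h z) = (\<Sum>z\<in>Z. s h z)"
    using YX ZX by (auto intro!: sum.cong)
  ultimately show ?thesis by simp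
qed

text \<open>Each of the three pairwise intersections in P contains h and costs at least 2 * 3 - (5 -
  K h) = 1 + K h there. The other hub lies in all three intersections, a row of Y in exactly
  one.\<close>

lemma hub_cells: "3 * (1 + K h) \<le> 3 * s h h' + (\<Sum>y\<in>Y. s h y)"
proof -
  let ?g = "\<lambda>x. if x = h then 0 else s h x"
  have "6 * (1 + K h) \<le> (\<Sum>S\<in>P. \<Sum>T\<in>P-{S}. \<Sum>x\<in>Xs u. A x S * A x T * ?g x)"
    unfolding PP_card[symmetric]
  proof (intro sum_mono)
    fix S T assume "S \<in> P" "T \<in> P - {S}"
    then have ST: "S \<in> P" "T \<in> P" "S \<noteq> T" by auto
    have "1 + K h \<le> (\<Sum>v\<in>F.I S T - {h}. s h v)"
      using I_Del_s[of S T h] ST PR I_PP[OF ST] by (auto simp: K_def)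
    also have "\<dots> = (\<Sum>v\<in>F.I S T. ?g v)"
      by (rule sum.mono_neutral_cong_left) (use F.fin_I in auto)
    also have "\<dots> = (\<Sum>x\<in>Xs u. A x S * A x T * ?g x)" by (rule F.sum_I)
    finally show "1 + K h \<le> (\<Sum>x\<in>Xs u. A x S * A x T * ?g x)" .
  qed
  also have "\<dots> = (\<Sum>x\<in>Xs u. t7 x * (t7 x - 1) * ?g x)" by (rule sum_PP)
  also have "\<dots> = 6 * s h h' + (\<Sum>y\<in>Y. 2 * s h y)"
  proof -
    have "(\<Sum>y\<in>Y. t7 y * (t7 y - 1) * ?g y) = (\<Sum>y\<in>Y. 2 * s h y)" "(\<Sum>z\<in>Z. t7 z * (t7 z - 1) * ?g z) = 0"
      using YX ZX by (auto intro!: sum.cong sum.neutral)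
    then show ?thesis using t7h hne by (subst sum_split) simp
  qed
  finally show ?thesis by (simp add: sum_distrib_left[symmetric])
qed

text \<open>A column outside P through the hub h alone meets some column of P in four rows: it has at most three rows in Z, so at least two in Y.\<close>
lemma big_cell:
  obtains G where "G \<subseteq> Y \<union> Z" "card G = 3" "\<And>y. \<lbrakk>y \<in> G; y \<in> Y; K y = 0\<rbrakk> \<Longrightarrow> 1 \<le> s h y"
    "\<And>v. v \<in> G \<Longrightarrow> 1 + K v \<le> s h v + (\<Sum>w\<in>G-{v}. s v w)"
    "\<And>v. v \<in> G \<Longrightarrow> 1 \<le> 3 * K v + f5 v"
proof -
  \<comment> \<open>\<open>hrho\<close> means that \<open>F.rho h\<close> is at least 4, one more
    than the columns of P provide.\<close>
  have "(\<Sum>S\<in>Rr u. A h S) = (\<Sum>S\<in>Rr u - P. A h S) + t7 h"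
    unfolding t7_def by (rule sum.subset_diff[OF PR F.finR])
  then have "(\<Sum>S\<in>Rr u - P. A h S) \<ge> 1" using rho_K[of h] hrho(1) t7h unfolding F.rho_def by simp
  then obtain S where S: "S \<in> Rr u" "S \<notin> P" "A h S = 1"
    using A01 by (metis (no_types, lifting) DiffD1 DiffD2 not_one_le_zero sum.neutral)
  have SP: "S \<notin> P" "\<And>T. T \<in> P \<Longrightarrow> T \<in> Rr u \<and> T \<noteq> S" using S PR by auto
  have sumS: "A h S + A h' S + (\<Sum>y\<in>Y. A y S) + (\<Sum>z\<in>Z. A z S) = 6"
    using sum_col[OF S(1,2)] sum_split[of "\<lambda>x. A x S"] by simp
  have Z3: "(\<Sum>z\<in>Z. A z S) \<le> 3" using sum_mono[of Z "\<lambda>z. A z S" "\<lambda>_. 1"] A_le1 cards by simp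
  \<comment> \<open>If S contained both hubs, a row of Y on S would join them on S and on its own
    two columns of P. So S would have at most the two hubs and the three rows of Z, but it has six
    rows.\<close>
  have h'S: "A h' S = 0"
  proof (rule ccontr)
    assume "A h' S \<noteq> 0"
    then have h'1: "A h' S = 1" using A01[of h' S] by auto
    have "A y S = 0" if y: "y \<in> Y" for y
    proof (rule ccontr)
      assume "A y S \<noteq> 0"
      then have y1: "A y S = 1" using A01[of y S] by auto
      note yX = YX[OF y]
      have "t7 y = (\<Sum>c\<in>{c\<in>P. A y c = 1}. 1)" unfolding t7_def
        by (rule sum.mono_neutral_cong_right) (use finP A01 in auto)
      then have "card {c\<in>P. A y c = 1} = 2" using yX by simp
      then have "card (insert S {c\<in>P. A y c = 1}) = 3" using S finP by simp
      moreover have "card {h,h',y} = 3" using hne yX by auto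
      ultimately show False
        using t7_3[OF t7h(1)] t7_3[OF t7h(2)] S(1,3) h'1 y1 hX yX fl(5)
        by (intro K33[of "{h,h',y}" "insert S {c\<in>P. A y c = 1}"]) (auto simp: Xs_def Rr_def)
    qed
    then show False using sumS Z3 S(3) h'1 by simp
  qed
  \<comment> \<open>The three intersections of S with P have total size 3 plus twice the five rows
    of S other than h, minus those of them in Z (at most three): at least 10, more than 3 *
    3.\<close>
  have "\<exists>T\<in>P. card (F.I T S) \<ge> 4"
  proof (rule ccontr)
    assume "\<not> ?thesis"
    then have "(\<Sum>T\<in>P. int (card (F.I T S))) \<le> (\<Sum>T\<in>P. 3)" by (intro sum_mono) force
    moreover have "(\<Sum>T\<in>P. int (card (F.I T S))) = (\<Sum>x\<in>Xs u. t7 x * A x S)"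
      unfolding F.card_I t7_def by (subst sum.swap) (simp add: sum_distrib_right)
    moreover have "\<dots> = 3 + (\<Sum>y\<in>Y. 2 * A y S) + (\<Sum>z\<in>Z. A z S)"
    proof -
      have "(\<Sum>y\<in>Y. t7 y * A y S) = (\<Sum>y\<in>Y. 2 * A y S)" "(\<Sum>z\<in>Z. t7 z * A z S) = (\<Sum>z\<in>Z. A z S)"
        by (auto intro!: sum.cong simp: Y_def Z_def)
      then show ?thesis using t7h S(3) h'S by (subst sum_split) simp
    qed
    ultimately show False using sumS Z3 S(3) h'S cardP by (simp add: sum_distrib_left[symmetric])
  qed
  then obtain T where T: "T \<in> P" "card (F.I T S) \<ge> 4" by blast
  have TR: "T \<in> Rr u" "T \<noteq> S" using SP(2)[OF T(1)] by auto
  have c4: "card (F.I T S) = 4" using I_le_4[OF TR(1) S(1) TR(2)] T(2) by simp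
  have hI: "h \<in> F.I T S" using t7_3[OF t7h(1) T(1)] S(3) hX by (simp add: F.I_def)
  define G where "G = F.I T S - {h}"
  have fG: "finite G" unfolding G_def using F.fin_I by simp
  have cG: "card G = 3" unfolding G_def using c4 hI F.fin_I by simp
  have hG: "h \<notin> G" unfolding G_def by simp
  have IG: "F.I T S = insert h G" unfolding G_def using hI by auto
  have GX: "x \<in> Xs u \<and> A x S = 1 \<and> A x T = 1 \<and> x \<noteq> h \<and> x \<noteq> h'" if "x \<in> G" for x
    using that h'S unfolding G_def F.I_def by auto
  have GYZ: "G \<subseteq> Y \<union> Z"
  proof
    fix x assume "x \<in> G"
    then show "x \<in> Y \<union> Z" using GX[of x] others[of x] unfolding Y_def Z_def by auto
  qed
  have def: "1 + K v \<le> s h v + (\<Sum>w\<in>G-{v}. s v w)" if v: "v \<in> G" for v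
  proof -
    have "1 + K v \<le> (\<Sum>w\<in>F.I T S - {v}. s v w)"
      using I_Del_s[OF TR(1) S(1) TR(2), of v] v c4 unfolding G_def K_def by simp
    also have "F.I T S - {v} = insert h (G - {v})" using IG v hG by auto
    finally show ?thesis using fG hG by (simp add: s_sym[of v h])
  qed
  have ge1: "1 \<le> 3 * K v + f5 v" if v: "v \<in> G" for v
    using F.I_le_Del[OF TR(1) S(1) TR(2), of v] v c4 Del_K[of v] GX[OF v] unfolding G_def K_def by simp
  \<comment> \<open>By \<open>Y_cell\<close> the missing pairs of y stay in its own intersection of
    two columns of P. Another row of G there would lie with h and y on those two columns and S. So
    the missing pair demanded at y must be the one with h.\<close>
  have adj: "1 \<le> s h y" if y: "y \<in> G" "y \<in> Y" "K y = 0" for y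
  proof -
    obtain T1 T2 where T12: "T1 \<in> P" "T2 \<in> P" "T1 \<noteq> T2" "y \<in> F.I T1 T2"
      "\<And>v. v \<in> Xs u \<Longrightarrow> v \<noteq> y \<Longrightarrow> v \<notin> F.I T1 T2 \<Longrightarrow> s y v = 0"
      using Y_cell[OF y(2,3)] by metis
    have "s y w = 0" if w: "w \<in> G - {y}" for w
    proof (rule T12(5))
      show "w \<in> Xs u" "w \<noteq> y" using w GX by auto
      show "w \<notin> F.I T1 T2"
      proof
        assume wI: "w \<in> F.I T1 T2"
        have "card {h,y,w} \<le> 2"
          using T12(1-4) wI SP S(1,3) GX[OF y(1)] GX[of w] w t7_3[OF t7h(1)] hX
          by (intro F.K33_cols[of T1 T2 S]) (auto simp: F.I_def)
        moreover have "card {h,y,w} = 3" using GX[OF y(1)] GX[of w] w by auto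
        ultimately show False by simp
      qed
    qed
    then have "(\<Sum>w\<in>G-{y}. s y w) = 0" by (intro sum.neutral) auto
    then show ?thesis using def[OF y(1)] y(3) by simp
  qed
  show ?thesis by (rule that[OF GYZ cG adj def ge1])
qed

end

section \<open>The two hub patterns and their refutation\<close>

context exceptional_row begin

text \<open>The sizes of the rows other than u fall 1 short of 9 on average times 11, so rows of
  size 8 outnumber those of size 10 by one. The row x on both columns of N from
  \<open>ex_f5_2\<close> either has size 9 and is itself the second hub, or has size 10 and forces a
  second row of size 8, which is the second hub.\<close>

lemma hubs_cases:
  obtains h h' where "hub_rows A u h h'" "K h \<ge> 1" "f5 h = 0" "f5 h' = 2" "\<And>z. z \<in> Z \<Longrightarrow> f5 z = 0"
  | h h' c where "hub_rows A u h h'" "K h \<ge> 1" "K h' \<ge> 1" "f5 h = 0" "f5 h' = 0" "c \<in> Z" "f5 c = 2" "\<And>z. z \<in> Z \<Longrightarrow> z \<noteq> c \<Longrightarrow> f5 z = 0"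
proof -
  let ?S8 = "{x \<in> Xs u. rs x = 8}" and ?S10 = "{x \<in> Xs u. rs x = 10}" and ?H = "{x \<in> Xs u. t7 x = 3}"
  have fin: "finite ?S8" "finite ?S10" "finite ?H" using F.finX by auto
  have S8H: "?S8 \<subseteq> ?H" using row_type by force
  have c8: "card ?S8 \<le> card ?H" by (rule card_mono[OF fin(3) S8H])
  have "(\<Sum>x\<in>Xs u. rs x - 9) = -1" using sum_Xs[of rs] sum_rs ru F.cX by (simp add: sum_subtractf)
  moreover have "(\<Sum>x\<in>Xs u. rs x - 9) = (\<Sum>x\<in>Xs u. (if rs x = 10 then 1 else 0) - (if rs x = 8 then 1 else 0))"
    by (rule sum.cong) (use row_type in force)+
  moreover have "\<dots> = int (card ?S10) - int (card ?S8)"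
    using F.finX by (simp add: sum_subtractf sum.If_cases Int_def)
  ultimately have n810: "card ?S8 = card ?S10 + 1" by simp
  then have "?S8 \<noteq> {}" by (metis add_is_0 card.empty one_neq_zero)
  then obtain a where a: "a \<in> Xs u" "rs a = 8" by blast
  obtain x where x: "x \<in> Xs u" "f5 x = 2" using ex_f5_2[OF a] by blast
  have ta: "t7 a = 3" "f5 a = 0" "K a \<ge> 1" using row_type[OF a(1)] a(2) by auto
  have ax: "a \<noteq> x" using ta x by auto
  consider "rs x = 9" "t7 x = 3" | "rs x = 10" "t7 x = 1" using row_type[OF x(1)] x(2) by auto
  then show ?thesis
  proof cases
    case 1
    have "{a,x} \<subseteq> ?H" using a x ta 1 by auto
    then have H: "?H = {a,x}" using card_H card_mono[OF fin(3)] ax card_seteq[OF fin(3), of "{a,x}"] by simp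
    have "x \<in> ?H" "x \<notin> ?S8" using x 1 by auto
    then have "?S8 \<subset> ?H" using S8H by blast
    then have "card ?S8 < card ?H" by (rule psubset_card_mono[OF fin(3)])
    then have "card ?S10 = 0" using n810 card_H by simp
    then have no10: "rs z \<noteq> 10" if "z \<in> Xs u" for z using fin(2) that by auto
    have oth: "rs z = 9 \<and> (t7 z = 1 \<and> f5 z = 0 \<or> t7 z = 2 \<and> f5 z = 1)" if z: "z \<in> Xs u" "z \<noteq> a" "z \<noteq> x" for z
    proof -
      have "t7 z \<noteq> 3" using H z by blast
      then show ?thesis using row_type[OF z(1)] no10[OF z(1)] f5_range[of z] by auto
    qed
    have hb: "hub_rows A u a x"
      by unfold_locales (use a x ta 1 ax oth K_nonneg[OF x(1)] in auto)
    have "f5 z = 0" if "z \<in> Z" for z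
    proof -
      have z: "z \<in> Xs u" "t7 z = 1" using that by (auto simp: Z_def)
      then have "z \<noteq> a" "z \<noteq> x" using ta 1 by auto
      then show ?thesis using oth[OF z(1)] z(2) by auto
    qed
    then show ?thesis using that(1)[OF hb] ta x by blast
  next
    case 2
    have "card ?S10 \<ge> 1" using x 2 fin(2) by (metis (mono_tags, lifting) One_nat_def Suc_leI card_gt_0_iff empty_iff mem_Collect_eq)
    then have c: "card ?S8 = 2" "card ?S10 = 1" "card ?H = 2" using n810 c8 card_H by linarith+
    then have H8: "?H = ?S8" using card_subset_eq[OF fin(3) S8H] by simp
    obtain a' where a': "?S8 = {a,a'}" "a \<noteq> a'"
    proof -
      obtain p q where "?S8 = {p,q}" "p \<noteq> q" using c(1) by (auto simp: card_2_iff)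
      moreover have "a \<in> ?S8" using a by simp
      ultimately show ?thesis using that by (metis doubleton_eq_iff insert_iff singletonD)
    qed
    have aX: "a' \<in> Xs u" "rs a' = 8" using a' by blast+
    have ta': "t7 a' = 3" "f5 a' = 0" "K a' \<ge> 1" using row_type[OF aX(1)] aX(2) by auto
    have S10: "?S10 = {x}" using c(2) x 2 by (metis (mono_tags, lifting) card_1_singletonE mem_Collect_eq singletonD)
    have oth: "t7 z = 1 \<and> f5 z = 0 \<or> t7 z = 2 \<and> f5 z = 1" if z: "z \<in> Xs u" "z \<noteq> a" "z \<noteq> a'" "z \<noteq> x" for z
    proof -
      have "t7 z \<noteq> 3" "rs z \<noteq> 10" using H8 a' S10 z by blast+
      then show ?thesis using row_type[OF z(1)] f5_range[of z] by auto
    qed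
    have hb: "hub_rows A u a a'"
    proof unfold_locales
      fix z assume z: "z \<in> Xs u" "z \<noteq> a" "z \<noteq> a'"
      then show "t7 z = 1 \<or> t7 z = 2 \<and> f5 z = 1" using oth[of z] 2 by (cases "z = x") auto
    qed (use a aX a' ta ta' in auto)
    have "f5 z = 0" if "z \<in> Z" "z \<noteq> x" for z
    proof -
      have z: "z \<in> Xs u" "t7 z = 1" using that by (auto simp: Z_def)
      then have "z \<noteq> a" "z \<noteq> a'" using ta ta' by auto
      then show ?thesis using oth[OF z(1)] z(2) that(2) by auto
    qed
    then show ?thesis using that(2)[OF hb, of x] ta ta' x 2 by (auto simp: Z_def)
  qed
qed

theorem gridE_False: False
proof (rule hubs_cases)
  fix h h' assume hb: "hub_rows A u h h'" and K1: "K h \<ge> 1" and f: "f5 h = 0" "f5 h' = 2" and fZ: "\<And>z. z \<in> Z \<Longrightarrow> f5 z = 0"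
  interpret H: hub_rows A u h h' by (rule hb)
  interpret H': hub_rows A u h' h
    by unfold_locales (use H.hX H.hne H.t7h H.hrho H.others in auto)
  have ss: "s h' h = s h h'" by (simp add: s_sym[of h'])
  have Ksum: "K h + K h' + (\<Sum>y\<in>Y. K y) + (\<Sum>z\<in>Z. K z) = 2" using sum_K H.sum_split[of K] by simp
  have KYZ: "0 \<le> K x" if "x \<in> Y \<union> Z" for x using that K_nonneg H.YX H.ZX by auto
  have KG: "(\<Sum>x\<in>G. K x) \<le> (\<Sum>y\<in>Y. K y) + (\<Sum>z\<in>Z. K z)" if "G \<subseteq> Y \<union> Z" for G
  proof -
    have "(\<Sum>x\<in>G. K x) \<le> (\<Sum>x\<in>Y \<union> Z. K x)" by (rule sum_mono2) (use that H.finYZ KYZ in auto)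
    then show ?thesis using H.finYZ H.ZX by (subst (asm) sum.union_disjoint) auto
  qed
  have SG: "(\<Sum>x\<in>G. s k x) \<le> (\<Sum>y\<in>Y. s k y) + (\<Sum>z\<in>Z. s k z)" if "G \<subseteq> Y \<union> Z" "k = h \<or> k = h'" for G k
  proof -
    have "(\<Sum>x\<in>G. s k x) \<le> (\<Sum>x\<in>Y \<union> Z. s k x)"
    proof (rule sum_mono2)
      fix b assume "b \<in> Y \<union> Z - G"
      then show "0 \<le> s k b" using that(2) H.hX H.YX[of b] H.ZX[of b] by (intro H.s_nonneg) auto
    qed (use that H.finYZ in auto)
    then show ?thesis using H.finYZ H.ZX by (subst (asm) sum.union_disjoint) auto
  qed
  have Dh: "F.Del h = 4 * K h" "F.Del h' = 4 * K h' + 2" using Del_K H.hX f by auto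
  \<comment> \<open>Each row of G either has K >= 1 or misses a pair with k: a row of Z with K = 0
    also has f5 = 0 and is excluded by the last condition on G.\<close>
  have lower: "3 - (\<Sum>x\<in>G. K x) \<le> (\<Sum>x\<in>G. s k x)"
    if G: "G \<subseteq> Y \<union> Z" "card G = 3" "\<And>y. \<lbrakk>y \<in> G; y \<in> Y; K y = 0\<rbrakk> \<Longrightarrow> 1 \<le> s k y" "\<And>v. v \<in> G \<Longrightarrow> 1 \<le> 3 * K v + f5 v"
      and k: "k = h \<or> k = h'" for G k
  proof -
    have "(\<Sum>x\<in>G. 1 - K x) \<le> (\<Sum>x\<in>G. s k x)"
    proof (rule sum_mono)
      fix x assume x: "x \<in> G"
      have xYZ: "x \<in> Y \<union> Z" using x G(1) by auto
      have "0 \<le> s k x" using k H.hX H.YX[of x] H.ZX[of x] xYZ by (intro H.s_nonneg) auto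
      then show "1 - K x \<le> s k x" using G(3)[OF x] G(4)[OF x] fZ[of x] KYZ[OF xYZ] xYZ by (cases "K x = 0") auto
    qed
    then show ?thesis using G(2) by (simp add: sum_subtractf)
  qed
  have nn: "0 \<le> (\<Sum>z\<in>Z. s h z)" "0 \<le> (\<Sum>z\<in>Z. s h' z)"
    using H.hX H.ZX by (auto intro!: sum_nonneg H.s_nonneg)
  show False
  proof (cases "K h' = 0")
    case True
    obtain G where G: "G \<subseteq> Y \<union> Z" "card G = 3" "\<And>y. \<lbrakk>y \<in> G; y \<in> Y; K y = 0\<rbrakk> \<Longrightarrow> 1 \<le> s h' y" "\<And>v. v \<in> G \<Longrightarrow> 1 \<le> 3 * K v + f5 v"
      using H'.big_cell by metis
    have "3 - (\<Sum>x\<in>G. K x) \<le> (\<Sum>y\<in>Y. s h' y) + (\<Sum>z\<in>Z. s h' z)"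
    proof -
      have "3 - (\<Sum>x\<in>G. K x) \<le> (\<Sum>x\<in>G. s h' x)" by (rule lower[OF G]) auto
      also have "\<dots> \<le> (\<Sum>y\<in>Y. s h' y) + (\<Sum>z\<in>Z. s h' z)" by (rule SG[OF G(1)]) simp
      finally show ?thesis .
    qed
    \<comment> \<open>Only two pairs are missing at h', and G uses at least 1 + K h of them. So K h
      = 1 and \<open>s h h'\<close> = 0, whereas \<open>hub_cells\<close> and the total 4 * K h at h
      require 3 <= 2 * \<open>s h h'\<close> + K h.\<close>
    then have "1 + K h + s h h' \<le> 2" using H'.Del_hub Dh True KG[OF G(1)] Ksum ss by linarith
    moreover have "3 + 3 * K h \<le> 2 * s h h' + 4 * K h" using H.hub_cells H.Del_hub Dh(1) nn(1) by (smt (verit))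
    ultimately show False using K1 by linarith
  next
    case False
    then have "K h' \<ge> 1" using K_nonneg[of h'] H.hX by simp
    have KYZ0: "0 \<le> (\<Sum>y\<in>Y. K y)" "0 \<le> (\<Sum>z\<in>Z. K z)" using KYZ by (auto intro: sum_nonneg)
    then have K11: "K h = 1" "K h' = 1" "(\<Sum>y\<in>Y. K y) = 0" "(\<Sum>z\<in>Z. K z) = 0" using Ksum K1 \<open>K h' \<ge> 1\<close> by linarith+
    have KY0: "K y = 0" if "y \<in> Y" for y using sum_nonneg_0[OF H.finYZ(1) _ K11(3) that] KYZ by simp
    have KZ0: "K z = 0" if "z \<in> Z" for z using sum_nonneg_0[OF H.finYZ(2) _ K11(4) that] KYZ by simp
    obtain G where G: "G \<subseteq> Y \<union> Z" "card G = 3" "\<And>y. \<lbrakk>y \<in> G; y \<in> Y; K y = 0\<rbrakk> \<Longrightarrow> 1 \<le> s h y" "\<And>v. v \<in> G \<Longrightarrow> 1 \<le> 3 * K v + f5 v"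
      using H.big_cell by metis
    have sZ: "s k z = 0" if z: "z \<in> Z" and k: "k = h \<or> k = h'" for z k
    proof -
      have "F.Del z = 0" using Del_K[of z] H.ZX[OF z] KZ0[OF z] fZ[OF z] by simp
      then have "s z k \<le> 0" using Del_part_s[of z "{k}"] H.ZX[OF z] k H.hX by auto
      then show ?thesis using H.s_nonneg[of z k] H.ZX[OF z] k H.hX s_sym[of k z] by auto
    qed
    have Z0: "(\<Sum>z\<in>Z. s h z) = 0" "(\<Sum>z\<in>Z. s h' z) = 0" using sZ by (auto intro: sum.neutral)
    have "(\<Sum>x\<in>G. K x) \<le> 0" using KG[OF G(1)] K11 by simp
    moreover have "3 - (\<Sum>x\<in>G. K x) \<le> (\<Sum>x\<in>G. s h x)" by (rule lower[OF G]) auto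
    moreover have "(\<Sum>x\<in>G. s h x) \<le> (\<Sum>y\<in>Y. s h y) + (\<Sum>z\<in>Z. s h z)" by (rule SG[OF G(1)]) simp
    ultimately have al: "3 \<le> (\<Sum>y\<in>Y. s h y)" using Z0 by linarith
    \<comment> \<open>A row of Y now has one missing pair, so Y supplies the hubs with at most 6.
      They need 4 + 6 = 10, hence \<open>s h h'\<close> >= 2; but Y already takes 3 of the 4 at
      h.\<close>
    have "(\<Sum>y\<in>Y. s h y + s h' y) \<le> (\<Sum>y\<in>Y. 1)"
    proof (rule sum_mono)
      fix y assume y: "y \<in> Y"
      note yX = H.YX[OF y]
      have "(\<Sum>v\<in>{h,h'}. s y v) \<le> F.Del y" using yX H.hX by (intro Del_part_s) auto
      then show "s h y + s h' y \<le> 1" using Del_K[of y] yX KY0[OF y] H.hne s_sym[of h y] s_sym[of h' y] by simp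
    qed
    then have "(\<Sum>y\<in>Y. s h y) + (\<Sum>y\<in>Y. s h' y) \<le> 6" using H.cards by (simp add: sum.distrib)
    then show False using al H.Del_hub H'.Del_hub Dh K11 Z0 ss by (smt (verit))
  qed
next
  fix h h' c assume hb: "hub_rows A u h h'" and K1: "K h \<ge> 1" "K h' \<ge> 1" and f: "f5 h = 0" "f5 h' = 0"
    and c: "c \<in> Z" "f5 c = 2" and fZ: "\<And>z. z \<in> Z \<Longrightarrow> z \<noteq> c \<Longrightarrow> f5 z = 0"
  interpret H: hub_rows A u h h' by (rule hb)
  interpret H': hub_rows A u h' h
    by unfold_locales (use H.hX H.hne H.t7h H.hrho H.others in auto)
  have Ksum: "K h + K h' + (\<Sum>y\<in>Y. K y) + (\<Sum>z\<in>Z. K z) = 2" using sum_K H.sum_split[of K] by simp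
  have KYZ: "0 \<le> K x" if "x \<in> Y \<union> Z" for x using that K_nonneg H.YX H.ZX by auto
  have KYZ0: "0 \<le> (\<Sum>y\<in>Y. K y)" "0 \<le> (\<Sum>z\<in>Z. K z)" using KYZ by (auto intro: sum_nonneg)
  then have K11: "K h = 1" "K h' = 1" "(\<Sum>y\<in>Y. K y) = 0" "(\<Sum>z\<in>Z. K z) = 0" using Ksum K1 by linarith+
  have KY0: "K y = 0" if "y \<in> Y" for y using sum_nonneg_0[OF H.finYZ(1) _ K11(3) that] KYZ by simp
  have KZ0: "K z = 0" if "z \<in> Z" for z using sum_nonneg_0[OF H.finYZ(2) _ K11(4) that] KYZ by simp
  note cX = H.ZX[OF c(1)]
  have sZ: "s z v = 0" if z: "z \<in> Z" "z \<noteq> c" and v: "v \<in> Xs u" "v \<noteq> z" for z v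
  proof -
    have "F.Del z = 0" using Del_K[of z] H.ZX[OF z(1)] KZ0[OF z(1)] fZ[OF z] by simp
    then have "s z v \<le> 0" using Del_part_s[of z "{v}"] H.ZX[OF z(1)] v by auto
    then show ?thesis using H.s_nonneg[of z v] H.ZX[OF z(1)] v by auto
  qed
  \<comment> \<open>The three rows of G lie in Y or are c, and each misses a pair with k. With the
    total 4 at k this gives \<open>s k k'\<close> <= 1, and then \<open>hub_cells\<close> uses up
    the whole total, leaving nothing for c.\<close>
  have key: "s k c = 0" if hk: "hub_rows A u k k'" and kk: "k = h \<and> k' = h' \<or> k = h' \<and> k' = h" for k k'
  proof -
    interpret J: hub_rows A u k k' by (rule hk)
    have kX: "k \<in> Xs u" "K k = 1" "f5 k = 0" using kk H.hX K11 f by auto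
    obtain G where G: "G \<subseteq> Y \<union> Z" "card G = 3" "\<And>y. \<lbrakk>y \<in> G; y \<in> Y; K y = 0\<rbrakk> \<Longrightarrow> 1 \<le> s k y"
        "\<And>v. v \<in> G \<Longrightarrow> 1 + K v \<le> s k v + (\<Sum>w\<in>G-{v}. s v w)" "\<And>v. v \<in> G \<Longrightarrow> 1 \<le> 3 * K v + f5 v"
      using J.big_cell by metis
    have Gc: "G \<subseteq> insert c Y"
    proof
      fix v assume v: "v \<in> G"
      show "v \<in> insert c Y" using G(1,5) v fZ[of v] KZ0[of v] by fastforce
    qed
    have "1 \<le> s k v" if v: "v \<in> G" for v
    proof (cases "v = c")
      case True
      have "(\<Sum>w\<in>G-{c}. s c w) = 0" using Gc KY0 H.Y_sZ[OF _ _ c(1)] by (intro sum.neutral) auto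
      then show ?thesis using G(4)[OF v] True KZ0[OF c(1)] by simp
    next
      case False
      then have "v \<in> Y" using Gc v by auto
      then show ?thesis using G(3)[OF v] KY0 by simp
    qed
    then have "(\<Sum>v\<in>G. 1) \<le> (\<Sum>v\<in>G. s k v)" by (rule sum_mono)
    also have "\<dots> \<le> (\<Sum>v\<in>insert c Y. s k v)"
    proof (rule sum_mono2)
      fix b assume "b \<in> insert c Y - G"
      then show "0 \<le> s k b" using kX J.YX[of b] J.ZX[OF c(1)] by (intro H.s_nonneg) auto
    qed (use Gc H.finYZ in auto)
    also have "\<dots> = s k c + (\<Sum>v\<in>Y. s k v)" using cX H.finYZ by simp
    finally have 1: "3 \<le> s k c + (\<Sum>v\<in>Y. s k v)" using G(2) by simp
    have "(\<Sum>z\<in>Z. s k z) = s k c + (\<Sum>z\<in>Z-{c}. s k z)" using c(1) H.finYZ by (simp add: sum.remove)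
    moreover have "(\<Sum>z\<in>Z-{c}. s k z) = 0"
    proof (rule sum.neutral, rule ballI)
      fix z assume z: "z \<in> Z - {c}"
      then show "s k z = 0" using sZ[of z k] kX J.ZX[of z] s_sym[of k z] by auto
    qed
    ultimately have 2: "4 = s k k' + (\<Sum>y\<in>Y. s k y) + s k c" using J.Del_hub Del_K[OF kX(1)] kX by simp
    have 3: "6 \<le> 3 * s k k' + (\<Sum>y\<in>Y. s k y)" using J.hub_cells kX by simp
    have "0 \<le> s k c" using kX J.ZX[OF c(1)] by (intro H.s_nonneg) auto
    then show "s k c = 0" using 1 2 3 by (smt (verit))
  qed
  have k1: "s h c = 0" by (rule key[of h h']) (use hb in auto)
  have k2: "s h' c = 0" by (rule key[of h' h]) (use H'.hub_rows_axioms in auto)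
  \<comment> \<open>No kind of row is left with which c could miss a pair, although c lies on both
    columns of N and so \<open>F.Del c\<close> = 2.\<close>
  have "F.Del c = (\<Sum>x\<in>Xs u. if x = c then 0 else s c x)"
    unfolding Del_s by (rule sum.mono_neutral_cong_left) (use F.finX in auto)
  also have "\<dots> = 0"
  proof (rule sum.neutral, rule ballI)
    fix x assume x: "x \<in> Xs u"
    consider "x = c" | "x = h" | "x = h'" | "x \<in> Y" | "x \<in> Z" "x \<noteq> c" using H.others[OF x] x unfolding Y_def Z_def by blast
    then show "(if x = c then 0 else s c x) = 0"
    proof cases
      case 4 then show ?thesis using H.Y_sZ[OF _ KY0 c(1)] by simp
    next
      case 5 then show ?thesis using sZ[of x c] cX s_sym[of c x] by auto
    qed (use k1 k2 s_sym[of c] in auto)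
  qed
  finally show False using Del_K[of c] cX KZ0[OF c(1)] c(2) by simp
qed

end

section \<open>Uniqueness of the row of size 11 and conclusion\<close>

context K33_free_grid begin

lemma V5_rows:
  assumes V5: "V = 5" and y: "y < 12"
  shows "rs y = 11 \<and> eps y = -2 \<and> psi y = 2 \<or> psi y \<le> 0"
    "psi y = 0 \<Longrightarrow> rs y = 8 \<and> eps y = 3 \<or> rs y = 9 \<and> eps y = 1 \<or> rs y = 10 \<and> eps y = -1"
proof -
  have W: "-2 \<le> eps y" "eps y \<le> 3" using eps_ge[of y] eps_le[of y] V_5_W[OF V5] by auto
  show 1: "rs y = 11 \<and> eps y = -2 \<and> psi y = 2 \<or> psi y \<le> 0"
  proof (cases "rs y = 11")
    case True
    then have "eps y = -2" using row_bounds(12)[OF y] W by linarith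
    then show ?thesis using True by (simp add: psi_def)
  next
    case False
    then show ?thesis using row_bounds(1,10,11,12,13)[OF y] rs_cases[of y] W by (auto simp: psi_def)
  qed
  assume "psi y = 0"
  then have "2 * rs y + eps y = 19" by (simp add: psi_def)
  then show "rs y = 8 \<and> eps y = 3 \<or> rs y = 9 \<and> eps y = 1 \<or> rs y = 10 \<and> eps y = -1"
    using row_bounds(12)[OF y] W by presburger
qed

text \<open>Both rows avoid the three columns of P, so z has at most 18 - 11 - 3 = 4 ones off y and
  the two share at least seven columns, including both of N. The other ten rows meet these common
  columns in at least 4 * 7 - 2 = 26 places, but each of them in at most two.\<close>

lemma two_eleven_rows:
  assumes V5: "V = 5" and y: "y < 12" "z < 12" "y \<noteq> z" "rs y = 11" "eps y = -2" "rs z = 11" "eps z = -2"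
  shows False
proof -
  have W: "W = 3" by (rule V_5_W[OF V5])
  have VW: "V = 2 * W - 1" using V5 W by simp
  note fl = flat[OF VW]
  have fin: "finite P" "finite N" using fl(5,6) finite_subset by blast+
  have PN: "(\<forall>c\<in>P. A x c = 0) \<and> (\<forall>c\<in>N. A x c = 1)" if "eps x = -2" for x
  proof -
    have p: "0 \<le> (\<Sum>c\<in>P. A x c)" by (intro sum_nonneg A_ge0)
    have n: "0 \<le> (\<Sum>c\<in>N. 1 - A x c)" by (intro sum_nonneg) (simp add: A_le1)
    have "(\<Sum>c\<in>N. 1 - A x c) = 2 - (\<Sum>c\<in>N. A x c)" using fl(3) W by (simp add: sum_subtractf)
    then have z: "(\<Sum>c\<in>P. A x c) = 0" "(\<Sum>c\<in>N. 1 - A x c) = 0" using fl(7)[of x] that p n by linarith+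
    have "A x c = 0" if "c \<in> P" for c by (rule sum_nonneg_0[OF fin(1) A_ge0 z(1) that])
    moreover have "1 - A x c = 0" if "c \<in> N" for c by (rule sum_nonneg_0[OF fin(2) _ z(2) that]) (simp add: A_le1)
    ultimately show ?thesis by simp
  qed
  have "11 - pp y z = (\<Sum>c<18. (1 - A y c) * A z c)"
    using y(6) unfolding pp_def rs_def by (simp add: left_diff_distrib sum_subtractf)
  also have "\<dots> \<le> (\<Sum>c<18. 1 - A y c - (if c \<in> P then 1 else 0))"
  proof (rule sum_mono)
    fix c show "(1 - A y c) * A z c \<le> 1 - A y c - (if c \<in> P then 1 else 0)"
      using PN[OF y(5)] PN[OF y(7)] A01[of y c] A01[of z c] by auto
  qed
  also have "\<dots> = 4" using y(4) fl(2,5) W by (simp add: sum_subtractf sum.If_cases Int_absorb1 rs_def)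
  finally have p7: "7 \<le> pp y z" by simp
  have "4 * pp y z - 2 = (\<Sum>c<18. 4 * (A y c * A z c) - (if c \<in> N then 1 else 0))"
    using fl(3,6) W unfolding pp_def by (simp add: sum_subtractf sum.If_cases Int_absorb1 sum_distrib_left)
  also have "\<dots> = (\<Sum>c<18. A y c * A z c * (e c + 4))"
    by (rule sum.cong) (use PN[OF y(5)] PN[OF y(7)] fl(1) in auto)
  also have "\<dots> = (\<Sum>c<18. \<Sum>x\<in>{..<12}-{y,z}. A y c * A z c * A x c)"
  proof (rule sum.cong)
    fix c
    have "(\<Sum>x<12. A x c) = (\<Sum>x\<in>{..<12}-{y,z}. A x c) + (A y c + A z c)"
      using sum.subset_diff[of "{y,z}" "{..<12}" "\<lambda>x. A x c"] y by auto
    then show "A y c * A z c * (e c + 4) = (\<Sum>x\<in>{..<12}-{y,z}. A y c * A z c * A x c)"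
      using A01[of y c] A01[of z c] by (auto simp: e_def sum_distrib_left[symmetric])
  qed simp
  also have "\<dots> = (\<Sum>x\<in>{..<12}-{y,z}. \<Sum>c<18. A y c * A z c * A x c)" by (rule sum.swap)
  also have "\<dots> \<le> (\<Sum>x\<in>{..<12}-{y,z}. 2)" by (intro sum_mono rows3) (use y in auto)
  also have "\<dots> = 20" using y by (simp add: card_Diff_subset)
  finally show False using p7 by simp
qed

theorem grid_False: False
proof -
  have V5: "V = 5" by (rule V_eq_5)
  have ps: "(\<Sum>y<12. psi y) = 2" using sum_psi V5 by simp
  have "\<exists>u<12. \<not> psi u \<le> 0"
  proof (rule ccontr)
    assume "\<not> ?thesis"
    then have "(\<Sum>y<12. psi y) \<le> 0" by (intro sum_nonpos) auto
    then show False using ps by simp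
  qed
  then obtain u where u: "u < 12" "rs u = 11" "eps u = -2" "psi u = 2" using V5_rows(1)[OF V5] by blast
  have le: "psi y \<le> 0" if "y \<in> {..<12} - {u}" for y
    using V5_rows(1)[OF V5, of y] two_eleven_rows[OF V5, of u y] u that by auto
  have "(\<Sum>y\<in>{..<12}-{u}. - psi y) = 0" using ps u by (simp add: sum_negf sum_diff1)
  then have z: "psi y = 0" if "y \<in> {..<12} - {u}" for y
    using sum_nonneg_0[of "{..<12}-{u}" "\<lambda>y. - psi y" y] le that by simp
  interpret exceptional_row A u
    by unfold_locales (use u V5 V_5_W V5_rows(2)[OF V5] z in auto)
  show False by (rule gridE_False)
qed

end

theorem lemma1:
  shows "\<not> (\<exists>A :: nat mat. A \<in> carrier_mat 12 18 \<and> binary_mat A \<and> K33_free A \<and> num_ones A = 109)"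
proof
  assume "\<exists>A :: nat mat. A \<in> carrier_mat 12 18 \<and> binary_mat A \<and> K33_free A \<and> num_ones A = 109"
  then obtain A :: "nat mat" where A: "A \<in> carrier_mat 12 18" "K33_free A" "num_ones A = 109" by blast
  have dim: "dim_row A = 12" "dim_col A = 18" using A(1) by auto
  let ?a = "\<lambda>i c. if A $$ (i, c) = 1 then 1 else 0 :: int"
  interpret K33_free_grid ?a
  proof
    fix I J :: "nat set"
    assume IJ: "I \<subseteq> {..<12}" "J \<subseteq> {..<18}" "card I = 3" "card J = 3" "\<And>i c. \<lbrakk>i \<in> I; c \<in> J\<rbrakk> \<Longrightarrow> ?a i c = 1"
    have "A $$ (i, c) = 1" if "i \<in> I" "c \<in> J" for i c
      by (rule ccontr) (use IJ(5)[OF that] in simp)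
    then have "I \<subseteq> {..<dim_row A} \<and> card I = 3 \<and> J \<subseteq> {..<dim_col A} \<and> card J = 3 \<and> (\<forall>i\<in>I. \<forall>j\<in>J. A $$ (i, j) = 1)"
      unfolding dim using IJ(1-4) by (intro conjI ballI)
    then show False using A(2) unfolding K33_free_def by (metis (no_types))
  next
    have "{(i, j). i < 12 \<and> j < 18 \<and> A $$ (i, j) = 1} = (SIGMA i:{..<12}. {c \<in> {..<18}. A $$ (i, c) = 1})"
      by auto
    then have "num_ones A = (\<Sum>i<12. card {c \<in> {..<18}. A $$ (i, c) = 1})"
      unfolding num_ones_def dim by simp
    then have "109 = (\<Sum>i<12. int (card {c \<in> {..<18}. A $$ (i, c) = 1}))"
      using A(3) by (simp flip: of_nat_sum)
    also have "\<dots> = (\<Sum>i<12. \<Sum>c<18. ?a i c)"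
      by (simp add: sum.If_cases Int_def)
    finally show "(\<Sum>i<12. \<Sum>c<18. ?a i c) = 109" by simp
  qed auto
  show False by (rule grid_False)
qed

end
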